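(* Let $\mu,\nu\in\mathbb{C}$. The following two pairs of (mutually inverse) series expansions hold. 1. For $x\in(2^{-1/2},1)$; also for $x=2^{-1/2}$ if $\operatorname{Re}\nu>-2/3$; and for all $x\in(0,1)$ if $\nu-\mu\in\mathbb{N}_0$: $$\frac{P_\nu^{-\mu}(x)}{(1+x)^\mu}=\sum_{n=0}^\infty\frac{(-1)^n(\mu-\nu)_n\,\mathfrak{p}_n\left(-\frac\nu2,2\mu,1\right)}{2^{\mu-n}\,x^{n+\mu-\nu}\,(1-x^2)^{-\frac n2}}\,P_{\nu-\mu-n}^{-\mu-n}\!\left(\frac1x\right),$$ and for $x\in(0,1)$: $$\frac{P_{\nu-\mu}^{-\mu}\left(\frac1x\right)}{2^\mu x^{\mu-\nu}}=\sum_{n=0}^\infty(-1)^n(\mu-\nu)_n\,g_n(\nu,-2\mu)\,\frac{(1-x)^{\frac n2}P_\nu^{-\mu-n}(x)}{(1+x)^{\frac n2+\mu}}.$$ 2. For $x\in(0,1)$: $$\frac{x^\nu P_\nu^{-\mu}\left(\frac1x\right)}{(1+x)^\mu}=\sum_{n=0}^\infty\frac{(\mu-\nu)_n\,\mathfrak{p}_n\left(-\frac\nu2,2\mu,1\right)}{2^{\mu-n}(1-x^2)^{-\frac n2}}\,P_{\nu-\mu-n}^{-n-\mu}(x),$$ $$\frac{P_{\nu-\mu}^{-\mu}(x)}{2^\mu x^\nu}=\sum_{n=0}^\infty(\mu-\nu)_n\,g_n(\nu,-2\mu)\,\frac{(1-x)^{\frac n2}P_\nu^{-n-\mu}\left(\frac1x\right)}{(1+x)^{\frac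 n2+\mu}}.$$
   Context: $\mathbb{N}_0=\{0,1,2,\dots\}$; $(a)_n=a(a+1)\cdots(a+n-1)$, $(a)_0=1$. The polynomials $\mathfrak{p}_n(\rho,\tau,t)$ are defined by $$(1-zt)^{-\rho}\left(1+\sqrt{1-z}\right)^{-\tau}=2^{-\tau}\sum_{n=0}^\infty\mathfrak{p}_n(\rho,\tau,t)\,z^n\qquad(|z|\text{ small}),$$ and the polynomials $g_n(\tau,r)$ (two arguments) by $$(1+u)^{\tau+r}(1-u)^{-\tau}=\sum_{n=0}^\infty g_n(\tau,r)\,u^n,\qquad|u|<1.$$ For $\mu,\nu\in\mathbb{C}$ and real $x>-1$, $x\ne1$, $$P_\nu^{-\mu}(x)=\left|\frac{1-x}{1+x}\right|^{\mu/2}\frac{F\left(-\nu,\nu+1;1+\mu;\frac{1-x}{2}\right)}{\Gamma(1+\mu)},$$ where $F(a,b;c;t)$ is the Gauss hypergeometric function (analytically continued to $t\le-1$), and $F(a,b;c;t)/\Gamma(c)$ is understood as the regularized function, entire in $a,b,c$. For $|x|<1$ this is the Ferrers function, for $x>1$ the associated Legendre function of the first kind. *)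

theory Defs
  imports "HOL-Analysis.Analysis"
begin

text \<open>
  The regularized Gauss series, i.e. the series of \<open>F(a,b;c;z) / \<Gamma>(c)\<close>, which is entire in
  \<open>a\<close>, \<open>b\<close>, \<open>c\<close>: since \<open>\<Gamma>(c) (c)\<^sub>n = \<Gamma>(c + n)\<close>, the quotient \<open>1 / (\<Gamma>(c) (c)\<^sub>n)\<close> is
  \<open>rGamma (c + n)\<close>, also when \<open>c\<close> is a non-positive integer.
\<close>

definition hypergeo_reg_series :: "complex \<Rightarrow> complex \<Rightarrow> complex \<Rightarrow> complex \<Rightarrow> complex" where
  "hypergeo_reg_series a b c z =
     (\<Sum>n. pochhammer a n * pochhammer b n * rGamma (c + of_nat n) / fact n * z ^ n)"

text \<open>
  The analytic continuation of this series along the straight segment from \<open>0\<close> to \<open>z\<close>: the value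
  at \<open>z\<close> of a function that is holomorphic on a convex open set containing \<open>0\<close> and \<open>z\<close> and is
  given by the series near \<open>0\<close>.  By the identity theorem on the (convex) intersection of two
  such sets, the value does not depend on the choice of \<open>S\<close> and \<open>f\<close>.  It exists for every \<open>z\<close>
  outside the cut \<open>[1, \<infinity>)\<close>, where it is the principal branch; for \<open>\<bar>z\<bar> < 1\<close> it is the sum of
  the series.
\<close>

definition hypergeo_reg :: "complex \<Rightarrow> complex \<Rightarrow> complex \<Rightarrow> complex \<Rightarrow> complex" where
  "hypergeo_reg a b c z =
     (THE v. \<exists>S f. open S \<and> convex S \<and> 0 \<in> S \<and> z \<in> S \<and> f holomorphic_on S \<and>
                 (\<forall>\<^sub>F w in nhds 0. f w = hypergeo_reg_series a b c w) \<and> v = f z)"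

text \<open>
  \<open>legendre_P \<nu> m x\<close> is \<open>P\<^sub>\<nu>\<^sup>m(x)\<close> with upper index \<open>m\<close>, so that the function written
  \<open>P\<^sub>\<nu>\<close> with upper index \<open>-\<mu>\<close> is \<open>legendre_P \<nu> (-\<mu>) x\<close>.  It is the Ferrers function for
  \<open>\<bar>x\<bar> < 1\<close> and the associated Legendre function of the first kind for \<open>x > 1\<close>; it is meant
  for real \<open>x > -1\<close>, \<open>x \<noteq> 1\<close> only.
\<close>

definition legendre_P :: "complex \<Rightarrow> complex \<Rightarrow> real \<Rightarrow> complex" where
  "legendre_P \<nu> m x =
     of_real \<bar>(1 - x) / (1 + x)\<bar> powr (- m / 2) *
     hypergeo_reg (- \<nu>) (\<nu> + 1) (1 - m) (of_real ((1 - x) / 2))"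

text \<open>
  The polynomials given by generating functions are the sequences of coefficients of the
  respective power series; all powers are principal.
\<close>

definition gen_p :: "nat \<Rightarrow> complex \<Rightarrow> complex \<Rightarrow> complex \<Rightarrow> complex" where
  "gen_p n \<rho> \<tau> t =
     (THE p :: nat \<Rightarrow> complex. \<forall>\<^sub>F z in nhds 0.
        (\<lambda>k. 2 powr (- \<tau>) * (p k * z ^ k)) sums
          ((1 - z * t) powr (- \<rho>) * (1 + csqrt (1 - z)) powr (- \<tau>))) n"

definition gen_g :: "nat \<Rightarrow> complex \<Rightarrow> complex \<Rightarrow> complex" where
  "gen_g n \<tau> r =
     (THE g :: nat \<Rightarrow> complex. \<forall>u. norm u < 1 \<longrightarrow>
        (\<lambda>k. g k * u ^ k) sums ((1 + u) powr (\<tau> + r) * (1 - u) powr (- \<tau>))) n"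

end

theory Submission
  imports Defs "HOL-Complex_Analysis.Complex_Analysis"
begin

text \<open>
  Put \<open>w = (1 - x) / (1 + x)\<close> and write \<open>\<Phi>(a, b; c; z)\<close> for the regularized Gauss series.  Pfaff's
  transformation turns every Legendre function that occurs into an elementary factor times a series
  \<open>\<Phi>\<close> at \<open>w\<close> or \<open>-w\<close> (\<open>legendre_P_less_1\<close>, \<open>legendre_P_greater_1\<close>), and the elementary factors combine to a
  common constant times the \<open>n\<close>-th power of \<open>\<plusminus>w\<close> or \<open>\<plusminus>4w\<close>.  Two expansions of power series in \<open>u\<close> remain;
  each is used once at \<open>u = w\<close> and once at \<open>u = -w\<close>.

  Let \<open>L\<close> be the linear map that multiplies the coefficient of \<open>u\<^sup>N\<close> by \<open>(\<mu> - \<nu>)\<^sub>N / \<Gamma>(1 + \<mu> + N)\<close>.  Since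
  \<open>(b)\<^bsub>n + k\<^esub> = (b)\<^sub>n (b + n)\<^sub>k\<close>, it sends \<open>u\<^sup>n\<close> times a power of \<open>1 \<plusminus> u\<close> to \<open>(\<mu> - \<nu>)\<^sub>n u\<^sup>n\<close> times a
  series \<open>\<Phi>\<close> with shifted parameters.  The expansions in \<open>g\<^sub>n\<close> result from applying \<open>L\<close> to the definition
  of \<open>g\<^sub>n\<close>, multiplied by \<open>(1 - u)\<^sup>\<nu>\<close> (\<open>gen_g_expansion\<close>).  For the expansions in \<open>\<pp>\<^sub>n\<close> put
  \<open>z = 4u / (1 + u)\<^sup>2\<close>.  Then \<open>\<surd>(1 - z) = (1 - u) / (1 + u)\<close>, the generating function of the \<open>\<pp>\<^sub>n\<close> becomes the
  reciprocal of that of the \<open>g\<^sub>n\<close>, and \<open>(1 - u)\<^sup>\<nu>\<close> is the sum of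
  \<open>\<pp>\<^sub>n (4u)\<^sup>n (1 + u)\<^bsup>\<nu> - 2\<mu> - 2n\<^esup>\<close>, to which \<open>L\<close> is applied (\<open>gen_p_expansion_near_0\<close>).

  In the first case the rearrangement is absolutely convergent for \<open>\<bar>u\<bar> < 1\<close>, in the second only for small
  \<open>u\<close>.  There the quadratic transformation (\<open>hypergeo_reg_series_quadratic\<close>, which rests on the
  Pfaff--Saalschuetz sum) rewrites the \<open>n\<close>-th term as a common factor times
  \<open>(\<mu> - \<nu>)\<^sub>n \<pp>\<^sub>n z\<^sup>n \<Phi>(\<mu> - \<nu>/2 + n, (1 + \<nu>)/2; 1 + \<mu> + n; z)\<close>.  This series converges locally uniformly for
  \<open>\<bar>z\<bar> < 1\<close>, and the identity theorem gives the expansion there (\<open>gen_p_expansion\<close>).  Now \<open>u = w\<close> gives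
  \<open>z = 1 - x\<^sup>2\<close>, which is always admissible, while \<open>u = -w\<close> gives \<open>z = -(1 - x\<^sup>2) / x\<^sup>2\<close>, which is admissible for
  \<open>x > 1 / \<surd>2\<close>.  If \<open>\<nu> - \<mu>\<close> is a natural number, all sums are finite and every \<open>x\<close> in \<open>(0, 1)\<close> is admissible
  (\<open>gen_p_expansion_terminating\<close>).

  At \<open>x = 1 / \<surd>2\<close>, that is \<open>z = -1\<close>, the terms are at most of the order of \<open>\<pp>\<^sub>n n\<^bsup>-Re \<nu> - 1\<^esup>\<close>,
  uniformly for \<open>z\<close> in \<open>(-1, 0)\<close>, and \<open>\<pp>\<^sub>n\<close> is the convolution of a sequence of the order of
  \<open>n\<^bsup>-Re \<nu> / 2 - 1\<^esup>\<close> with an absolutely summable one.  For \<open>Re \<nu> > -2/3\<close> this is a summable majorant, and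
  the expansion passes to the limit (\<open>gen_p_expansion_boundary\<close>).
\<close>

section \<open>Growth of Pochhammer symbols and of the reciprocal Gamma function\<close>

lemma pochhammer_nonneg_real: "0 \<le> pochhammer a n" if "0 \<le> a" for a :: real
  using that by (induction n) (auto simp: pochhammer_Suc)

lemma norm_pochhammer_le:
  fixes a :: complex
  shows "norm (pochhammer a n) \<le> pochhammer (norm a) n"
proof (induction n)
  case (Suc n)
  have "norm (a + of_nat n) \<le> norm a + of_nat n"
    by (metis norm_of_nat norm_triangle_ineq)
  then show ?case
    using Suc by (auto simp: pochhammer_Suc norm_mult intro!: mult_mono pochhammer_nonneg_real)
qed simp

lemma pochhammer_mono_real:
  fixes a b :: real
  assumes "0 \<le> a" "a \<le> b"
  shows "pochhammer a n \<le> pochhammer b n"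
proof (induction n)
  case (Suc n)
  have "0 \<le> pochhammer b n"
    using assms by (intro pochhammer_nonneg_real) auto
  with Suc assms show ?case
    by (auto simp: pochhammer_Suc intro!: mult_mono)
qed simp

lemma rGamma_series_norm_eq:
  fixes a :: complex
  assumes "n > 0"
  shows "norm (rGamma_series a n) = norm (pochhammer a (Suc n)) / (fact n * real n powr Re a)"
  using assms by (simp add: rGamma_series_def norm_divide norm_mult powr_def mult.commute)

lemma powr_Suc_le:
  assumes "n > 0"
  shows "real n powr s \<le> 2 powr \<bar>s\<bar> * real (n + 1) powr s"
proof (cases "s \<ge> 0")
  case True
  then have "real n powr s \<le> 1 * real (n + 1) powr s"
    by (simp add: powr_mono2)
  also have "\<dots> \<le> 2 powr \<bar>s\<bar> * real (n + 1) powr s"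
    by (intro mult_right_mono) (auto simp: ge_one_powr_ge_zero)
  finally show ?thesis .
next
  case False
  then have "(real (n + 1) / 2) powr (- s) \<le> real n powr (- s)"
    using assms by (intro powr_mono2) auto
  then have "real (n + 1) powr (- s) / 2 powr (- s) \<le> real n powr (- s)"
    by (simp add: powr_divide)
  with False assms show ?thesis
    by (simp add: powr_minus field_simps)
qed

text \<open>
  Gauss's product \<^const>\<open>rGamma_series\<close> converges, hence is bounded; its \<open>n\<close>-th term is, up to a
  shift of \<open>n\<close>, a Pochhammer symbol divided by the claimed order of growth.
\<close>

lemma pochhammer_growth:
  fixes a :: complex
  shows "\<exists>C>0. \<forall>n. norm (pochhammer a n) \<le> C * fact n * real (n + 1) powr (Re a - 1)"
proof -
  have "Bseq (rGamma_series a)"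
    using rGamma_series_LIMSEQ convergent_def by (blast intro: convergent_imp_Bseq)
  then obtain K where K: "K > 0" "\<And>n. norm (rGamma_series a n) \<le> K"
    by (auto simp: Bseq_def)
  define D where "D = 2 powr \<bar>Re a\<bar> * 2 powr \<bar>Re a - 1\<bar>"
  define C where "C = max (max 1 (norm a * 2 powr \<bar>Re a - 1\<bar>)) (K * D)"
  have "norm (pochhammer a n) \<le> C * fact n * real (n + 1) powr (Re a - 1)" for n
  proof -
    \<comment> \<open>The bounded series starts usefully at index \<open>1\<close>, that is with the Pochhammer symbol of index \<open>2\<close>.\<close>
    consider "n = 0" | "n = 1" | m where "n = Suc m" "m > 0"
      by (metis One_nat_def neq0_conv old.nat.exhaust)
    then show ?thesis
    proof cases
      case 2
      have "norm a * 1 \<le> norm a * (2 powr \<bar>Re a - 1\<bar> * 2 powr (Re a - 1))"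
        by (intro mult_left_mono) (auto simp: powr_add [symmetric] ge_one_powr_ge_zero)
      also have "\<dots> \<le> C * 2 powr (Re a - 1)"
        unfolding C_def by (simp add: mult.assoc[symmetric])
      finally show ?thesis using 2 by simp
    next
      case (3 m)
      have "norm (pochhammer a (Suc m)) \<le> K * (fact m * real m powr Re a)"
        using K(2)[of m] 3 by (simp add: rGamma_series_norm_eq divide_simps mult_ac)
      also have "\<dots> \<le> K * (fact m * (2 powr \<bar>Re a\<bar> * real (m + 1) powr Re a))"
        using K(1) 3 by (intro mult_left_mono powr_Suc_le) auto
      also have "\<dots> = K * (2 powr \<bar>Re a\<bar> * (fact (Suc m) * real (m + 1) powr (Re a - 1)))"
        by (simp add: powr_diff)
      also have "\<dots> \<le> K * (2 powr \<bar>Re a\<bar> * (fact (Suc m) *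
                          (2 powr \<bar>Re a - 1\<bar> * real (m + 1 + 1) powr (Re a - 1))))"
        using K(1) by (intro mult_left_mono powr_Suc_le) auto
      also have "\<dots> = K * D * (fact (Suc m) * real (m + 1 + 1) powr (Re a - 1))"
        by (simp add: D_def mult_ac)
      also have "\<dots> \<le> C * (fact (Suc m) * real (m + 1 + 1) powr (Re a - 1))"
        by (intro mult_right_mono) (auto simp: C_def)
      finally show ?thesis using 3 by (simp add: mult_ac)
    qed (auto simp: C_def)
  qed
  moreover have "C > 0" by (auto simp: C_def less_max_iff_disj)
  ultimately show ?thesis by blast
qed

text \<open>
  For \<open>Re c > 0\<close> the value \<open>rGamma (c + n)\<close> is \<open>rGamma c\<close> divided by the Pochhammer symbol, and
  Gauss's product, \<^const>\<open>Gamma_series\<close>, being convergent, bounds that symbol from below.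
\<close>

lemma rGamma_growth_pos:
  fixes c :: complex
  assumes "Re c > 0"
  shows "\<exists>C>0. \<forall>n. norm (rGamma (c + of_nat n)) \<le> C * real (n + 1) powr (1 - Re c) / fact n"
proof -
  have nz: "c \<notin> \<int>\<^sub>\<le>\<^sub>0" using assms by (auto elim!: nonpos_Ints_cases)
  have "Bseq (Gamma_series c)"
    using Gamma_series_LIMSEQ convergent_def by (blast intro: convergent_imp_Bseq)
  then obtain K where K: "K > 0" "\<And>n. norm (Gamma_series c n) \<le> K"
    by (auto simp: Bseq_def)
  have nzp: "pochhammer c n \<noteq> 0" for n
    using nz by (auto simp: pochhammer_eq_0_iff)
  have cn: "c + of_nat n \<noteq> 0" for n
  proof
    assume "c + of_nat n = 0"
    then have "Re (c + of_nat n) = 0" by simp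
    then show False using assms by simp
  qed
  define D where "D = K * norm (rGamma c) * (norm c + 1) * 2 powr \<bar>-Re c\<bar>"
  define C where "C = max (D + 1) (norm (rGamma c))"
  have "norm (rGamma (c + of_nat n)) \<le> C * real (n + 1) powr (1 - Re c) / fact n" for n
  proof (cases "n = 0")
    case False
    have "1 / norm (pochhammer c (Suc n)) = norm (Gamma_series c n) / (fact n * real n powr Re c)"
      using False by (simp add: Gamma_series_altdef norm_inverse rGamma_series_norm_eq)
    also have "\<dots> \<le> K / (fact n * real n powr Re c)"
      by (intro divide_right_mono K) auto
    finally have 1: "1 / norm (pochhammer c (Suc n)) \<le> K / (fact n * real n powr Re c)" .
    have "norm (rGamma (c + of_nat n)) = norm (rGamma c) * norm (c + of_nat n) * (1 / norm (pochhammer c (Suc n)))"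
      using pochhammer_rGamma[of c n] nzp[of n] cn[of n]
      by (simp add: norm_mult pochhammer_Suc)
    also have "\<dots> \<le> norm (rGamma c) * norm (c + of_nat n) * (K / (fact n * real n powr Re c))"
      by (intro mult_left_mono 1) auto
    also have "\<dots> = norm (rGamma c) * norm (c + of_nat n) * (K / fact n * real n powr (- Re c))"
      by (simp add: powr_minus field_simps)
    also have "\<dots> \<le> norm (rGamma c) * norm (c + of_nat n) * (K / fact n * (2 powr \<bar>- Re c\<bar> * real (n + 1) powr (- Re c)))"
      using K(1) False by (intro mult_left_mono powr_Suc_le) auto
    also have "\<dots> \<le> norm (rGamma c) * ((norm c + 1) * real (n + 1)) * (K / fact n * (2 powr \<bar>- Re c\<bar> * real (n + 1) powr (- Re c)))"
    proof (intro mult_right_mono mult_left_mono)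
      have "norm (c + of_nat n) \<le> norm c + real n"
        by (metis norm_of_nat norm_triangle_ineq)
      also have "\<dots> \<le> (norm c + 1) * real (n + 1)" by (simp add: algebra_simps)
      finally show "norm (c + of_nat n) \<le> (norm c + 1) * real (n + 1)" .
    qed (use K(1) in auto)
    also have "\<dots> = D * (real (n + 1) powr (1 - Re c) / fact n)"
      by (simp add: D_def powr_diff powr_minus divide_inverse mult_ac)
    also have "\<dots> \<le> C * (real (n + 1) powr (1 - Re c) / fact n)"
      by (intro mult_right_mono) (auto simp: C_def)
    finally show ?thesis by simp
  qed (auto simp: C_def)
  moreover have "C > 0"
    using K(1) by (auto simp: C_def D_def less_max_iff_disj intro!: add_nonneg_pos)
  ultimately show ?thesis by blast
qed

text \<open>
  The recurrence of \<^const>\<open>rGamma\<close> carries the bound from \<open>c + 1\<close> to \<open>c\<close>, which removes the restriction to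
  the right half-plane and covers the poles of the Gamma function.
\<close>

lemma rGamma_growth:
  fixes c :: complex
  shows "\<exists>C>0. \<forall>n. norm (rGamma (c + of_nat n)) \<le> C * real (n + 1) powr (1 - Re c) / fact n"
proof -
  have "\<exists>C>0. \<forall>n. norm (rGamma (c + of_nat n)) \<le> C * real (n + 1) powr (1 - Re c) / fact n"
    if "Re c + real m > 0" for m c
    using that
  proof (induction m arbitrary: c)
    case 0
    then show ?case using rGamma_growth_pos by simp
  next
    case (Suc m)
    then have "Re (c + 1) + real m > 0" by simp
    from Suc.IH[OF this] obtain C where C: "C > 0"
      "\<And>n. norm (rGamma (c + 1 + of_nat n)) \<le> C * real (n + 1) powr (1 - Re (c + 1)) / fact n"
      by blast
    have "norm (rGamma (c + of_nat n)) \<le> ((norm c + 1) * C) * real (n + 1) powr (1 - Re c) / fact n" for n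
    proof -
      have "norm (c + of_nat n) \<le> norm c + real n"
        by (metis norm_of_nat norm_triangle_ineq)
      also have "\<dots> \<le> (norm c + 1) * real (n + 1)" by (simp add: algebra_simps)
      finally have 1: "norm (c + of_nat n) \<le> (norm c + 1) * real (n + 1)" .
      have "norm (rGamma (c + of_nat n)) = norm (c + of_nat n) * norm (rGamma (c + 1 + of_nat n))"
        using rGamma_plus1[of "c + of_nat n"] by (metis (no_types, lifting) add.assoc add.commute norm_mult)
      also have "\<dots> \<le> ((norm c + 1) * real (n + 1)) * (C * real (n + 1) powr (1 - Re (c + 1)) / fact n)"
        by (intro mult_mono 1 C) auto
      also have "\<dots> = ((norm c + 1) * C) * real (n + 1) powr (1 - Re c) / fact n"
        by (simp add: powr_diff powr_minus divide_simps)
      finally show ?thesis .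
    qed
    moreover have "(norm c + 1) * C > 0" using C(1) by (intro mult_pos_pos) (auto intro: add_nonneg_pos)
    ultimately show ?case by blast
  qed
  moreover obtain m :: nat where "Re c + real m > 0"
    by (metis add.commute diff_less_eq minus_real_def diff_0 reals_Archimedean2 less_diff_eq add.left_neutral)
  ultimately show ?thesis by blast
qed

text \<open>
  Separates the two indices of a double series in a weight of polynomial growth.  The factor in \<open>n\<close>
  keeps its sharp exponent.
\<close>

lemma powr_sum_le:
  "real (n + k + 1) powr s \<le> real (n + 1) powr s * real (k + 1) powr \<bar>s\<bar>"
proof (cases "s \<ge> 0")
  case True
  have "real (n + k + 1) \<le> real (n + 1) * real (k + 1)" by (simp add: algebra_simps)
  then have "real (n + k + 1) powr s \<le> (real (n + 1) * real (k + 1)) powr s"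
    using True by (intro powr_mono2) auto
  then show ?thesis using True by (simp add: powr_mult)
next
  case False
  then have "real (n + k + 1) powr s \<le> real (n + 1) powr s * 1"
    by (simp add: powr_mono2')
  also have "\<dots> \<le> real (n + 1) powr s * real (k + 1) powr \<bar>s\<bar>"
    by (intro mult_left_mono) (auto intro: ge_one_powr_ge_zero)
  finally show ?thesis .
qed

lemma summable_powr_geometric:
  fixes r :: real
  assumes "0 \<le> r" "r < 1"
  shows "summable (\<lambda>n. real (n + 1) powr K * r ^ n)"
proof (cases "r = 0")
  case True
  have "summable (\<lambda>n. if n = 0 then (1::real) else 0)" by simp
  moreover have "(\<lambda>n. if n = 0 then (1::real) else 0) = (\<lambda>n. real (n + 1) powr K * r ^ n)"
    using True by (auto simp: power_0_left)
  ultimately show ?thesis by simp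
next
  case False
  define q where "q = (1 + r) / 2"
  have q: "r < q" "q < 1" "0 < q" using assms by (auto simp: q_def)
  have "(\<lambda>n. real (n + 1) powr K * (r / q) ^ n) \<longlonglongrightarrow> 0"
  proof -
    define s where "s = r / q"
    have "0 < s" "s < 1" using False assms q by (auto simp: s_def)
    then have "(\<lambda>n. real (n + 1) powr K * s ^ n) \<longlonglongrightarrow> 0" by real_asymp
    then show ?thesis by (simp add: s_def)
  qed
  then have "Bseq (\<lambda>n. real (n + 1) powr K * (r / q) ^ n)"
    using convergent_def by (blast intro: convergent_imp_Bseq)
  then obtain B where B: "B > 0" "\<And>n. norm (real (n + 1) powr K * (r / q) ^ n) \<le> B"
    by (auto simp: Bseq_def)
  show ?thesis
  proof (rule summable_comparison_test')
    show "summable (\<lambda>n. B * q ^ n)" using q by (intro summable_mult summable_geometric) auto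
    fix n :: nat assume "n \<ge> 0"
    have "norm (real (n + 1) powr K * r ^ n) = norm (real (n + 1) powr K * (r / q) ^ n) * q ^ n"
      using q assms by (simp add: power_divide abs_mult)
    also have "\<dots> \<le> B * q ^ n" using q by (intro mult_right_mono B) auto
    finally show "norm (real (n + 1) powr K * r ^ n) \<le> B * q ^ n" .
  qed
qed

section \<open>Summation along diagonals\<close>

text \<open>
  Fubini for absolutely convergent double series, summed once by rows and once by diagonals.  A
  majorant of product form is all that the expansions below require.
\<close>

lemma double_series_diagonal:
  fixes f :: "nat \<Rightarrow> nat \<Rightarrow> 'a :: banach"
  assumes le: "\<And>n k. norm (f n k) \<le> A n * B k"
      and A: "summable A" and B: "summable B" and nn: "\<And>n. 0 \<le> A n" "\<And>k. 0 \<le> B k"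
  shows "\<And>n. summable (f n)"
    and "(\<lambda>n. \<Sum>k. f n k) sums (\<Sum>N. \<Sum>n\<le>N. f n (N - n))"
    and "summable (\<lambda>N. \<Sum>n\<le>N. f n (N - n))"
proof -
  have sA: "A summable_on UNIV" and sB: "B summable_on UNIV"
    using A B nn by (auto intro!: norm_summable_imp_summable_on)
  have "((\<lambda>k. A n * B k) has_sum A n * (\<Sum>\<^sub>\<infinity>k. B k)) UNIV" for n
    by (intro has_sum_cmult_right has_sum_infsum sB)
  then have "(\<lambda>(n,k). A n * B k) summable_on UNIV \<times> UNIV"
    by (intro summable_on_SigmaI[where g = "\<lambda>n. A n * (\<Sum>\<^sub>\<infinity>k. B k)"] summable_on_cmult_left sA)
       (auto simp: nn)
  then have "(\<lambda>x. norm (case x of (n, k) \<Rightarrow> f n k)) summable_on UNIV \<times> UNIV"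
  proof (rule Infinite_Sum.abs_summable_on_comparison_test')
    show "norm (case x of (n, k) \<Rightarrow> f n k) \<le> (case x of (n, k) \<Rightarrow> A n * B k)" for x
      using le by (cases x) simp
  qed
  then have sf: "(\<lambda>(n,k). f n k) summable_on UNIV \<times> UNIV"
    by (rule abs_summable_summable)
  then obtain S where S: "((\<lambda>(n,k). f n k) has_sum S) (UNIV \<times> UNIV)"
    by (auto simp: summable_on_def)
  have nf: "summable (\<lambda>k. norm (f n k))" for n
    by (rule summable_comparison_test'[OF summable_mult[OF B, of "A n"], of 0]) (auto intro: le)
  then show s: "summable (f n)" for n by (rule summable_norm_cancel)
  have "(f n has_sum (\<Sum>k. f n k)) UNIV" for n
    by (rule norm_summable_imp_has_sum[OF nf]) (rule summable_sums[OF s])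
  then have "((\<lambda>n. \<Sum>k. f n k) has_sum S) UNIV"
    using has_sum_SigmaD[OF S, of "\<lambda>n. \<Sum>k. f n k"] by simp
  then have 1: "(\<lambda>n. \<Sum>k. f n k) sums S" by (rule has_sum_imp_sums)
  have "((\<lambda>(N,n). f n (N - n)) has_sum S) (SIGMA N:UNIV. {..N})"
    using S by (subst has_sum_reindex_bij_witness[of _ "\<lambda>(n,k). (n+k,n)" "\<lambda>(N,n). (n, N-n)"
                        "UNIV \<times> UNIV" "\<lambda>(n,k). f n k" _ S S]) auto
  then have "((\<lambda>N. \<Sum>n\<le>N. f n (N - n)) has_sum S) UNIV"
    by (rule has_sum_SigmaD) (auto intro!: has_sum_finite)
  then have 2: "(\<lambda>N. \<Sum>n\<le>N. f n (N - n)) sums S" by (rule has_sum_imp_sums)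
  show "(\<lambda>n. \<Sum>k. f n k) sums (\<Sum>N. \<Sum>n\<le>N. f n (N - n))" using 1 2 by (simp add: sums_iff)
  show "summable (\<lambda>N. \<Sum>n\<le>N. f n (N - n))" using 2 by (simp add: sums_iff)
qed

section \<open>Finite hypergeometric sums\<close>

lemma pochhammer_reflect:
  fixes x :: "'a :: comm_ring_1"
  shows "pochhammer (1 - x - of_nat n) n = (-1) ^ n * pochhammer x n"
  using pochhammer_minus[of "x + of_nat n - 1" n] by (simp add: algebra_simps)

text \<open>
  The Chu--Vandermonde sum, cleared of denominators so that no parameter has to be excluded: it is
  the binomial theorem for Pochhammer symbols, with the second symbol read backwards.
\<close>

lemma vandermonde_sum:
  fixes a c :: "'a :: field_char_0"
  shows "(\<Sum>k\<le>N. of_nat (N choose k) * pochhammer (c - a) k * (-1) ^ k * pochhammer (c + of_nat k) (N - k))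
         = pochhammer a N"
proof -
  have "pochhammer (c - a + (1 - c - of_nat N)) N =
     (\<Sum>k\<le>N. of_nat (N choose k) * pochhammer (c - a) k * pochhammer (1 - c - of_nat N) (N - k))"
    by (rule pochhammer_binomial_sum)
  also have "\<dots> = (-1) ^ N * (\<Sum>k\<le>N. of_nat (N choose k) * pochhammer (c - a) k * (-1) ^ k
                                 * pochhammer (c + of_nat k) (N - k))"
    unfolding sum_distrib_left
  proof (rule sum.cong[OF refl])
    fix k assume "k \<in> {..N}"
    then have k: "k \<le> N" by simp
    have "pochhammer (1 - c - of_nat N) (N - k) = (-1) ^ (N - k) * pochhammer (c + of_nat k) (N - k)"
    proof -
      have "1 - (c + of_nat k) - of_nat (N - k) = 1 - c - of_nat N"
        using k by (simp add: of_nat_diff)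
      with pochhammer_reflect[of "c + of_nat k" "N - k"] show ?thesis by metis
    qed
    moreover have "(-1) ^ (N - k) = ((-1) ^ N * (-1) ^ k :: 'a)"
      using k by (simp add: minus_one_power_iff)
    ultimately show "of_nat (N choose k) * pochhammer (c - a) k * pochhammer (1 - c - of_nat N) (N - k) =
      (-1) ^ N * (of_nat (N choose k) * pochhammer (c - a) k * (-1) ^ k * pochhammer (c + of_nat k) (N - k))"
      by (simp add: mult_ac)
  qed
  finally have "(-1) ^ N * pochhammer a N = (-1) ^ N * (\<Sum>k\<le>N. of_nat (N choose k) * pochhammer (c - a) k * (-1) ^ k
                                 * pochhammer (c + of_nat k) (N - k))"
    using pochhammer_reflect[of a N] by (simp add: algebra_simps)
  then show ?thesis by simp
qed

lemma sum_choose_Suc: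
  fixes f :: "nat \<Rightarrow> 'a :: comm_ring_1"
  shows "(\<Sum>j\<le>Suc N. of_nat (Suc N choose j) * f j) =
         (\<Sum>j\<le>N. of_nat (N choose j) * (f j + f (Suc j)))"
proof -
  have "(\<Sum>j\<le>Suc N. of_nat (Suc N choose j) * f j) =
        f 0 + (\<Sum>j\<le>N. of_nat (N choose j) * f (Suc j)) + (\<Sum>j\<le>N. of_nat (N choose Suc j) * f (Suc j))"
    by (subst sum.atMost_Suc_shift) (simp add: algebra_simps sum.distrib)
  also have "\<dots> = (f 0 + (\<Sum>j\<le>N. of_nat (N choose Suc j) * f (Suc j))) + (\<Sum>j\<le>N. of_nat (N choose j) * f (Suc j))"
    by (simp only: add_ac)
  also have "f 0 + (\<Sum>j\<le>N. of_nat (N choose Suc j) * f (Suc j)) = (\<Sum>j\<le>Suc N. of_nat (N choose j) * f j)"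
    by (subst sum.atMost_Suc_shift) simp
  also have "\<dots> = (\<Sum>j\<le>N. of_nat (N choose j) * f j)"
    by (simp add: binomial_eq_0)
  also have "\<dots> + (\<Sum>j\<le>N. of_nat (N choose j) * f (Suc j)) = (\<Sum>j\<le>N. of_nat (N choose j) * (f j + f (Suc j)))"
    by (simp add: algebra_simps sum.distrib)
  finally show ?thesis .
qed

text \<open>
  The left-hand side of the Pfaff--Saalschuetz summation theorem, multiplied by
  \<open>(c)\<^sub>N (c - a - b)\<^sub>N\<close>, so that it is a polynomial in the parameters.
\<close>

definition saalschuetz_sum :: "nat \<Rightarrow> 'a :: comm_ring_1 \<Rightarrow> 'a \<Rightarrow> 'a \<Rightarrow> 'a" where
  "saalschuetz_sum N a b c = (\<Sum>j\<le>N. of_nat (N choose j) * (pochhammer a j * pochhammer b j *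
       pochhammer (c + of_nat j) (N - j) * pochhammer (c - a - b) (N - j)))"

text \<open>
  By Pascal's rule and a term-by-term comparison, passing from \<open>N\<close> to \<open>N + 1\<close> multiplies the sum by the
  expected factor, up to the difference of two sums of the same kind with shifted parameters.  Both
  of these have the same product form, so the difference vanishes in the induction that follows.
\<close>

lemma saalschuetz_sum_Suc:
  fixes a b c :: "'a :: comm_ring_1"
  shows "saalschuetz_sum (Suc N) a b c = (c - a + of_nat N) * (c - b + of_nat N) * saalschuetz_sum N a b c +
     of_nat N * a * b * (c - a - b) * (saalschuetz_sum (N - 1) a b (c + 1) - saalschuetz_sum (N - 1) (a + 1) (b + 1) (c + 2))"
proof -
  define e where "e = c - a - b"
  have e1: "c + 1 - a - b = e + 1" and e2: "c + 2 - (a + 1) - (b + 1) = e"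
    by (simp_all add: e_def)
  define Y where "Y j = pochhammer a j * pochhammer b j * pochhammer e (N - j)" for j
  define X where "X j = pochhammer a j * pochhammer b j * pochhammer (c + of_nat j) (Suc N - j) * pochhammer e (Suc N - j)" for j
  have key: "X j + X (Suc j) = (c - a + of_nat N) * (c - b + of_nat N) * (Y j * pochhammer (c + of_nat j) (N - j))
      + Y j * (of_nat (N - j) * a * b * pochhammer (c + 1 + of_nat j) (N - 1 - j)
              - of_nat j * e * pochhammer (c + 1 + of_nat j) (N - j))" if "j \<le> N" for j
  proof (cases "j = N")
    case True
    have "X j + X (Suc j) = Y j * ((c + of_nat N) * e + (a + of_nat N) * (b + of_nat N))"
      using True by (simp add: X_def Y_def pochhammer_Suc algebra_simps)
    also have "(c + of_nat N) * e + (a + of_nat N) * (b + of_nat N) =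
               (c - a + of_nat N) * (c - b + of_nat N) - of_nat N * e"
      by (simp add: e_def algebra_simps)
    finally show ?thesis using True by (simp add: algebra_simps)
  next
    case False
    with that obtain m where m: "N = Suc (j + m)"
      by (metis le_neq_implies_less less_iff_Suc_add)
    define W where "W = pochhammer (c + 1 + of_nat j) m"
    have 1: "pochhammer (c + of_nat j) (Suc N - j) = (c + of_nat j) * W * (c + of_nat N)"
      unfolding W_def m using pochhammer_rec[of "c + of_nat j" "Suc m"]
      by (simp add: pochhammer_Suc add_ac mult_ac Suc_diff_le)
    have 2: "pochhammer e (Suc N - j) = pochhammer e (N - j) * (e + of_nat (N - j))"
      using that by (simp add: Suc_diff_le pochhammer_Suc)
    have 3: "pochhammer (c + of_nat (Suc j)) (Suc N - Suc j) = W * (c + of_nat N)"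
            "pochhammer (c + 1 + of_nat j) (N - j) = W * (c + of_nat N)"
      unfolding W_def m by (simp_all add: pochhammer_Suc algebra_simps)
    have 4: "pochhammer (c + of_nat j) (N - j) = (c + of_nat j) * W"
      unfolding W_def m by (simp add: pochhammer_rec add_ac)
    have 5: "pochhammer (c + 1 + of_nat j) (N - 1 - j) = W"
      unfolding W_def m by simp
    have X1: "X j = Y j * ((e + of_nat (N - j)) * (c + of_nat j) * W * (c + of_nat N))"
      unfolding X_def Y_def 1 2 by (simp add: mult_ac)
    have X2: "X (Suc j) = Y j * ((a + of_nat j) * (b + of_nat j) * W * (c + of_nat N))"
      unfolding X_def Y_def 3 by (simp add: pochhammer_Suc mult_ac)
    have "(e + of_nat (N - j)) * (c + of_nat j) * (c + of_nat N)
            + (a + of_nat j) * (b + of_nat j) * (c + of_nat N)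
          = (c - a + of_nat N) * (c - b + of_nat N) * (c + of_nat j)
            + of_nat (N - j) * a * b - of_nat j * e * (c + of_nat N)"
      using that by (simp add: e_def of_nat_diff algebra_simps)
    then have "Y j * W * ((e + of_nat (N - j)) * (c + of_nat j) * (c + of_nat N)
            + (a + of_nat j) * (b + of_nat j) * (c + of_nat N))
          = Y j * W * ((c - a + of_nat N) * (c - b + of_nat N) * (c + of_nat j)
            + of_nat (N - j) * a * b - of_nat j * e * (c + of_nat N))" by simp
    then show ?thesis unfolding X1 X2 3(2) 4 5 by (simp add: algebra_simps)
  qed
  have "saalschuetz_sum (Suc N) a b c = (\<Sum>j\<le>Suc N. of_nat (Suc N choose j) * X j)"
    by (simp add: saalschuetz_sum_def X_def e_def del: sum.atMost_Suc)
  also have "\<dots> = (\<Sum>j\<le>N. of_nat (N choose j) * (X j + X (Suc j)))"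
    by (rule sum_choose_Suc)
  also have "\<dots> = (\<Sum>j\<le>N. (c - a + of_nat N) * (c - b + of_nat N) *
                      (of_nat (N choose j) * (Y j * pochhammer (c + of_nat j) (N - j)))
         + (of_nat (N choose j) * of_nat (N - j)) * (a * b * Y j * pochhammer (c + 1 + of_nat j) (N - 1 - j))
         - (of_nat (N choose j) * of_nat j) * (e * Y j * pochhammer (c + 1 + of_nat j) (N - j)))"
    by (intro sum.cong refl, subst key) (simp_all add: algebra_simps)
  also have "\<dots> = (c - a + of_nat N) * (c - b + of_nat N) * saalschuetz_sum N a b c
       + (\<Sum>j\<le>N. (of_nat (N choose j) * of_nat (N - j)) * (a * b * Y j * pochhammer (c + 1 + of_nat j) (N - 1 - j)))
       - (\<Sum>j\<le>N. (of_nat (N choose j) * of_nat j) * (e * Y j * pochhammer (c + 1 + of_nat j) (N - j)))"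
    by (simp add: sum.distrib sum_subtractf sum_distrib_left saalschuetz_sum_def Y_def e_def mult_ac)
  also have "(\<Sum>j\<le>N. (of_nat (N choose j) * of_nat (N - j)) * (a * b * Y j * pochhammer (c + 1 + of_nat j) (N - 1 - j)))
       = of_nat N * a * b * e * saalschuetz_sum (N - 1) a b (c + 1)"
  proof (cases N)
    case (Suc M)
    have "(\<Sum>j\<le>N. (of_nat (N choose j) * of_nat (N - j)) * (a * b * Y j * pochhammer (c + 1 + of_nat j) (N - 1 - j)))
        = (\<Sum>j\<le>M. (of_nat (N choose j) * of_nat (N - j)) * (a * b * Y j * pochhammer (c + 1 + of_nat j) (N - 1 - j)))"
      unfolding Suc by simp
    also have "\<dots> = (\<Sum>j\<le>M. of_nat N * a * b * e * (of_nat (M choose j) * (pochhammer a j * pochhammer b j *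
       pochhammer (c + 1 + of_nat j) (M - j) * pochhammer (e + 1) (M - j))))"
    proof (rule sum.cong[OF refl])
      fix j assume "j \<in> {..M}"
      then have j: "j \<le> M" by simp
      have "(N choose j) * (N - j) = N * (M choose j)"
        using binomial_absorb_comp[of N j] Suc by (simp add: mult.commute)
      then have 1: "of_nat (N choose j) * of_nat (N - j) = (of_nat N * of_nat (M choose j) :: 'a)"
        by (metis of_nat_mult)
      have 2: "pochhammer e (N - j) = e * pochhammer (e + 1) (M - j)"
        using j unfolding Suc by (simp add: Suc_diff_le pochhammer_rec)
      show "(of_nat (N choose j) * of_nat (N - j)) * (a * b * Y j * pochhammer (c + 1 + of_nat j) (N - 1 - j)) =
         of_nat N * a * b * e * (of_nat (M choose j) * (pochhammer a j * pochhammer b j *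
            pochhammer (c + 1 + of_nat j) (M - j) * pochhammer (e + 1) (M - j)))"
        unfolding 1 Y_def 2 using Suc by (simp add: mult_ac)
    qed
    also have "\<dots> = of_nat N * a * b * e * saalschuetz_sum (N - 1) a b (c + 1)"
      unfolding saalschuetz_sum_def e1 sum_distrib_left using Suc by simp
    finally show ?thesis .
  qed simp
  also have "(\<Sum>j\<le>N. (of_nat (N choose j) * of_nat j) * (e * Y j * pochhammer (c + 1 + of_nat j) (N - j)))
       = of_nat N * a * b * e * saalschuetz_sum (N - 1) (a + 1) (b + 1) (c + 2)"
  proof (cases N)
    case (Suc M)
    have "(\<Sum>j\<le>N. (of_nat (N choose j) * of_nat j) * (e * Y j * pochhammer (c + 1 + of_nat j) (N - j)))
        = (\<Sum>j\<le>M. (of_nat (N choose Suc j) * of_nat (Suc j)) * (e * Y (Suc j) * pochhammer (c + 1 + of_nat (Suc j)) (N - Suc j)))"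
      unfolding Suc by (subst sum.atMost_Suc_shift) simp
    also have "\<dots> = (\<Sum>j\<le>M. of_nat N * a * b * e * (of_nat (M choose j) * (pochhammer (a + 1) j * pochhammer (b + 1) j *
       pochhammer (c + 2 + of_nat j) (M - j) * pochhammer e (M - j))))"
    proof (rule sum.cong[OF refl])
      fix j assume "j \<in> {..M}"
      have "(N choose Suc j) * Suc j = N * (M choose j)"
        using Suc_times_binomial[of j M] Suc by (simp add: mult.commute)
      then have 1: "of_nat (N choose Suc j) * of_nat (Suc j) = (of_nat N * of_nat (M choose j) :: 'a)"
        by (metis of_nat_mult)
      have 2: "c + 1 + of_nat (Suc j) = c + 2 + of_nat j" by simp
      show "(of_nat (N choose Suc j) * of_nat (Suc j)) * (e * Y (Suc j) * pochhammer (c + 1 + of_nat (Suc j)) (N - Suc j)) =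
        of_nat N * a * b * e * (of_nat (M choose j) * (pochhammer (a + 1) j * pochhammer (b + 1) j *
       pochhammer (c + 2 + of_nat j) (M - j) * pochhammer e (M - j)))"
        unfolding 1 2 Y_def using Suc by (simp add: pochhammer_rec mult_ac)
    qed
    also have "\<dots> = of_nat N * a * b * e * saalschuetz_sum (N - 1) (a + 1) (b + 1) (c + 2)"
      unfolding saalschuetz_sum_def e2 sum_distrib_left using Suc by simp
    finally show ?thesis .
  qed simp
  finally show ?thesis by (simp add: e_def algebra_simps)
qed

lemma saalschuetz_sum_eq:
  fixes a b c :: "'a :: comm_ring_1"
  shows "saalschuetz_sum N a b c = pochhammer (c - a) N * pochhammer (c - b) N"
proof (induction N arbitrary: a b c rule: less_induct)
  case (less N)
  show ?case
  proof (cases N)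
    case (Suc M)
    have "of_nat M * (saalschuetz_sum (M - 1) a b (c + 1) - saalschuetz_sum (M - 1) (a + 1) (b + 1) (c + 2)) = 0"
    proof (cases M)
      case (Suc K)
      with \<open>N = Suc M\<close> have "M - 1 < N" by simp
      from less[OF this, of a b "c + 1"] less[OF this, of "a + 1" "b + 1" "c + 2"]
      show ?thesis by (simp add: algebra_simps)
    qed simp
    then have "of_nat M * a * b * (c - a - b) * (saalschuetz_sum (M - 1) a b (c + 1) - saalschuetz_sum (M - 1) (a + 1) (b + 1) (c + 2)) = 0"
      by (metis (no_types, opaque_lifting) mult.assoc mult.commute mult_zero_right)
    then have "saalschuetz_sum N a b c = (c - a + of_nat M) * (c - b + of_nat M) * saalschuetz_sum M a b c"
      unfolding Suc saalschuetz_sum_Suc by simp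
    also have "saalschuetz_sum M a b c = pochhammer (c - a) M * pochhammer (c - b) M"
      by (rule less) (simp add: Suc)
    finally show ?thesis by (simp add: Suc pochhammer_Suc mult_ac)
  qed (simp add: saalschuetz_sum_def)
qed

text \<open>
  After multiplication by \<open>(h + 1/2)\<^sub>N\<close>, the duplication formula
  \<open>(2h)\<^bsub>2k\<^esub> = 4\<^sup>k (h)\<^sub>k (h + 1/2)\<^sub>k\<close> turns the summand into that of a Saalschuetz sum.
\<close>

lemma quadratic_sum_generic:
  fixes h b :: "'a :: field_char_0"
  assumes nz: "pochhammer (h + 1/2) N \<noteq> 0"
  shows "(\<Sum>k\<le>N. of_nat (N choose k) * (pochhammer h k * pochhammer (h + 1/2 - b) k * (-4) ^ k *
            pochhammer (2 * h + 2 * of_nat k) (N - k) * pochhammer (2 * h - b + 1 + of_nat k) (N - k)))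
         = pochhammer (2 * h) N * pochhammer b N"
proof -
  define d where "d = h + 1/2"
  define c where "c = 2 * h - b + 1"
  have e: "c - (d - b) - (2 * h + of_nat N) = 1 - d - of_nat N"
    by (simp add: c_def d_def field_simps)
  have "pochhammer d N * (\<Sum>k\<le>N. of_nat (N choose k) * (pochhammer h k * pochhammer (h + 1/2 - b) k * (-4) ^ k *
            pochhammer (2 * h + 2 * of_nat k) (N - k) * pochhammer (2 * h - b + 1 + of_nat k) (N - k)))
    = (\<Sum>k\<le>N. (-1) ^ N * pochhammer (2 * h) N * (of_nat (N choose k) * (pochhammer (d - b) k * pochhammer (2 * h + of_nat N) k *
         pochhammer (c + of_nat k) (N - k) * pochhammer (1 - d - of_nat N) (N - k))))"
    unfolding sum_distrib_left
  proof (rule sum.cong[OF refl])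
    fix k assume "k \<in> {..N}"
    then have k: "k \<le> N" by simp
    have 1: "pochhammer d N = pochhammer d k * pochhammer (d + of_nat k) (N - k)"
      using pochhammer_product[OF k, of d] .
    have 2: "pochhammer (1 - d - of_nat N) (N - k) = (-1) ^ (N - k) * pochhammer (d + of_nat k) (N - k)"
    proof -
      have "1 - (d + of_nat k) - of_nat (N - k) = 1 - d - of_nat N"
        using k by (simp add: of_nat_diff)
      with pochhammer_reflect[of "d + of_nat k" "N - k"] show ?thesis by metis
    qed
    have s: "(-1) ^ N = ((-1) ^ k * (-1) ^ (N - k) :: 'a)"
      using k by (simp add: minus_one_power_iff)
    have "4 ^ k * pochhammer h k * pochhammer d k = pochhammer (2 * h) (2 * k)"
      by (simp add: pochhammer_double d_def power_mult)
    then have "4 ^ k * pochhammer h k * pochhammer d k * pochhammer (2 * h + 2 * of_nat k) (N - k)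
      = pochhammer (2 * h) (2 * k) * pochhammer (2 * h + of_nat (2 * k)) (N - k)" by simp
    also have "\<dots> = pochhammer (2 * h) (N + k)"
    proof -
      have "2 * k + (N - k) = N + k" using k by simp
      with pochhammer_product'[of "2 * h" "2 * k" "N - k"] show ?thesis by metis
    qed
    also have "\<dots> = pochhammer (2 * h) N * pochhammer (2 * h + of_nat N) k"
      by (rule pochhammer_product')
    finally have 3: "4 ^ k * pochhammer h k * pochhammer d k * pochhammer (2 * h + 2 * of_nat k) (N - k)
      = pochhammer (2 * h) N * pochhammer (2 * h + of_nat N) k" .
    have 4: "(-4) ^ k = ((-1) ^ k * 4 ^ k :: 'a)" by (rule power_minus)
    define P where "P = pochhammer (d + of_nat k) (N - k)"
    define R where "R = of_nat (N choose k) * pochhammer (d - b) k * pochhammer (c + of_nat k) (N - k) * (-1) ^ k * P"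
    have "pochhammer d N * (of_nat (N choose k) * (pochhammer h k * pochhammer (h + 1/2 - b) k * (-4) ^ k *
            pochhammer (2 * h + 2 * of_nat k) (N - k) * pochhammer (2 * h - b + 1 + of_nat k) (N - k)))
      = R * (4 ^ k * pochhammer h k * pochhammer d k * pochhammer (2 * h + 2 * of_nat k) (N - k))"
      unfolding 1 4 R_def P_def c_def by (simp add: mult_ac d_def)
    also have "\<dots> = R * (pochhammer (2 * h) N * pochhammer (2 * h + of_nat N) k)" by (simp only: 3)
    also have "\<dots> = (-1) ^ N * pochhammer (2 * h) N * (of_nat (N choose k) * (pochhammer (d - b) k * pochhammer (2 * h + of_nat N) k *
         pochhammer (c + of_nat k) (N - k) * pochhammer (1 - d - of_nat N) (N - k)))"
    proof -
      have "((-1) ^ (N - k) * (-1) ^ (N - k) :: 'a) = 1" by (simp flip: power_mult_distrib)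
      then have "(-1) ^ N * pochhammer (1 - d - of_nat N) (N - k) = (-1) ^ k * P"
      proof -
        have "(-1) ^ N * pochhammer (1 - d - of_nat N) (N - k) =
              ((-1) ^ (N - k) * (-1) ^ (N - k)) * ((-1) ^ k * P)"
          unfolding P_def by (simp only: s 2 mult_ac)
        with \<open>(-1) ^ (N - k) * (-1) ^ (N - k) = (1 :: 'a)\<close> show ?thesis by simp
      qed
      then have "(-1) ^ k * P = (-1) ^ N * pochhammer (1 - d - of_nat N) (N - k)" ..
      then have "R = of_nat (N choose k) * pochhammer (d - b) k * pochhammer (c + of_nat k) (N - k) *
          ((-1) ^ N * pochhammer (1 - d - of_nat N) (N - k))"
        unfolding R_def by (simp only: mult.assoc)
      then show ?thesis by (simp only: mult_ac)
    qed
    finally show "pochhammer d N * (of_nat (N choose k) * (pochhammer h k * pochhammer (h + 1/2 - b) k * (-4) ^ k *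
            pochhammer (2 * h + 2 * of_nat k) (N - k) * pochhammer (2 * h - b + 1 + of_nat k) (N - k)))
      = (-1) ^ N * pochhammer (2 * h) N * (of_nat (N choose k) * (pochhammer (d - b) k * pochhammer (2 * h + of_nat N) k *
         pochhammer (c + of_nat k) (N - k) * pochhammer (1 - d - of_nat N) (N - k)))" .
  qed
  also have "\<dots> = (-1) ^ N * pochhammer (2 * h) N * saalschuetz_sum N (d - b) (2 * h + of_nat N) c"
    unfolding saalschuetz_sum_def e sum_distrib_left by simp
  also have "\<dots> = (-1) ^ N * pochhammer (2 * h) N * (pochhammer (c - (d - b)) N * pochhammer (c - (2 * h + of_nat N)) N)"
    by (simp only: saalschuetz_sum_eq)
  also have "c - (d - b) = d" by (simp add: c_def d_def field_simps)
  also have "c - (2 * h + of_nat N) = 1 - b - of_nat N" by (simp add: c_def)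
  also have "pochhammer (1 - b - of_nat N) N = (-1) ^ N * pochhammer b N"
    by (rule pochhammer_reflect)
  also have "(-1) ^ N * pochhammer (2 * h) N * (pochhammer d N * ((-1) ^ N * pochhammer b N)) =
     pochhammer d N * (((-1) ^ N * (-1) ^ N) * (pochhammer (2 * h) N * pochhammer b N))"
    by (simp only: mult_ac)
  also have "((-1) ^ N * (-1) ^ N :: 'a) = 1" by (simp flip: power_mult_distrib)
  finally show ?thesis using nz by (simp add: d_def)
qed

lemma continuous_pochhammer:
  fixes f :: "complex \<Rightarrow> complex"
  assumes "continuous_on UNIV f"
  shows "continuous_on UNIV (\<lambda>x. pochhammer (f x) n)"
proof (induction n)
  case (Suc n)
  then show ?case
    unfolding pochhammer_Suc by (intro continuous_on_mult continuous_on_add assms continuous_on_const)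
qed simp

text \<open>
  Both sides are continuous in \<open>h\<close>, and only finitely many \<open>h\<close> are excluded in the generic case.
\<close>

lemma quadratic_sum:
  fixes h b :: complex
  shows "(\<Sum>k\<le>N. of_nat (N choose k) * (pochhammer h k * pochhammer (h + 1/2 - b) k * (-4) ^ k *
            pochhammer (2 * h + 2 * of_nat k) (N - k) * pochhammer (2 * h - b + 1 + of_nat k) (N - k)))
         = pochhammer (2 * h) N * pochhammer b N"
    (is "?L h = ?R h")
proof -
  define Z where "Z = (\<lambda>k. - of_nat k - 1/2 :: complex) ` {..<N}"
  have "finite Z" by (simp add: Z_def)
  then have "eventually (\<lambda>x. x \<notin> Z) (at h)"
    using islimpt_finite islimpt_iff_eventually by blast
  then have ev: "eventually (\<lambda>x. ?L x - ?R x = 0) (at h)"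
  proof eventually_elim
    case (elim x)
    have "pochhammer (x + 1/2) N \<noteq> 0"
    proof
      assume "pochhammer (x + 1/2) N = 0"
      then obtain k where "k < N" "x + 1/2 = - of_nat k" by (auto simp: pochhammer_eq_0_iff)
      then have "x = - of_nat k - 1/2" by (simp add: field_simps)
      with \<open>k < N\<close> elim show False by (auto simp: Z_def)
    qed
    then show ?case by (simp only: quadratic_sum_generic[OF \<open>pochhammer (x + 1/2) N \<noteq> 0\<close>] diff_self)
  qed
  have "continuous_on UNIV (\<lambda>x. ?L x - ?R x)"
    by (intro continuous_intros continuous_pochhammer)
  then have "isCont (\<lambda>x. ?L x - ?R x) h"
    by (rule continuous_on_interior) simp
  then have "(\<lambda>x. ?L x - ?R x) \<midarrow>h\<rightarrow> ?L h - ?R h"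
    by (simp only: isCont_def)
  moreover have "(\<lambda>x. ?L x - ?R x) \<midarrow>h\<rightarrow> 0"
    using ev by (rule tendsto_eventually)
  ultimately have "?L h - ?R h = 0"
    by (rule tendsto_unique[OF at_neq_bot])
  then show ?thesis by (simp only: right_minus_eq)
qed

section \<open>The regularized Gauss series in the unit disc\<close>

definition hyp_coeff :: "complex \<Rightarrow> complex \<Rightarrow> complex \<Rightarrow> nat \<Rightarrow> complex" where
  "hyp_coeff a b c n = pochhammer a n * pochhammer b n * rGamma (c + of_nat n) / fact n"

lemma hypergeo_reg_series_altdef:
  "hypergeo_reg_series a b c z = (\<Sum>n. hyp_coeff a b c n * z ^ n)"
  by (simp add: hypergeo_reg_series_def hyp_coeff_def)

lemma hypergeo_reg_series_commute: "hypergeo_reg_series a b c z = hypergeo_reg_series b a c z"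
  by (simp add: hypergeo_reg_series_def mult_ac)

lemma hyp_coeff_growth:
  "\<exists>C>0. \<forall>n. norm (hyp_coeff a b c n) \<le> C * real (n + 1) powr (Re a + Re b - Re c - 1)"
proof -
  obtain A B C where A: "A > 0" "\<And>n. norm (pochhammer a n) \<le> A * fact n * real (n + 1) powr (Re a - 1)"
    and B: "B > 0" "\<And>n. norm (pochhammer b n) \<le> B * fact n * real (n + 1) powr (Re b - 1)"
    and C: "C > 0" "\<And>n. norm (rGamma (c + of_nat n)) \<le> C * real (n + 1) powr (1 - Re c) / fact n"
    using pochhammer_growth[of a] pochhammer_growth[of b] rGamma_growth[of c] by blast
  have alg: "(A * f * x) * (B * f * y) * (C * z / f) / f = (A * B * C) * (x * y * z)"
    if "f \<noteq> 0" for f x y z :: real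
    using that by (simp add: field_simps)
  have "norm (hyp_coeff a b c n) \<le> (A * B * C) * real (n + 1) powr (Re a + Re b - Re c - 1)" for n
  proof -
    have "norm (hyp_coeff a b c n) = norm (pochhammer a n) * norm (pochhammer b n) * norm (rGamma (c + of_nat n)) / fact n"
      by (simp add: hyp_coeff_def norm_mult norm_divide)
    also have "\<dots> \<le> (A * fact n * real (n + 1) powr (Re a - 1)) * (B * fact n * real (n + 1) powr (Re b - 1))
        * (C * real (n + 1) powr (1 - Re c) / fact n) / fact n"
      using A(1) B(1) C(1) by (intro divide_right_mono mult_mono A B C) auto
    also have "\<dots> = (A * B * C) * (real (n + 1) powr (Re a - 1) * real (n + 1) powr (Re b - 1) * real (n + 1) powr (1 - Re c))"
      by (rule alg) simp
    also have "\<dots> = (A * B * C) * real (n + 1) powr (Re a + Re b - Re c - 1)"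
      by (simp add: algebra_simps flip: powr_add)
    finally show ?thesis .
  qed
  with A B C show ?thesis by (intro exI[of _ "A * B * C"]) auto
qed

lemma powr_bounded_summable:
  fixes f :: "nat \<Rightarrow> 'a :: {real_normed_field, banach}"
  assumes "\<And>n. norm (f n) \<le> C * real (n + 1) powr s" and "norm z < 1"
  shows "summable (\<lambda>n. norm (f n * z ^ n))"
proof (rule summable_comparison_test')
  show "summable (\<lambda>n. C * (real (n + 1) powr s * norm z ^ n))"
    using assms(2) by (intro summable_mult summable_powr_geometric) auto
  show "norm (norm (f n * z ^ n)) \<le> C * (real (n + 1) powr s * norm z ^ n)" for n
    using mult_right_mono[OF assms(1)[of n], of "norm z ^ n"] by (simp add: norm_mult norm_power mult_ac)
qed

lemma hyp_coeff_summable: "norm z < 1 \<Longrightarrow> summable (\<lambda>n. norm (hyp_coeff a b c n * z ^ n))"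
  using hyp_coeff_growth[of a b c] powr_bounded_summable by blast

lemma hypergeo_reg_series_sums:
  "norm z < 1 \<Longrightarrow> (\<lambda>n. hyp_coeff a b c n * z ^ n) sums hypergeo_reg_series a b c z"
  unfolding hypergeo_reg_series_altdef
  by (intro summable_sums summable_norm_cancel[OF hyp_coeff_summable])

lemma power_series_holomorphic:
  fixes f :: "nat \<Rightarrow> complex"
  assumes "\<And>z. norm z < 1 \<Longrightarrow> summable (\<lambda>n. f n * z ^ n)"
  shows "(\<lambda>z. \<Sum>n. f n * z ^ n) holomorphic_on ball 0 1"
proof -
  have "conv_radius f \<ge> 1"
    by (rule conv_radius_geI_ex') (use assms in \<open>auto simp: one_ereal_def\<close>)
  have "ball (0::complex) 1 \<subseteq> eball 0 (fps_conv_radius (Abs_fps f))"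
  proof
    fix x :: complex assume "x \<in> ball 0 1"
    then have "ereal (norm x) < 1" by (simp add: one_ereal_def)
    also note \<open>1 \<le> conv_radius f\<close>
    finally show "x \<in> eball 0 (fps_conv_radius (Abs_fps f))"
      by (simp add: fps_conv_radius_def in_eball_iff)
  qed
  then have "eval_fps (Abs_fps f) holomorphic_on ball 0 1"
    by (rule holomorphic_on_eval_fps)
  then show ?thesis by (simp add: eval_fps_def[abs_def])
qed

lemma hypergeo_reg_series_holomorphic: "hypergeo_reg_series a b c holomorphic_on ball 0 1"
proof -
  have "(\<lambda>z. \<Sum>n. hyp_coeff a b c n * z ^ n) holomorphic_on ball 0 1"
    by (intro power_series_holomorphic summable_norm_cancel[OF hyp_coeff_summable])
  then show ?thesis by (simp flip: hypergeo_reg_series_altdef)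
qed

lemma power_series_unique:
  fixes a b :: "nat \<Rightarrow> complex"
  assumes "eventually (\<lambda>z. (\<lambda>n. a n * z ^ n) sums f z) (nhds 0)"
    and "eventually (\<lambda>z. (\<lambda>n. b n * z ^ n) sums f z) (nhds 0)"
  shows "a = b"
proof -
  have "f has_fps_expansion Abs_fps a" "f has_fps_expansion Abs_fps b"
    using assms by (auto intro!: has_fps_expansionI)
  then have "Abs_fps a = Abs_fps b" by (rule fps_expansion_unique_complex)
  then have "fps_nth (Abs_fps a) = fps_nth (Abs_fps b)" by (rule arg_cong)
  then show ?thesis by (simp add: fun_eq_iff)
qed

section \<open>Substitutions in power series\<close>

lemma binomial_series:
  fixes a u :: complex
  assumes "norm u < 1"
  shows "(\<lambda>k. pochhammer a k / fact k * u ^ k) sums ((1 - u) powr (- a))"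
proof -
  have "((- a) gchoose k) * (- u) ^ k = pochhammer a k / fact k * u ^ k" for k
    by (simp add: gbinomial_pochhammer flip: power_mult_distrib)
  with gen_binomial_complex[of "- u" "- a"] assms show ?thesis by simp
qed

text \<open>
  The coefficients of \<open>(1 - u)\<^bsup>-(a + mn)\<^esup>\<close> grow at most geometrically, jointly in
  the exponent and in the index.  This makes substitutions in power series converge near \<open>0\<close>.
\<close>

lemma binomial_coeff_bound:
  fixes a :: complex
  shows "\<exists>M. \<forall>n k. norm (pochhammer (a + of_nat (m * n)) k / fact k) \<le> 2 ^ (M + m * n + k)"
proof (intro exI allI)
  fix n k
  define M where "M = nat \<lceil>norm a\<rceil>"
  have M: "norm a \<le> real M" by (simp add: M_def)
  have le: "norm (a + of_nat (m * n)) \<le> real (M + m * n) + 1"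
    using norm_triangle_ineq[of a "of_nat (m * n)"] M by (simp del: of_nat_mult)
  have "norm (pochhammer (a + of_nat (m * n)) k) \<le> pochhammer (norm (a + of_nat (m * n))) k"
    by (rule norm_pochhammer_le)
  also have "\<dots> \<le> pochhammer (real (M + m * n) + 1) k"
    by (intro pochhammer_mono_real le) auto
  finally have "norm (pochhammer (a + of_nat (m * n)) k / fact k) \<le> pochhammer (real (M + m * n) + 1) k / fact k"
    by (simp add: norm_divide divide_right_mono)
  also have "\<dots> = real ((M + m * n + k) choose k)"
    unfolding binomial_gbinomial gbinomial_pochhammer' by simp
  also have "\<dots> \<le> real (2 ^ (M + m * n + k))"
    using binomial_le_pow2 by (intro of_nat_mono)
  finally show "norm (pochhammer (a + of_nat (m * n)) k / fact k) \<le> 2 ^ (nat \<lceil>norm a\<rceil> + m * n + k)"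
    by (simp add: M_def)
qed

text \<open>
  The coefficient of \<open>u\<^sup>N\<close> in the formal expansion of the sum over \<open>n\<close> of
  \<open>e\<^sub>n u\<^sup>n (1 - u)\<^bsup>-(a + mn)\<^esup>\<close>.  The case \<open>m = 0\<close> is a Cauchy product, \<open>m = 1\<close> is the substitution
  of Pfaff's transformation, and \<open>m = 2\<close> that of the quadratic one.
\<close>

definition subst_coeff :: "(nat \<Rightarrow> complex) \<Rightarrow> complex \<Rightarrow> nat \<Rightarrow> nat \<Rightarrow> complex" where
  "subst_coeff e a m N = (\<Sum>n\<le>N. e n * (pochhammer (a + of_nat (m * n)) (N - n) / fact (N - n)))"

lemma eventually_norm_less: "eventually (\<lambda>u::complex. norm u < r) (nhds 0)" if "r > 0" for r
  using that eventually_nhds_in_open[of "ball 0 r" "0::complex"] by (simp add: dist_norm)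

text \<open>
  The linear map that multiplies the \<open>N\<close>-th coefficient of a power series by \<open>w N\<close> may be applied to a
  series of power series term by term, as long as the resulting double series converges absolutely.
  With \<open>w N = (b)\<^sub>N / \<Gamma>(c + N)\<close> it turns powers of \<open>1 - u\<close> into regularized Gauss series.
\<close>

lemma rearrangement_sums:
  fixes e w :: "nat \<Rightarrow> complex" and a u :: complex and m :: nat
  defines "f \<equiv> \<lambda>n k. e n * u ^ n * (w (n + k) * (pochhammer (a + of_nat (m * n)) k / fact k) * u ^ k)"
  assumes le: "\<And>n k. norm (f n k) \<le> A n * B k" and sA: "summable A" and sB: "summable B"
    and nn: "\<And>n. 0 \<le> A n" "\<And>k. 0 \<le> B k"
  shows "(\<lambda>n. e n * u ^ n * (\<Sum>k. w (n + k) * (pochhammer (a + of_nat (m * n)) k / fact k) * u ^ k))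
        sums (\<Sum>N. w N * subst_coeff e a m N * u ^ N)"
    and "summable (\<lambda>N. w N * subst_coeff e a m N * u ^ N)"
proof -
  note D = double_series_diagonal[OF le sA sB nn]
  have row: "(\<Sum>k. f n k) = e n * u ^ n * (\<Sum>k. w (n + k) * (pochhammer (a + of_nat (m * n)) k / fact k) * u ^ k)" for n
  proof (cases "e n * u ^ n = 0")
    case False
    have "summable (\<lambda>k. inverse (e n * u ^ n) * f n k)" by (intro summable_mult D)
    also have "(\<lambda>k. inverse (e n * u ^ n) * f n k) = (\<lambda>k. w (n + k) * (pochhammer (a + of_nat (m * n)) k / fact k) * u ^ k)"
      using False by (simp add: f_def fun_eq_iff field_simps)
    finally show ?thesis unfolding f_def by (rule suminf_mult)
  next
    case True
    then have "f n k = 0" for k by (simp only: f_def mult_zero_left)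
    with True show ?thesis by (simp only: suminf_zero mult_zero_left)
  qed
  have diag: "(\<Sum>n\<le>N. f n (N - n)) = w N * subst_coeff e a m N * u ^ N" for N
    unfolding subst_coeff_def sum_distrib_left sum_distrib_right
    by (intro sum.cong refl) (auto simp: f_def mult_ac simp flip: power_add)
  show "(\<lambda>n. e n * u ^ n * (\<Sum>k. w (n + k) * (pochhammer (a + of_nat (m * n)) k / fact k) * u ^ k))
        sums (\<Sum>N. w N * subst_coeff e a m N * u ^ N)"
    and "summable (\<lambda>N. w N * subst_coeff e a m N * u ^ N)"
    using D(2,3) unfolding row diag by blast+
qed

lemma weighted_rearrangement:
  assumes e: "\<And>n. norm (e n) \<le> C * R ^ n" and w: "\<And>n. norm (w n) \<le> D * T ^ n"
    and pos: "R > 0" "T > 0"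
  shows "\<forall>\<^sub>F u in nhds 0.
     (\<lambda>n. e n * u ^ n * (\<Sum>k. w (n + k) * (pochhammer (a + of_nat (m * n)) k / fact k) * u ^ k))
        sums (\<Sum>N. w N * subst_coeff e a m N * u ^ N) \<and>
     summable (\<lambda>N. w N * subst_coeff e a m N * u ^ N)"
proof -
  obtain M where M: "\<And>n k. norm (pochhammer (a + of_nat (m * n)) k / fact k) \<le> 2 ^ (M + m * n + k)"
    using binomial_coeff_bound by blast
  have C: "C \<ge> 0" using e[of 0] by (simp add: order_trans[OF norm_ge_zero])
  have D: "D \<ge> 0" using w[of 0] by (simp add: order_trans[OF norm_ge_zero])
  \<comment> \<open>The radii make the geometric majorants \<open>A\<close> and \<open>B\<close> below have ratio at most \<open>1/2\<close>.\<close>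
  have ev: "\<forall>\<^sub>F u in nhds (0::complex). norm u < 1 / (2 * T * R * 2 ^ m) \<and> norm u < 1 / (4 * T)"
    using pos by (intro eventually_conj eventually_norm_less) auto
  show ?thesis using ev
  proof eventually_elim
    case (elim u)
    define f where "f n k = e n * u ^ n * (w (n + k) * (pochhammer (a + of_nat (m * n)) k / fact k) * u ^ k)" for n k
    define A where "A n = D * C * 2 ^ M * (T * R * 2 ^ m * norm u) ^ n" for n
    define B where "B k = (2 * T * norm u) ^ k" for k
    have le: "norm (f n k) \<le> A n * B k" for n k
    proof -
      have "norm (f n k) = norm (e n) * norm u ^ n * (norm (w (n + k)) * norm (pochhammer (a + of_nat (m * n)) k / fact k) * norm u ^ k)"
        by (simp add: f_def norm_mult norm_power norm_divide)
      also have "\<dots> \<le> (C * R ^ n) * norm u ^ n * ((D * T ^ (n + k)) * 2 ^ (M + m * n + k) * norm u ^ k)"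
        using C D pos by (intro mult_mono e w M) auto
      also have "\<dots> = A n * B k"
        by (simp add: A_def B_def power_add power_mult power_mult_distrib mult_ac)
      finally show ?thesis .
    qed
    have "T * R * 2 ^ m * norm u < 1" "2 * T * norm u < 1"
      using elim pos by (simp_all add: field_simps)
    then have sA: "summable A" and sB: "summable B"
      unfolding A_def B_def using pos by (auto intro!: summable_mult summable_geometric)
    have nn: "0 \<le> A n" "0 \<le> B k" for n k
      using C D pos by (auto simp: A_def B_def)
    show ?case
      using rearrangement_sums[of e u w a m A B, OF le[unfolded f_def] sA sB nn] by blast
  qed
qed

text \<open>
  The unweighted case: the inner series are binomial series and can be summed.
\<close>

lemma substitution_sums:
  assumes e: "\<And>n. norm (e n) \<le> C * R ^ n" and "R > 0"
  shows "\<forall>\<^sub>F u in nhds 0. (\<lambda>N. subst_coeff e a m N * u ^ N) sums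
     ((1 - u) powr (- a) * (\<Sum>n. e n * (u / (1 - u) ^ m) ^ n))"
proof -
  have "\<forall>\<^sub>F u in nhds 0.
     (\<lambda>n. e n * u ^ n * (\<Sum>k. 1 * (pochhammer (a + of_nat (m * n)) k / fact k) * u ^ k))
        sums (\<Sum>N. 1 * subst_coeff e a m N * u ^ N) \<and>
     summable (\<lambda>N. 1 * subst_coeff e a m N * u ^ N)"
    using weighted_rearrangement[of e C R "\<lambda>_. 1" 1 1 a m] assms by simp
  moreover have "\<forall>\<^sub>F u in nhds (0::complex). norm u < 1"
    by (rule eventually_norm_less) simp
  ultimately show ?thesis
  proof eventually_elim
    case (elim u)
    have u: "1 - u \<noteq> 0" using elim(2) by auto
    have row: "(\<Sum>k. 1 * (pochhammer (a + of_nat (m * n)) k / fact k) * u ^ k) = (1 - u) powr (- a) / ((1 - u) ^ m) ^ n" for n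
    proof -
      have "(\<Sum>k. 1 * (pochhammer (a + of_nat (m * n)) k / fact k) * u ^ k) = (1 - u) powr (- (a + of_nat (m * n)))"
        using binomial_series[OF elim(2), of "a + of_nat (m * n)"] by (simp add: sums_iff)
      also have "\<dots> = (1 - u) powr (- a) * (1 - u) powr (- of_nat (m * n))"
        by (simp flip: powr_add)
      also have "(1 - u) powr (- of_nat (m * n)) = 1 / ((1 - u) ^ m) ^ n"
        using u by (simp add: powr_minus powr_nat' power_mult divide_simps del: of_nat_mult)
      finally show ?thesis by simp
    qed
    have "(\<lambda>n. (1 - u) powr (- a) * (e n * (u / (1 - u) ^ m) ^ n)) sums (\<Sum>N. subst_coeff e a m N * u ^ N)"
      using elim(1) unfolding row by (simp add: power_divide mult_ac)
    then have "(\<lambda>n. e n * (u / (1 - u) ^ m) ^ n) sums ((\<Sum>N. subst_coeff e a m N * u ^ N) / (1 - u) powr (- a))"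
      by (rule sums_mult_D) (use u in auto)
    then have "(1 - u) powr (- a) * (\<Sum>n. e n * (u / (1 - u) ^ m) ^ n) = (\<Sum>N. subst_coeff e a m N * u ^ N)"
      using u by (simp add: sums_iff)
    then show ?case using elim(1) by (simp add: sums_iff)
  qed
qed

lemma geometric_bound:
  fixes f :: "nat \<Rightarrow> complex"
  assumes "\<And>z. norm z < 1 \<Longrightarrow> summable (\<lambda>n. f n * z ^ n)" and "0 < q" "q < 1"
  shows "\<exists>C. \<forall>n. norm (f n) \<le> C * (1 / q) ^ n"
proof -
  have "summable (\<lambda>n. f n * of_real q ^ n)"
    by (rule assms) (use assms in auto)
  then have "(\<lambda>n. f n * of_real q ^ n) \<longlonglongrightarrow> 0" by (rule summable_LIMSEQ_zero)
  then have "Bseq (\<lambda>n. f n * of_real q ^ n)"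
    using convergent_def by (blast intro: convergent_imp_Bseq)
  then obtain K where K: "\<And>n. norm (f n * of_real q ^ n) \<le> K" by (auto simp: Bseq_def)
  have "norm (f n) \<le> K * (1 / q) ^ n" for n
    using K[of n] assms(2) by (simp add: norm_mult norm_power power_divide field_simps)
  then show ?thesis by blast
qed

lemma hyp_coeff_geometric: "\<exists>C. \<forall>n. norm (hyp_coeff a b c n) \<le> C * 2 ^ n"
  using geometric_bound[of "hyp_coeff a b c" "1/2", OF summable_norm_cancel[OF hyp_coeff_summable]] by simp

section \<open>Pfaff's transformation and analytic continuation\<close>

lemma hyp_coeff_pfaff:
  "subst_coeff (\<lambda>n. (-1) ^ n * hyp_coeff (c - a) b c n) b 1 N = hyp_coeff a b c N"
proof -
  have "subst_coeff (\<lambda>n. (-1) ^ n * hyp_coeff (c - a) b c n) b 1 N =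
    (\<Sum>n\<le>N. pochhammer b N * rGamma (c + of_nat N) / fact N *
      (of_nat (N choose n) * pochhammer (c - a) n * (-1) ^ n * pochhammer (c + of_nat n) (N - n)))"
    unfolding subst_coeff_def
  proof (rule sum.cong[OF refl])
    fix n assume "n \<in> {..N}"
    then have n: "n \<le> N" by simp
    have 1: "pochhammer b N = pochhammer b n * pochhammer (b + of_nat n) (N - n)"
      using pochhammer_product[OF n] .
    have 2: "rGamma (c + of_nat n) = pochhammer (c + of_nat n) (N - n) * rGamma (c + of_nat N)"
      using pochhammer_rGamma[of "c + of_nat n" "N - n"] n by (simp add: of_nat_diff)
    have 3: "of_nat (N choose n) = (fact N / (fact n * fact (N - n)) :: complex)"
      using n by (rule binomial_fact)
    show "(-1) ^ n * hyp_coeff (c - a) b c n * (pochhammer (b + of_nat (1 * n)) (N - n) / fact (N - n)) =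
      pochhammer b N * rGamma (c + of_nat N) / fact N *
      (of_nat (N choose n) * pochhammer (c - a) n * (-1) ^ n * pochhammer (c + of_nat n) (N - n))"
      unfolding hyp_coeff_def 1 2 3 by simp
  qed
  also have "\<dots> = hyp_coeff a b c N"
    unfolding sum_distrib_left[symmetric] vandermonde_sum by (simp add: hyp_coeff_def)
  finally show ?thesis .
qed

lemma hypergeo_reg_series_pfaff_near_0:
  "\<forall>\<^sub>F z in nhds 0. (1 - z) powr (- b) * hypergeo_reg_series (c - a) b c (z / (z - 1)) = hypergeo_reg_series a b c z"
proof -
  obtain C where C: "\<And>n. norm (hyp_coeff (c - a) b c n) \<le> C * 2 ^ n"
    using hyp_coeff_geometric by blast
  have "\<forall>\<^sub>F u in nhds 0. (\<lambda>N. subst_coeff (\<lambda>n. (-1) ^ n * hyp_coeff (c - a) b c n) b 1 N * u ^ N) sums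
     ((1 - u) powr (- b) * (\<Sum>n. (-1) ^ n * hyp_coeff (c - a) b c n * (u / (1 - u) ^ 1) ^ n))"
    by (rule substitution_sums[where C = C and R = 2]) (use C in \<open>auto simp: norm_mult norm_power\<close>)
  then show ?thesis
  proof eventually_elim
    case (elim u)
    have "(-1) ^ n * hyp_coeff (c - a) b c n * (u / (1 - u) ^ 1) ^ n = hyp_coeff (c - a) b c n * (u / (u - 1)) ^ n" for n
    proof -
      have "u / (u - 1) = (-1) * (u / (1 - u))" by (metis minus_diff_eq minus_divide_right mult_minus1)
      then show ?thesis by (simp only: power_mult_distrib power_one_right mult_ac)
    qed
    note h = this
    show ?case
      using elim unfolding hyp_coeff_pfaff h hypergeo_reg_series_altdef by (simp add: sums_iff)
  qed
qed

lemma continuation_unique: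
  assumes "open S" "convex S" "0 \<in> S" "z \<in> S" "f holomorphic_on S"
    and "open T" "convex T" "0 \<in> T" "z \<in> T" "g holomorphic_on T"
    and "\<forall>\<^sub>F w in nhds 0. f w = h w" "\<forall>\<^sub>F w in nhds 0. g w = h w"
  shows "f z = (g z :: complex)"
proof -
  have "\<forall>\<^sub>F w in nhds 0. f w = g w" using assms(11,12) by eventually_elim simp
  then obtain X where X: "open X" "0 \<in> X" "\<And>w. w \<in> X \<Longrightarrow> f w = g w"
    unfolding eventually_nhds by blast
  show ?thesis
  proof (rule analytic_continuation_open[of "X \<inter> (S \<inter> T)" "S \<inter> T" f g z])
    show "connected (S \<inter> T)" using assms by (intro convex_connected convex_Int)
    show "f holomorphic_on S \<inter> T" "g holomorphic_on S \<inter> T"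
      using assms holomorphic_on_subset by blast+
  qed (use X assms in auto)
qed

lemma hypergeo_reg_eqI:
  assumes "open S" "convex S" "0 \<in> S" "z \<in> S" "f holomorphic_on S"
    and "\<forall>\<^sub>F w in nhds 0. f w = hypergeo_reg_series a b c w"
  shows "hypergeo_reg a b c z = f z"
  unfolding hypergeo_reg_def
proof (rule the_equality)
  show "\<exists>S g. open S \<and> convex S \<and> 0 \<in> S \<and> z \<in> S \<and> g holomorphic_on S \<and>
     (\<forall>\<^sub>F w in nhds 0. g w = hypergeo_reg_series a b c w) \<and> f z = g z"
    using assms by blast
  fix v
  assume "\<exists>S g. open S \<and> convex S \<and> 0 \<in> S \<and> z \<in> S \<and> g holomorphic_on S \<and>
     (\<forall>\<^sub>F w in nhds 0. g w = hypergeo_reg_series a b c w) \<and> v = g z"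
  then show "v = f z"
    using continuation_unique[OF assms(1-5) _ _ _ _ _ assms(6)] by metis
qed

lemma pfaff_arg_norm:
  assumes "Re z < 1/2"
  shows "norm (z / (z - 1)) < 1"
proof -
  have "(norm z)\<^sup>2 < (norm (z - 1))\<^sup>2"
    unfolding cmod_power2 using assms by (simp add: power2_eq_square algebra_simps)
  then have "norm z < norm (z - 1)" by (rule power2_less_imp_less) simp
  moreover have "norm (z - 1) > 0" using assms by auto
  ultimately show ?thesis by (simp add: norm_divide)
qed

text \<open>
  The right-hand side is holomorphic on the half-plane \<open>Re z < 1/2\<close>, because that half-plane is mapped
  into the unit disc by \<open>z / (z - 1)\<close>.  It is therefore the analytic continuation that the definition
  of \<^const>\<open>hypergeo_reg\<close> asks for.
\<close>

lemma hypergeo_reg_pfaff: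
  assumes "Re z < 1/2"
  shows "hypergeo_reg a b c z = (1 - z) powr (- b) * hypergeo_reg_series (c - a) b c (z / (z - 1))"
proof (rule hypergeo_reg_eqI[of "{z. Re z < 1/2}"])
  show "open {z. Re z < 1/2}" "convex {z. Re z < 1/2}"
    by (rule open_halfspace_Re_lt, rule convex_halfspace_Re_lt)
  have "(hypergeo_reg_series (c - a) b c \<circ> (\<lambda>z. z / (z - 1))) holomorphic_on {z. Re z < 1/2}"
  proof (rule holomorphic_on_compose_gen)
    show "(\<lambda>z. z / (z - 1)) holomorphic_on {z. Re z < 1/2}"
      by (intro holomorphic_intros) auto
    show "(\<lambda>z. z / (z - 1)) ` {z. Re z < 1/2} \<subseteq> ball 0 1"
      using pfaff_arg_norm by auto
  qed (rule hypergeo_reg_series_holomorphic)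
  then show "(\<lambda>z. (1 - z) powr (- b) * hypergeo_reg_series (c - a) b c (z / (z - 1))) holomorphic_on {z. Re z < 1/2}"
    unfolding o_def by (intro holomorphic_intros) (auto simp: complex_nonpos_Reals_iff)
qed (use assms hypergeo_reg_series_pfaff_near_0 in auto)

lemma hypergeo_reg_series_pfaff:
  assumes "norm z < 1" "Re z < 1/2"
  shows "hypergeo_reg_series a b c z = (1 - z) powr (- b) * hypergeo_reg_series (c - a) b c (z / (z - 1))"
proof -
  have "hypergeo_reg a b c z = hypergeo_reg_series a b c z"
    by (rule hypergeo_reg_eqI[of "ball 0 1"])
       (use assms hypergeo_reg_series_holomorphic in auto)
  with hypergeo_reg_pfaff[OF assms(2)] show ?thesis by simp
qed

section \<open>The quadratic transformation\<close>

lemma hyp_coeff_quadratic: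
  "subst_coeff (\<lambda>n. (-4) ^ n * hyp_coeff (a / 2) ((a + 1) / 2 - b) (a - b + 1) n) a 2 N = hyp_coeff a b (a - b + 1) N"
proof -
  define c where "c = a - b + 1"
  have "subst_coeff (\<lambda>n. (-4) ^ n * hyp_coeff (a / 2) ((a + 1) / 2 - b) c n) a 2 N =
    (\<Sum>n\<le>N. rGamma (c + of_nat N) / fact N *
      (of_nat (N choose n) * (pochhammer (a / 2) n * pochhammer (a / 2 + 1 / 2 - b) n * (-4) ^ n *
        pochhammer (2 * (a / 2) + 2 * of_nat n) (N - n) * pochhammer (2 * (a / 2) - b + 1 + of_nat n) (N - n))))"
    unfolding subst_coeff_def
  proof (rule sum.cong[OF refl])
    fix n assume "n \<in> {..N}"
    then have n: "n \<le> N" by simp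
    have 2: "rGamma (c + of_nat n) = pochhammer (c + of_nat n) (N - n) * rGamma (c + of_nat N)"
      using pochhammer_rGamma[of "c + of_nat n" "N - n"] n by (simp add: of_nat_diff)
    have 3: "of_nat (N choose n) = (fact N / (fact n * fact (N - n)) :: complex)"
      using n by (rule binomial_fact)
    have 4: "a / 2 + 1 / 2 - b = (a + 1) / 2 - b" "2 * (a / 2) = a" "a - b + 1 = c"
      "a + of_nat (2 * n) = a + 2 * of_nat n"
      by (simp_all add: c_def add_divide_distrib)
    show "(-4) ^ n * hyp_coeff (a / 2) ((a + 1) / 2 - b) c n * (pochhammer (a + of_nat (2 * n)) (N - n) / fact (N - n)) =
      rGamma (c + of_nat N) / fact N *
      (of_nat (N choose n) * (pochhammer (a / 2) n * pochhammer (a / 2 + 1 / 2 - b) n * (-4) ^ n *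
        pochhammer (2 * (a / 2) + 2 * of_nat n) (N - n) * pochhammer (2 * (a / 2) - b + 1 + of_nat n) (N - n)))"
      unfolding hyp_coeff_def 2 3 4 by simp
  qed
  also have "\<dots> = hyp_coeff a b c N"
    unfolding sum_distrib_left[symmetric] quadratic_sum by (simp add: hyp_coeff_def)
  finally show ?thesis by (simp add: c_def)
qed

text \<open>
  For \<open>\<bar>z\<bar> < 1\<close>, the solution \<open>u\<close> of \<open>4 u / (1 + u)\<^sup>2 = z\<close> that lies in the unit disc.  The substitution is chosen
  because it makes \<open>\<surd>(1 - z) = (1 - u) / (1 + u)\<close> rational.
\<close>

definition quad_root :: "complex \<Rightarrow> complex" where
  "quad_root z = (1 - csqrt (1 - z)) / (1 + csqrt (1 - z))"

lemma Re_one_minus_pos: "norm z < 1 \<Longrightarrow> Re (1 - z) > 0" "norm z < 1 \<Longrightarrow> Re (1 + z) > 0"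
  using abs_Re_le_cmod[of z] by auto

lemma Re_csqrt_pos:
  assumes "Re w > 0"
  shows "Re (csqrt w) > 0"
proof (rule ccontr)
  assume "\<not> Re (csqrt w) > 0"
  with Re_csqrt[of w] have "Re (csqrt w) = 0" by simp
  then have "Re ((csqrt w)\<^sup>2) \<le> 0" by (simp add: power2_eq_square)
  with assms show False by simp
qed

lemma csqrt_one_minus_pos: "norm z < 1 \<Longrightarrow> Re (csqrt (1 - z)) > 0"
  by (intro Re_csqrt_pos Re_one_minus_pos)

lemma one_plus_csqrt_nonzero: "norm z < 1 \<Longrightarrow> 1 + csqrt (1 - z) \<noteq> 0"
  using csqrt_one_minus_pos[of z] by (metis add_pos_pos complex.sel(1) less_numeral_extra(1) less_numeral_extra(3) one_complex.sel(1) plus_complex.sel(1) zero_complex.sel(1))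

lemma one_plus_quad_root: "norm z < 1 \<Longrightarrow> 1 + quad_root z = 2 / (1 + csqrt (1 - z))"
  using one_plus_csqrt_nonzero[of z] by (simp add: quad_root_def field_simps)

lemma one_plus_quad_root_nonzero: "norm z < 1 \<Longrightarrow> 1 + quad_root z \<noteq> 0"
  using one_plus_csqrt_nonzero[of z] by (simp add: one_plus_quad_root)

lemma quad_root_eq:
  assumes "norm z < 1"
  shows "4 * quad_root z / (1 + quad_root z)\<^sup>2 = z"
proof -
  define s where "s = csqrt (1 - z)"
  have s: "1 + s \<noteq> 0" "s\<^sup>2 = 1 - z"
    using one_plus_csqrt_nonzero[OF assms] by (simp_all add: s_def)
  have alg: "4 * (a / t) / (2 / t)\<^sup>2 = a * t" if "t \<noteq> 0" for a t :: complex
    using that by (simp add: power2_eq_square field_simps)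
  have "4 * quad_root z / (1 + quad_root z)\<^sup>2 = 4 * ((1 - s) / (1 + s)) / (2 / (1 + s))\<^sup>2"
    unfolding one_plus_quad_root[OF assms] by (simp add: quad_root_def s_def)
  also have "\<dots> = (1 - s) * (1 + s)"
    by (rule alg) (rule s(1))
  also have "\<dots> = 1 - s\<^sup>2" by (simp add: power2_eq_square algebra_simps)
  finally show ?thesis using s(2) by simp
qed

lemma norm_quad_root:
  assumes "norm z < 1"
  shows "norm (quad_root z) < 1"
proof -
  define s where "s = csqrt (1 - z)"
  have s: "Re s > 0" "1 + s \<noteq> 0"
    using csqrt_one_minus_pos[OF assms] one_plus_csqrt_nonzero[OF assms] by (simp_all add: s_def)
  have "(norm (1 - s))\<^sup>2 < (norm (1 + s))\<^sup>2"
    unfolding cmod_power2 using s(1) by (simp add: power2_eq_square algebra_simps)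
  then have "norm (1 - s) < norm (1 + s)" by (rule power2_less_imp_less) simp
  then show ?thesis using s(2) by (simp add: quad_root_def norm_divide s_def)
qed

lemma csqrt_quadratic:
  assumes "norm u < 1"
  shows "csqrt (1 - 4 * u / (1 + u)\<^sup>2) = (1 - u) / (1 + u)" and "Re ((1 - u) / (1 + u)) > 0"
proof -
  have nz: "1 + u \<noteq> 0"
    using Re_one_minus_pos(2)[OF assms] by (metis less_irrefl zero_complex.sel(1))
  have "(norm u)\<^sup>2 < 1" using assms by (simp add: power_less_one_iff abs_square_less_1)
  then have "Re ((1 - u) * cnj (1 + u)) > 0"
    unfolding cmod_power2 by (simp add: power2_eq_square algebra_simps)
  moreover have "(norm (1 + u))\<^sup>2 > 0" using nz by simp
  ultimately show pos: "Re ((1 - u) / (1 + u)) > 0"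
    by (subst complex_div_cnj) (metis Re_divide_of_real divide_pos_pos)
  have "1 - 4 * u / (1 + u)\<^sup>2 = ((1 + u)\<^sup>2 - 4 * u) / (1 + u)\<^sup>2"
    using nz by (simp add: diff_divide_distrib)
  also have "(1 + u)\<^sup>2 - 4 * u = (1 - u)\<^sup>2"
    by (simp add: power2_eq_square algebra_simps)
  also have "\<dots> / (1 + u)\<^sup>2 = ((1 - u) / (1 + u))\<^sup>2" by (simp add: power_divide)
  finally show "csqrt (1 - 4 * u / (1 + u)\<^sup>2) = (1 - u) / (1 + u)"
    using pos csqrt_square by simp
qed

lemma quad_root_inverse:
  assumes "norm u < 1"
  shows "quad_root (4 * u / (1 + u)\<^sup>2) = u"
proof -
  have nz: "1 + u \<noteq> 0"
    using Re_one_minus_pos(2)[OF assms] by (metis less_irrefl zero_complex.sel(1))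
  then have "1 - (1 - u) / (1 + u) = 2 * u / (1 + u)" "1 + (1 - u) / (1 + u) = 2 / (1 + u)"
    by (simp_all add: divide_simps)
  with nz show ?thesis
    unfolding quad_root_def csqrt_quadratic(1)[OF assms] by simp
qed

lemma quad_root_0 [simp]: "quad_root 0 = 0"
  by (simp add: quad_root_def)

lemma one_minus_not_nonpos:
  fixes z :: complex
  shows "norm z < 1 \<Longrightarrow> 1 - z \<notin> \<real>\<^sub>\<le>\<^sub>0" "norm z < 1 \<Longrightarrow> 1 + z \<notin> \<real>\<^sub>\<le>\<^sub>0"
  using Re_one_minus_pos[of z] by (auto simp: complex_nonpos_Reals_iff)

lemma quad_root_holomorphic: "quad_root holomorphic_on ball 0 1"
  unfolding quad_root_def[abs_def]
  by (intro holomorphic_intros) (use one_minus_not_nonpos one_plus_csqrt_nonzero in auto)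

lemma quad_root_tendsto: "(quad_root \<longlongrightarrow> 0) (nhds 0)"
proof -
  have "continuous_on (ball 0 1) quad_root"
    by (rule holomorphic_on_imp_continuous_on[OF quad_root_holomorphic])
  then have "isCont quad_root 0" by (rule continuous_on_interior) simp
  then have "(quad_root \<longlongrightarrow> quad_root 0) (nhds 0)"
    unfolding isCont_def tendsto_at_iff_tendsto_nhds .
  then show ?thesis by simp
qed

lemma eventually_quad_root:
  assumes "\<forall>\<^sub>F u in nhds 0. P u"
  shows "\<forall>\<^sub>F z in nhds 0. P (quad_root z)" "\<forall>\<^sub>F z in nhds 0. P (- quad_root z)"
proof -
  show "\<forall>\<^sub>F z in nhds 0. P (quad_root z)"
    by (rule eventually_compose_filterlim[OF assms quad_root_tendsto])
  have "((\<lambda>z. - quad_root z) \<longlongrightarrow> - 0) (nhds 0)"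
    by (intro tendsto_minus quad_root_tendsto)
  then show "\<forall>\<^sub>F z in nhds 0. P (- quad_root z)"
    using eventually_compose_filterlim[OF assms] by simp
qed

text \<open>
  Near \<open>0\<close> this is the substitution \<open>m = 2\<close>, whose coefficients have been summed in closed form; the
  identity theorem extends it to the disc.
\<close>

lemma hypergeo_reg_series_quadratic:
  assumes "norm z < 1"
  shows "hypergeo_reg_series a b (a - b + 1) (- quad_root z) =
     (1 + quad_root z) powr (- a) * hypergeo_reg_series (a / 2) ((a + 1) / 2 - b) (a - b + 1) z"
proof -
  define c where "c = a - b + 1"
  obtain C where C: "\<And>n. norm (hyp_coeff (a / 2) ((a + 1) / 2 - b) c n) \<le> C * 2 ^ n"
    using hyp_coeff_geometric by blast
  have "\<forall>\<^sub>F u in nhds 0. (\<lambda>N. subst_coeff (\<lambda>n. (-4) ^ n * hyp_coeff (a / 2) ((a + 1) / 2 - b) c n) a 2 N * u ^ N) sums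
     ((1 - u) powr (- a) * (\<Sum>n. (-4) ^ n * hyp_coeff (a / 2) ((a + 1) / 2 - b) c n * (u / (1 - u) ^ 2) ^ n))"
  proof (rule substitution_sums)
    show "norm ((-4) ^ n * hyp_coeff (a / 2) ((a + 1) / 2 - b) c n) \<le> C * 8 ^ n" for n
    proof -
      have "norm ((-4) ^ n * hyp_coeff (a / 2) ((a + 1) / 2 - b) c n) \<le> 4 ^ n * (C * 2 ^ n)"
        unfolding norm_mult norm_power using C[of n] by (intro mult_mono) auto
      also have "\<dots> = C * (4 * 2) ^ n" by (simp only: power_mult_distrib mult_ac)
      finally show ?thesis by simp
    qed
  qed simp
  from eventually_quad_root(2)[OF this] eventually_norm_less[OF zero_less_one]
  have ev: "\<forall>\<^sub>F z in nhds 0. hypergeo_reg_series a b c (- quad_root z) =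
     (1 + quad_root z) powr (- a) * hypergeo_reg_series (a / 2) ((a + 1) / 2 - b) c z"
  proof eventually_elim
    case (elim z)
    note s = elim(1) and z = elim(2)
    have "- 4 * (- quad_root z / (1 - - quad_root z) ^ 2) = z"
      using quad_root_eq[OF z] by simp
    then have "z ^ n = (-4) ^ n * (- quad_root z / (1 - - quad_root z) ^ 2) ^ n" for n
      by (metis power_mult_distrib)
    then have "(-4) ^ n * hyp_coeff (a / 2) ((a + 1) / 2 - b) c n * (- quad_root z / (1 - - quad_root z) ^ 2) ^ n
        = hyp_coeff (a / 2) ((a + 1) / 2 - b) c n * z ^ n" for n
      by (simp only: mult_ac)
    note h = this
    show ?case
      using s[unfolded h] unfolding c_def hyp_coeff_quadratic hypergeo_reg_series_altdef by (simp add: sums_iff)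
  qed
  have "hypergeo_reg_series a b c (- quad_root z) =
     (1 + quad_root z) powr (- a) * hypergeo_reg_series (a / 2) ((a + 1) / 2 - b) c z"
  proof (rule continuation_unique[of "ball 0 1" z _ "ball 0 1" _ "\<lambda>z. (1 + quad_root z) powr (- a) * hypergeo_reg_series (a / 2) ((a + 1) / 2 - b) c z"])
    have "(hypergeo_reg_series a b c \<circ> (\<lambda>z. - quad_root z)) holomorphic_on ball 0 1"
      by (rule holomorphic_on_compose_gen[OF _ hypergeo_reg_series_holomorphic])
         (use norm_quad_root in \<open>auto intro!: holomorphic_intros quad_root_holomorphic\<close>)
    then show "(\<lambda>z. hypergeo_reg_series a b c (- quad_root z)) holomorphic_on ball 0 1"
      by (simp add: o_def)
    show "(\<lambda>z. (1 + quad_root z) powr (- a) * hypergeo_reg_series (a / 2) ((a + 1) / 2 - b) c z) holomorphic_on ball 0 1"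
      using norm_quad_root one_minus_not_nonpos
      by (intro holomorphic_intros quad_root_holomorphic hypergeo_reg_series_holomorphic) auto
  qed (use assms ev in auto)
  then show ?thesis by (simp add: c_def)
qed

section \<open>The generating functions\<close>

text \<open>
  Inside the disc of convergence, weights of polynomial growth do no harm.
\<close>

lemma weighted_summable:
  fixes f :: "nat \<Rightarrow> complex"
  assumes "\<And>z. norm z < 1 \<Longrightarrow> summable (\<lambda>n. f n * z ^ n)" and "0 \<le> r" "r < 1"
  shows "summable (\<lambda>n. norm (f n) * real (n + 1) powr s * r ^ n)"
proof -
  define q where "q = (1 + r) / 2"
  have q: "0 < q" "q < 1" "r < q" using assms by (auto simp: q_def)
  obtain C where C: "\<And>n. norm (f n) \<le> C * (1 / q) ^ n"
    using geometric_bound[OF assms(1) q(1,2)] by blast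
  show ?thesis
  proof (rule summable_comparison_test')
    show "summable (\<lambda>n. C * (real (n + 1) powr s * (r / q) ^ n))"
      using q assms by (intro summable_mult summable_powr_geometric) auto
    fix n :: nat
    have "norm (norm (f n) * real (n + 1) powr s * r ^ n) = norm (f n) * (real (n + 1) powr s * r ^ n)"
      using assms by simp
    also have "\<dots> \<le> C * (1 / q) ^ n * (real (n + 1) powr s * r ^ n)"
      using assms by (intro mult_right_mono C) auto
    also have "\<dots> = C * (real (n + 1) powr s * (r / q) ^ n)" by (simp add: power_divide)
    finally show "norm (norm (f n) * real (n + 1) powr s * r ^ n) \<le> C * (real (n + 1) powr s * (r / q) ^ n)" .
  qed
qed

lemma gen_g_sums:
  assumes "norm u < 1"
  shows "(\<lambda>k. gen_g k \<tau> r * u ^ k) sums ((1 + u) powr (\<tau> + r) * (1 - u) powr (- \<tau>))"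
proof -
  define F where "F u = (1 + u) powr (\<tau> + r) * (1 - u) powr (- \<tau>)" for u :: complex
  define g where "g k = (deriv ^^ k) F 0 / fact k" for k
  have "F holomorphic_on ball 0 1"
    unfolding F_def by (intro holomorphic_intros) (use one_minus_not_nonpos in auto)
  then have g: "(\<lambda>k. g k * u ^ k) sums F u" if "norm u < 1" for u
    using holomorphic_power_series[of F 0 1 u] that by (simp add: g_def)
  have "(THE g. \<forall>u. norm u < 1 \<longrightarrow> (\<lambda>k. g k * u ^ k) sums F u) = g"
  proof (rule the_equality)
    fix h assume h: "\<forall>u. norm u < 1 \<longrightarrow> (\<lambda>k. h k * u ^ k) sums F u"
    have "\<forall>\<^sub>F u in nhds (0::complex). norm u < 1" by (rule eventually_norm_less) simp
    then show "h = g"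
      by (intro power_series_unique[of _ F]; elim eventually_mono) (use h g in auto)
  qed (use g in blast)
  then have "gen_g k \<tau> r = g k" for k
    by (simp add: gen_g_def F_def)
  with g[OF assms] show ?thesis by (simp add: F_def)
qed

lemma gen_p_sums:
  assumes "norm z < 1"
  shows "(\<lambda>k. gen_p k \<rho> \<tau> 1 * z ^ k) sums (2 powr \<tau> * ((1 - z) powr (- \<rho>) * (1 + csqrt (1 - z)) powr (- \<tau>)))"
proof -
  define F where "F z = (1 - z * 1) powr (- \<rho>) * (1 + csqrt (1 - z)) powr (- \<tau>)" for z :: complex
  define g where "g k = 2 powr \<tau> * ((deriv ^^ k) F 0 / fact k)" for k
  have "1 + csqrt (1 - z) \<notin> \<real>\<^sub>\<le>\<^sub>0" if "norm z < 1" for z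
  proof -
    have "Re (1 + csqrt (1 - z)) > 0" using csqrt_one_minus_pos[OF that] by (simp only: plus_complex.sel one_complex.sel)
    then show ?thesis by (metis complex_nonpos_Reals_iff not_le)
  qed
  then have "F holomorphic_on ball 0 1"
    unfolding F_def by (intro holomorphic_intros) (use one_minus_not_nonpos in auto)
  then have "(\<lambda>k. (deriv ^^ k) F 0 / fact k * z ^ k) sums F z" if "norm z < 1" for z
    using holomorphic_power_series[of F 0 1 z] that by simp
  moreover have "2 powr (- \<tau>) * (g k * z ^ k) = (deriv ^^ k) F 0 / fact k * z ^ k" for k z
    by (simp add: g_def powr_minus)
  ultimately have g: "(\<lambda>k. 2 powr (- \<tau>) * (g k * z ^ k)) sums F z" if "norm z < 1" for z
    using that by simp
  have small: "\<forall>\<^sub>F u in nhds (0::complex). norm u < 1" by (rule eventually_norm_less) simp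
  have "(THE g. \<forall>\<^sub>F z in nhds 0. (\<lambda>k. 2 powr (- \<tau>) * (g k * z ^ k)) sums F z) = g"
  proof (rule the_equality)
    show "\<forall>\<^sub>F z in nhds 0. (\<lambda>k. 2 powr (- \<tau>) * (g k * z ^ k)) sums F z"
      using small by (rule eventually_mono) (rule g)
    fix h assume h: "\<forall>\<^sub>F z in nhds 0. (\<lambda>k. 2 powr (- \<tau>) * (h k * z ^ k)) sums F z"
    have "(\<lambda>k. 2 powr (- \<tau>) * h k) = (\<lambda>k. 2 powr (- \<tau>) * g k)"
    proof (rule power_series_unique)
      show "\<forall>\<^sub>F z in nhds 0. (\<lambda>k. 2 powr (- \<tau>) * h k * z ^ k) sums F z"
        using h by (simp add: mult.assoc)
      show "\<forall>\<^sub>F z in nhds 0. (\<lambda>k. 2 powr (- \<tau>) * g k * z ^ k) sums F z"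
        using small by (rule eventually_mono) (use g in \<open>simp add: mult.assoc\<close>)
    qed
    then show "h = g" by (simp add: fun_eq_iff)
  qed
  then have "gen_p k \<rho> \<tau> 1 = g k" for k
    by (simp add: gen_p_def F_def)
  then have "(\<lambda>k. 2 powr \<tau> * (2 powr (- \<tau>) * (gen_p k \<rho> \<tau> 1 * z ^ k))) sums (2 powr \<tau> * F z)"
    using g[OF assms] by (intro sums_mult) simp
  moreover have "2 powr \<tau> * (2 powr (- \<tau>) * x) = x" for x :: complex
    by (simp add: powr_minus)
  ultimately show ?thesis by (simp add: F_def)
qed

text \<open>
  Multiplying the generating function by \<open>(1 - u)\<^sup>\<nu>\<close> cancels one factor and leaves
  \<open>(1 + u)\<^bsup>\<nu> - 2\<mu>\<^esup>\<close>.
\<close>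

lemma gen_g_substitution:
  "subst_coeff (\<lambda>n. gen_g n \<nu> (- 2 * \<mu>)) (- \<nu>) 0 N = (-1) ^ N * (pochhammer (2 * \<mu> - \<nu>) N / fact N)"
proof -
  obtain C where C: "\<And>n. norm (gen_g n \<nu> (- 2 * \<mu>)) \<le> C * (1 / (1 / 2)) ^ n"
    using geometric_bound[of "\<lambda>n. gen_g n \<nu> (- 2 * \<mu>)" "1/2"] gen_g_sums by (auto simp: sums_iff)
  have "\<forall>\<^sub>F u in nhds 0. (\<lambda>N. subst_coeff (\<lambda>n. gen_g n \<nu> (- 2 * \<mu>)) (- \<nu>) 0 N * u ^ N) sums
     ((1 - u) powr (- (- \<nu>)) * (\<Sum>n. gen_g n \<nu> (- 2 * \<mu>) * (u / (1 - u) ^ 0) ^ n))"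
    by (rule substitution_sums[where C = C and R = "1 / (1/2)"]) (use C in auto)
  moreover have small: "\<forall>\<^sub>F u in nhds (0::complex). norm u < 1" by (rule eventually_norm_less) simp
  ultimately have 1: "\<forall>\<^sub>F u in nhds 0. (\<lambda>N. subst_coeff (\<lambda>n. gen_g n \<nu> (- 2 * \<mu>)) (- \<nu>) 0 N * u ^ N) sums
     ((1 + u) powr (\<nu> - 2 * \<mu>))"
  proof eventually_elim
    case (elim u)
    have "1 - u \<noteq> 0" using elim(2) by auto
    then have eq: "(1 - u) powr (- (- \<nu>)) * (X * (1 - u) powr (- \<nu>)) = X" for X
      by (simp add: powr_minus)
    have "(\<Sum>n. gen_g n \<nu> (- 2 * \<mu>) * (u / (1 - u) ^ 0) ^ n) = (1 + u) powr (\<nu> - 2 * \<mu>) * (1 - u) powr (- \<nu>)"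
      using gen_g_sums[OF elim(2), of \<nu> "- 2 * \<mu>"] by (simp add: sums_iff)
    with elim(1) show ?case by (simp only: eq)
  qed
  have 2: "\<forall>\<^sub>F u in nhds 0. (\<lambda>N. ((-1) ^ N * (pochhammer (2 * \<mu> - \<nu>) N / fact N)) * u ^ N) sums
     ((1 + u) powr (\<nu> - 2 * \<mu>))"
    using small
  proof eventually_elim
    case (elim u)
    have "pochhammer (2 * \<mu> - \<nu>) N / fact N * (- u) ^ N = ((-1) ^ N * (pochhammer (2 * \<mu> - \<nu>) N / fact N)) * u ^ N" for N
      by (subst power_minus) simp
    note h = this
    have "norm (- u) < 1" using elim by simp
    then show ?case using binomial_series[of "- u" "2 * \<mu> - \<nu>", unfolded h] by simp
  qed
  show ?thesis using power_series_unique[OF 1 2] by (simp add: fun_eq_iff)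
qed

text \<open>
  With \<open>z = -4u / (1 - u)\<^sup>2\<close> the square root of \<open>1 - z\<close> is \<open>(1 + u) / (1 - u)\<close>, so the generating function of the
  polynomials becomes a product of powers of \<open>1 + u\<close> and \<open>1 - u\<close>, and the prefactor removes the second one.
\<close>

lemma gen_p_substitution:
  "subst_coeff (\<lambda>n. (-4) ^ n * gen_p n (- \<nu> / 2) (2 * \<mu>) 1) (2 * \<mu> - \<nu>) 2 N = (-1) ^ N * (pochhammer (- \<nu>) N / fact N)"
proof -
  define p where "p n = gen_p n (- \<nu> / 2) (2 * \<mu>) 1" for n
  obtain C where C: "\<And>n. norm (p n) \<le> C * (1 / (1 / 2)) ^ n"
    using geometric_bound[of p "1/2"] gen_p_sums by (auto simp: sums_iff p_def)
  have "\<forall>\<^sub>F u in nhds 0. (\<lambda>N. subst_coeff (\<lambda>n. (-4) ^ n * p n) (2 * \<mu> - \<nu>) 2 N * u ^ N) sums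
     ((1 - u) powr (- (2 * \<mu> - \<nu>)) * (\<Sum>n. (-4) ^ n * p n * (u / (1 - u) ^ 2) ^ n))"
  proof (rule substitution_sums)
    show "norm ((-4) ^ n * p n) \<le> C * 8 ^ n" for n
    proof -
      have "norm ((-4) ^ n * p n) \<le> 4 ^ n * (C * 2 ^ n)"
        unfolding norm_mult norm_power using C[of n] by (intro mult_mono) auto
      also have "\<dots> = C * (4 * 2) ^ n" by (simp only: power_mult_distrib mult_ac)
      finally show ?thesis by simp
    qed
  qed simp
  moreover have small: "\<forall>\<^sub>F u in nhds (0::complex). norm u < 1" by (rule eventually_norm_less) simp
  moreover have "\<forall>\<^sub>F u in nhds (0::complex). norm (- 4 * u / (1 - u)\<^sup>2) < 1"
  proof -
    have "((\<lambda>u::complex. norm (- 4 * u / (1 - u)\<^sup>2)) \<longlongrightarrow> norm (- 4 * 0 / (1 - 0)\<^sup>2 :: complex)) (nhds 0)"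
      by (intro tendsto_intros filterlim_ident) auto
    then show ?thesis by (rule order_tendstoD) simp
  qed
  ultimately have 1: "\<forall>\<^sub>F u in nhds 0. (\<lambda>N. subst_coeff (\<lambda>n. (-4) ^ n * p n) (2 * \<mu> - \<nu>) 2 N * u ^ N) sums
     ((1 + u) powr \<nu>)"
  proof eventually_elim
    case (elim u)
    define q where "q = (1 + u) / (1 - u)"
    have nz: "1 - u \<noteq> 0" "1 + u \<noteq> 0"
      using Re_one_minus_pos[OF elim(2)] by (metis less_irrefl zero_complex.sel(1))+
    have qpos: "Re q > 0" and sq: "csqrt (1 - (- 4 * u / (1 - u)\<^sup>2)) = q"
      using csqrt_quadratic[of "- u"] elim(2) by (simp_all add: q_def)
    then have q0: "q \<noteq> 0" by auto
    have one_m: "1 - (- 4 * u / (1 - u)\<^sup>2) = q * q"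
      using sq by (metis power2_csqrt power2_eq_square)
    have Im: "\<bar>Im (Ln (1 + u))\<bar> < pi / 2" "\<bar>Im (Ln (1 - u))\<bar> < pi / 2" "\<bar>Im (Ln q)\<bar> < pi / 2"
      using Re_Ln_pos_lt_imp[OF Re_one_minus_pos(1)[OF elim(2)]]
        Re_Ln_pos_lt_imp[OF Re_one_minus_pos(2)[OF elim(2)]] Re_Ln_pos_lt_imp[OF qpos] by blast+
    have Lninv: "Ln (inverse (1 - u)) = - Ln (1 - u)"
      using one_minus_not_nonpos[OF elim(2)] by (intro Ln_inverse) auto
    have Lnq: "Ln q = Ln (1 + u) - Ln (1 - u)"
      unfolding q_def divide_inverse using Im nz Lninv
      by (subst Ln_times_simple) auto
    have Lnqq: "Ln (q * q) = 2 * Ln q"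
      using Im q0 by (subst Ln_times_simple) auto
    have "1 + q = of_real 2 * inverse (1 - u)"
      using nz by (simp add: q_def field_simps)
    then have Ln1q: "Ln (1 + q) = Ln 2 - Ln (1 - u)"
      using Ln_times_of_real[of 2 "inverse (1 - u)"] nz Lninv by simp
    have q1: "1 + q \<noteq> 0" using qpos by (auto simp: complex_eq_iff)
    have "(\<Sum>n. (-4) ^ n * p n * (u / (1 - u) ^ 2) ^ n) = (\<Sum>n. p n * (- 4 * u / (1 - u)\<^sup>2) ^ n)"
    proof (rule suminf_cong)
      fix n
      have "- 4 * u / (1 - u)\<^sup>2 = - 4 * (u / (1 - u)\<^sup>2)" by simp
      then show "(-4) ^ n * p n * (u / (1 - u) ^ 2) ^ n = p n * (- 4 * u / (1 - u)\<^sup>2) ^ n"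
        by (simp only: power_mult_distrib mult_ac)
    qed
    also have "\<dots> = 2 powr (2 * \<mu>) * ((1 - (- 4 * u / (1 - u)\<^sup>2)) powr (- (- \<nu> / 2)) * (1 + csqrt (1 - (- 4 * u / (1 - u)\<^sup>2))) powr (- (2 * \<mu>)))"
      using gen_p_sums[OF elim(3), of "- \<nu> / 2" "2 * \<mu>"] by (simp add: sums_iff p_def)
    also have "\<dots> = 2 powr (2 * \<mu>) * ((q * q) powr (\<nu> / 2) * (1 + q) powr (- (2 * \<mu>)))"
      unfolding sq unfolding one_m by simp
    also have "\<dots> = exp (2 * \<mu> * Ln 2) * (exp (\<nu> / 2 * (2 * Ln q)) * exp (- (2 * \<mu>) * (Ln 2 - Ln (1 - u))))"
    proof -
      have "(q * q) powr (\<nu> / 2) = exp (\<nu> / 2 * (2 * Ln q))"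
        unfolding powr_def Lnqq using q0 by simp
      moreover have "(1 + q) powr (- (2 * \<mu>)) = exp (- (2 * \<mu>) * (Ln 2 - Ln (1 - u)))"
        unfolding powr_def Ln1q using q1 by simp
      moreover have "2 powr (2 * \<mu>) = exp (2 * \<mu> * Ln 2)" by (simp add: powr_def)
      ultimately show ?thesis by (simp only:)
    qed
    also have "\<dots> = exp (2 * \<mu> * Ln 2 + (\<nu> / 2 * (2 * Ln q) + - (2 * \<mu>) * (Ln 2 - Ln (1 - u))))"
      by (simp only: exp_add)
    also have "2 * \<mu> * Ln 2 + (\<nu> / 2 * (2 * Ln q) + - (2 * \<mu>) * (Ln 2 - Ln (1 - u)))
       = \<nu> * Ln (1 + u) + (2 * \<mu> - \<nu>) * Ln (1 - u)"
      by (simp add: Lnq algebra_simps)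
    also have "(1 - u) powr (- (2 * \<mu> - \<nu>)) * exp (\<nu> * Ln (1 + u) + (2 * \<mu> - \<nu>) * Ln (1 - u)) = (1 + u) powr \<nu>"
    proof -
      have "(1 - u) powr (- (2 * \<mu> - \<nu>)) * exp (\<nu> * Ln (1 + u) + (2 * \<mu> - \<nu>) * Ln (1 - u)) =
            exp (- (2 * \<mu> - \<nu>) * Ln (1 - u) + (\<nu> * Ln (1 + u) + (2 * \<mu> - \<nu>) * Ln (1 - u)))"
        using nz by (simp only: powr_def exp_add if_False)
      also have "- (2 * \<mu> - \<nu>) * Ln (1 - u) + (\<nu> * Ln (1 + u) + (2 * \<mu> - \<nu>) * Ln (1 - u)) = \<nu> * Ln (1 + u)"
        by (simp add: algebra_simps)
      finally show ?thesis using nz by (simp add: powr_def)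
    qed
    finally show ?case using elim(1) by simp
  qed
  have 2: "\<forall>\<^sub>F u in nhds 0. (\<lambda>N. ((-1) ^ N * (pochhammer (- \<nu>) N / fact N)) * u ^ N) sums ((1 + u) powr \<nu>)"
    using small
  proof eventually_elim
    case (elim u)
    have "pochhammer (- \<nu>) N / fact N * (- u) ^ N = ((-1) ^ N * (pochhammer (- \<nu>) N / fact N)) * u ^ N" for N
      by (subst power_minus) simp
    note h = this
    have "norm (- u) < 1" using elim by simp
    then show ?case using binomial_series[of "- u" "- \<nu>", unfolded h] by simp
  qed
  show ?thesis using power_series_unique[OF 1 2] by (simp add: fun_eq_iff p_def)
qed

section \<open>Expansions with the coefficients of the generating functions\<close>

lemma weight_growth:
  fixes b c :: complex
  shows "\<exists>D>0. \<exists>s. \<forall>n. norm (pochhammer b n * rGamma (c + of_nat n)) \<le> D * real (n + 1) powr s"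
proof -
  obtain B C where B: "B > 0" "\<And>n. norm (pochhammer b n) \<le> B * fact n * real (n + 1) powr (Re b - 1)"
    and C: "C > 0" "\<And>n. norm (rGamma (c + of_nat n)) \<le> C * real (n + 1) powr (1 - Re c) / fact n"
    using pochhammer_growth[of b] rGamma_growth[of c] by blast
  have "norm (pochhammer b n * rGamma (c + of_nat n)) \<le> (B * C) * real (n + 1) powr (Re b - 1 + (1 - Re c))" for n
  proof -
    have "norm (pochhammer b n * rGamma (c + of_nat n)) \<le>
      (B * fact n * real (n + 1) powr (Re b - 1)) * (C * real (n + 1) powr (1 - Re c) / fact n)"
      unfolding norm_mult using B(1) C(1) by (intro mult_mono B C) auto
    also have "\<dots> = (B * C) * (real (n + 1) powr (Re b - 1) * real (n + 1) powr (1 - Re c))"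
      by simp
    finally show ?thesis by (simp only: powr_add)
  qed
  moreover have "B * C > 0" using B C by simp
  ultimately show ?thesis by blast
qed

text \<open>
  Since \<open>(b)\<^bsub>n + k\<^esub> = (b)\<^sub>n (b + n)\<^sub>k\<close>, the weights turn a shifted binomial series into a
  Gauss series with shifted parameters.
\<close>

lemma weighted_row:
  assumes "norm u < 1"
  shows "(\<Sum>k. (pochhammer b (n + k) * rGamma (c + of_nat (n + k))) * (pochhammer a k / fact k) * u ^ k)
       = pochhammer b n * hypergeo_reg_series a (b + of_nat n) (c + of_nat n) u"
proof -
  have "(pochhammer b (n + k) * rGamma (c + of_nat (n + k))) * (pochhammer a k / fact k) * u ^ k
     = pochhammer b n * (hyp_coeff a (b + of_nat n) (c + of_nat n) k * u ^ k)" for k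
  proof -
    have 1: "pochhammer b (n + k) = pochhammer b n * pochhammer (b + of_nat n) k"
      by (rule pochhammer_product')
    have 2: "c + of_nat (n + k) = c + of_nat n + of_nat k" by simp
    show ?thesis unfolding hyp_coeff_def 1 2 by simp
  qed
  then show ?thesis
    using sums_mult[OF hypergeo_reg_series_sums[OF assms], of "pochhammer b n"] by (simp add: sums_iff)
qed

text \<open>
  The identity between coefficients of \<open>gen_g_substitution\<close>, weighted by \<open>(b)\<^sub>N / \<Gamma>(c + N)\<close>.  A Cauchy product
  converges absolutely in the whole disc, so no continuation is involved.
\<close>

lemma gen_g_expansion:
  assumes v: "norm v < 1"
  shows "(\<lambda>n. pochhammer b n * gen_g n \<nu> (- 2 * \<mu>) * v ^ n * hypergeo_reg_series (- \<nu>) (b + of_nat n) (c + of_nat n) v)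
     sums hypergeo_reg_series b (2 * \<mu> - \<nu>) c (- v)"
proof -
  define e where "e n = gen_g n \<nu> (- 2 * \<mu>)" for n
  define w where "w n = pochhammer b n * rGamma (c + of_nat n)" for n
  define h where "h k = pochhammer (- \<nu>) k / fact k" for k :: nat
  obtain D s where D: "D > 0" and w: "\<And>n. norm (w n) \<le> D * real (n + 1) powr s"
    using weight_growth[of b c] unfolding w_def by blast
  have e_summable: "summable (\<lambda>n. e n * z ^ n)" if "norm z < 1" for z
    using gen_g_sums[OF that] by (auto simp: sums_iff e_def)
  have h_summable: "summable (\<lambda>n. h n * z ^ n)" if "norm z < 1" for z
    using binomial_series[OF that] by (auto simp: sums_iff h_def)
  define A where "A n = D * (norm (e n) * real (n + 1) powr s * norm v ^ n)" for n
  define B where "B k = norm (h k) * real (k + 1) powr \<bar>s\<bar> * norm v ^ k" for k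
  have "summable A" "summable B"
    unfolding A_def B_def using v
    by (intro summable_mult weighted_summable e_summable h_summable; simp)+
  moreover have "norm (e n * v ^ n * (w (n + k) * (pochhammer (- \<nu> + of_nat (0 * n)) k / fact k) * v ^ k)) \<le> A n * B k" for n k
  proof -
    have "norm (e n * v ^ n * (w (n + k) * (pochhammer (- \<nu> + of_nat (0 * n)) k / fact k) * v ^ k))
       = norm (w (n + k)) * (norm (e n) * norm v ^ n * norm (h k) * norm v ^ k)"
      by (simp add: h_def norm_mult norm_power norm_divide)
    also have "\<dots> \<le> (D * (real (n + 1) powr s * real (k + 1) powr \<bar>s\<bar>)) * (norm (e n) * norm v ^ n * norm (h k) * norm v ^ k)"
      using D by (intro mult_right_mono order_trans[OF w] mult_left_mono powr_sum_le) auto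
    finally show ?thesis by (simp add: A_def B_def mult_ac)
  qed
  ultimately have *: "(\<lambda>n. e n * v ^ n * (\<Sum>k. w (n + k) * (pochhammer (- \<nu> + of_nat (0 * n)) k / fact k) * v ^ k))
        sums (\<Sum>N. w N * subst_coeff e (- \<nu>) 0 N * v ^ N)"
    using D by (intro rearrangement_sums[of e v w "- \<nu>" 0 A B]) (auto simp: A_def B_def)
  have "w N * subst_coeff e (- \<nu>) 0 N * v ^ N = hyp_coeff b (2 * \<mu> - \<nu>) c N * (- v) ^ N" for N
  proof -
    have "subst_coeff e (- \<nu>) 0 N = (-1) ^ N * (pochhammer (2 * \<mu> - \<nu>) N / fact N)"
      unfolding e_def by (rule gen_g_substitution)
    then show ?thesis
      by (subst power_minus[of v]) (simp add: w_def hyp_coeff_def)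
  qed
  then have "(\<Sum>N. w N * subst_coeff e (- \<nu>) 0 N * v ^ N) = hypergeo_reg_series b (2 * \<mu> - \<nu>) c (- v)"
    by (simp only: hypergeo_reg_series_altdef)
  moreover have "(\<Sum>k. w (n + k) * (pochhammer (- \<nu> + of_nat (0 * n)) k / fact k) * v ^ k)
      = pochhammer b n * hypergeo_reg_series (- \<nu>) (b + of_nat n) (c + of_nat n) v" for n
    unfolding w_def using weighted_row[OF v] by simp
  ultimately show ?thesis using * by (simp only: e_def mult_ac)
qed

lemma gen_p_diagonal:
  "pochhammer b N * rGamma (c + of_nat N) *
     subst_coeff (\<lambda>n. (-4) ^ n * gen_p n (- \<nu> / 2) (2 * \<mu>) 1) (2 * \<mu> - \<nu>) 2 N * (- u) ^ N
   = hyp_coeff (- \<nu>) b c N * u ^ N"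
proof -
  have "(- u) ^ N = (-1) ^ N * u ^ N" by (rule power_minus)
  then show ?thesis
    unfolding gen_p_substitution by (simp add: hyp_coeff_def flip: mult.assoc power_mult_distrib)
qed

lemma gen_p_row:
  assumes "norm u < 1"
  shows "(-4) ^ n * p * (- u) ^ n * (\<Sum>k. (pochhammer b (n + k) * rGamma (c + of_nat (n + k))) *
            (pochhammer (a + of_nat (2 * n)) k / fact k) * (- u) ^ k)
     = pochhammer b n * p * (4 * u) ^ n *
         hypergeo_reg_series (a + of_nat (2 * n)) (b + of_nat n) (c + of_nat n) (- u)"
proof -
  have "(4 * u) ^ n = ((-4) * (- u)) ^ n" by simp
  also have "\<dots> = (-4) ^ n * (- u) ^ n" by (rule power_mult_distrib)
  finally show ?thesis
    using weighted_row[of "- u" b n c "a + of_nat (2 * n)"] assms by (simp only: norm_minus_cancel mult_ac)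
qed

lemma gen_p_summable: "norm z < 1 \<Longrightarrow> summable (\<lambda>n. gen_p n \<rho> \<tau> 1 * z ^ n)"
  using gen_p_sums by (blast intro: sums_summable)

text \<open>
  The identity of \<open>gen_p_substitution\<close>, weighted likewise.  The double series need not converge
  absolutely unless \<open>u\<close> is small.
\<close>

lemma gen_p_expansion_near_0:
  "\<forall>\<^sub>F u in nhds 0. (\<lambda>n. pochhammer b n * gen_p n (- \<nu> / 2) (2 * \<mu>) 1 * (4 * u) ^ n *
       hypergeo_reg_series (2 * \<mu> - \<nu> + of_nat (2 * n)) (b + of_nat n) (c + of_nat n) (- u))
     sums hypergeo_reg_series (- \<nu>) b c u"
proof -
  define p where "p n = gen_p n (- \<nu> / 2) (2 * \<mu>) 1" for n
  define e where "e n = (-4) ^ n * p n" for n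
  define w where "w n = pochhammer b n * rGamma (c + of_nat n)" for n
  obtain C where C: "\<And>n. norm (p n) \<le> C * (1 / (1 / 2)) ^ n"
    using geometric_bound[of p "1/2"] gen_p_summable by (auto simp: p_def)
  have e: "norm (e n) \<le> C * 8 ^ n" for n
  proof -
    have "norm ((-4) ^ n * p n) \<le> 4 ^ n * (C * 2 ^ n)"
      unfolding norm_mult norm_power using C[of n] by (intro mult_mono) auto
    also have "\<dots> = C * (4 * 2) ^ n" by (simp only: power_mult_distrib mult_ac)
    finally show ?thesis by (simp add: e_def)
  qed
  obtain D s where D: "D > 0" and w: "\<And>n. norm (w n) \<le> D * real (n + 1) powr s"
    using weight_growth[of b c] unfolding w_def by blast
  have "\<exists>E. \<forall>n. norm (w n) \<le> E * (1 / (1/2)) ^ n"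
  proof (rule geometric_bound)
    show "summable (\<lambda>n. w n * z ^ n)" if "norm z < 1" for z
      by (rule summable_norm_cancel[OF powr_bounded_summable[OF w that]])
  qed auto
  then obtain E where E: "\<And>n. norm (w n) \<le> E * 2 ^ n" by auto
  have "\<forall>\<^sub>F u in nhds 0.
     (\<lambda>n. e n * u ^ n * (\<Sum>k. w (n + k) * (pochhammer (2 * \<mu> - \<nu> + of_nat (2 * n)) k / fact k) * u ^ k))
        sums (\<Sum>N. w N * subst_coeff e (2 * \<mu> - \<nu>) 2 N * u ^ N) \<and>
     summable (\<lambda>N. w N * subst_coeff e (2 * \<mu> - \<nu>) 2 N * u ^ N)"
    using e E by (intro weighted_rearrangement) auto
  \<comment> \<open>The rearranged series is used at \<open>-u\<close>.\<close>
  then have "\<forall>\<^sub>F u in nhds (- 0).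
     (\<lambda>n. e n * u ^ n * (\<Sum>k. w (n + k) * (pochhammer (2 * \<mu> - \<nu> + of_nat (2 * n)) k / fact k) * u ^ k))
        sums (\<Sum>N. w N * subst_coeff e (2 * \<mu> - \<nu>) 2 N * u ^ N)"
    by (auto elim: eventually_mono)
  from eventually_compose_filterlim[OF this tendsto_minus[OF filterlim_ident]]
    eventually_norm_less[OF zero_less_one]
  show ?thesis
  proof eventually_elim
    case (elim u)
    show ?case
      using elim(1) unfolding e_def w_def p_def gen_p_row[OF elim(2)] gen_p_diagonal
      by (simp only: hypergeo_reg_series_altdef)
  qed
qed

text \<open>
  If \<open>b = -M\<close>, all weights beyond \<open>M\<close> vanish and the double series is a finite sum, whatever the size of
  the individual factors.
\<close>

lemma gen_p_expansion_terminating: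
  assumes u: "norm u < 1"
  shows "(\<lambda>n. pochhammer (- of_nat M) n * gen_p n (- \<nu> / 2) (2 * \<mu>) 1 * (4 * u) ^ n *
       hypergeo_reg_series (2 * \<mu> - \<nu> + of_nat (2 * n)) (- of_nat M + of_nat n) (c + of_nat n) (- u))
     sums hypergeo_reg_series (- \<nu>) (- of_nat M) c u"
proof -
  define e where "e n = (-4) ^ n * gen_p n (- \<nu> / 2) (2 * \<mu>) 1" for n
  define b where "b = (- of_nat M :: complex)"
  define w where "w n = pochhammer b n * rGamma (c + of_nat n)" for n
  define f where "f n k = e n * (- u) ^ n * (w (n + k) * (pochhammer (2 * \<mu> - \<nu> + of_nat (2 * n)) k / fact k) * (- u) ^ k)" for n k
  define S where "S = (\<Sum>n\<le>M. \<Sum>k\<le>M. norm (f n k))"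
  define A where "A n = (if n \<in> {..M} then S else 0)" for n
  define B where "B k = (if k \<in> {..M} then 1 else 0 :: real)" for k
  have S: "S \<ge> 0" by (auto simp: S_def intro!: sum_nonneg)
  have "norm (f n k) \<le> A n * B k" for n k
  proof (cases "n \<le> M \<and> k \<le> M")
    case True
    have "norm (f n k) \<le> (\<Sum>k\<le>M. norm (f n k))"
      using True by (intro member_le_sum) auto
    also have "\<dots> \<le> S"
      unfolding S_def using True by (intro member_le_sum[of n "{..M}" "\<lambda>n. \<Sum>k\<le>M. norm (f n k)"]) (auto intro: sum_nonneg)
    finally show ?thesis using True by (simp add: A_def B_def)
  next
    case False
    then have "w (n + k) = 0"
      by (auto simp: w_def b_def pochhammer_of_nat_eq_0_iff)
    then have "f n k = 0" by (simp only: f_def mult_zero_left mult_zero_right)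
    then show ?thesis using S by (simp add: A_def B_def)
  qed
  moreover have "summable A" "summable B"
    unfolding A_def B_def by (rule summable_If_finite_set; simp)+
  ultimately have "(\<lambda>n. e n * (- u) ^ n * (\<Sum>k. w (n + k) * (pochhammer (2 * \<mu> - \<nu> + of_nat (2 * n)) k / fact k) * (- u) ^ k))
        sums (\<Sum>N. w N * subst_coeff e (2 * \<mu> - \<nu>) 2 N * (- u) ^ N)"
    using S unfolding f_def by (intro rearrangement_sums(1)[of e "- u" w "2 * \<mu> - \<nu>" 2 A B]) (auto simp: A_def B_def)
  then show ?thesis
    unfolding e_def w_def gen_p_row[OF u] gen_p_diagonal
    by (simp only: hypergeo_reg_series_altdef b_def)
qed

text \<open>
  The parameters of the two Pochhammer symbols differ, so they do not combine; but \<open>\<bar>(a + n)\<^sub>k\<bar>\<close> is at most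
  \<open>(A)\<^bsub>n + k\<^esub> / n!\<close> for \<open>A = \<bar>a\<bar> + 1\<close>, and the factorials cancel.
\<close>

lemma shifted_weight_growth:
  fixes a b c :: complex
  shows "\<exists>C>0. \<exists>K. \<forall>n k. norm (pochhammer b n * pochhammer (a + of_nat n) k * rGamma (c + of_nat n + of_nat k))
      \<le> C * (real (n + 1) powr K * real (k + 1) powr K)"
proof -
  define A where "A = norm a + 1"
  obtain B where B: "B > 0" "\<And>n. norm (pochhammer b n) \<le> B * fact n * real (n + 1) powr (Re b - 1)"
    using pochhammer_growth by blast
  obtain G where G: "G > 0" "\<And>n. norm (rGamma (c + of_nat n)) \<le> G * real (n + 1) powr (1 - Re c) / fact n"
    using rGamma_growth by blast
  obtain L where L: "L > 0" "\<And>n. norm (pochhammer (of_real A :: complex) n) \<le> L * fact n * real (n + 1) powr (A - 1)"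
    using pochhammer_growth[of "of_real A"] by auto
  have L': "pochhammer A n \<le> L * fact n * real (n + 1) powr (A - 1)" for n
    using L(2)[of n] by (simp add: pochhammer_of_real)
  have shift: "norm (pochhammer (a + of_nat n) k) \<le> pochhammer A (n + k) / fact n" for n k
  proof -
    have "norm (a + of_nat n) \<le> norm a + real n"
      by (metis norm_of_nat norm_triangle_ineq)
    then have "norm (pochhammer (a + of_nat n) k) \<le> pochhammer (A + real n) k"
      by (intro order_trans[OF norm_pochhammer_le] pochhammer_mono_real) (auto simp: A_def)
    moreover have "fact n \<le> pochhammer A n"
      unfolding pochhammer_fact by (rule pochhammer_mono_real) (auto simp: A_def)
    ultimately have "norm (pochhammer (a + of_nat n) k) * fact n \<le> pochhammer (A + real n) k * pochhammer A n"
      by (intro mult_mono) (auto intro!: pochhammer_nonneg_real simp: A_def)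
    also have "\<dots> = pochhammer A (n + k)" by (simp add: pochhammer_product')
    finally show ?thesis by (simp add: field_simps)
  qed
  define s where "s = A - 1 + (1 - Re c)"
  define K where "K = \<bar>Re b - 1\<bar> + \<bar>s\<bar>"
  have "norm (pochhammer b n * pochhammer (a + of_nat n) k * rGamma (c + of_nat n + of_nat k))
      \<le> (B * L * G) * (real (n + 1) powr K * real (k + 1) powr K)" for n k
  proof -
    have g: "norm (rGamma (c + of_nat n + of_nat k)) \<le> G * real (n + k + 1) powr (1 - Re c) / fact (n + k)"
      using G(2)[of "n + k"] by (simp add: add.assoc)
    have "norm (pochhammer b n * pochhammer (a + of_nat n) k * rGamma (c + of_nat n + of_nat k)) \<le>
       (B * fact n * real (n + 1) powr (Re b - 1)) *
       ((L * fact (n + k) * real (n + k + 1) powr (A - 1)) / fact n) * (G * real (n + k + 1) powr (1 - Re c) / fact (n + k))"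
      unfolding norm_mult using B(1) L(1) G(1)
      by (intro mult_mono B g order_trans[OF shift] divide_right_mono L') auto
    also have "\<dots> = (B * L * G) * (real (n + 1) powr (Re b - 1) * (real (n + k + 1) powr (A - 1) * real (n + k + 1) powr (1 - Re c)))"
      by (simp only: times_divide_eq_right times_divide_eq_left) (simp add: field_simps)
    also have "\<dots> = (B * L * G) * (real (n + 1) powr (Re b - 1) * real (n + k + 1) powr s)"
      by (simp only: s_def powr_add)
    also have "\<dots> \<le> (B * L * G) * (real (n + 1) powr \<bar>Re b - 1\<bar> * (real (n + 1) powr \<bar>s\<bar> * real (k + 1) powr \<bar>s\<bar>))"
    proof (intro mult_left_mono mult_mono)
      have "real (n + k + 1) powr s \<le> real (n + 1) powr s * real (k + 1) powr \<bar>s\<bar>" by (rule powr_sum_le)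
      also have "\<dots> \<le> real (n + 1) powr \<bar>s\<bar> * real (k + 1) powr \<bar>s\<bar>"
        by (intro mult_right_mono powr_mono) auto
      finally show "real (n + k + 1) powr s \<le> real (n + 1) powr \<bar>s\<bar> * real (k + 1) powr \<bar>s\<bar>" .
      show "real (n + 1) powr (Re b - 1) \<le> real (n + 1) powr \<bar>Re b - 1\<bar>" by (intro powr_mono) auto
    qed (use B L G in auto)
    also have "\<dots> = (B * L * G) * (real (n + 1) powr K * real (k + 1) powr \<bar>s\<bar>)"
      by (simp add: K_def powr_add mult_ac)
    also have "\<dots> \<le> (B * L * G) * (real (n + 1) powr K * real (k + 1) powr K)"
      using B L G by (intro mult_left_mono powr_mono) (auto simp: K_def)
    finally show ?thesis .
  qed
  moreover have "B * L * G > 0" using B L G by simp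
  ultimately show ?thesis by blast
qed

text \<open>
  Multiplied by \<open>(b)\<^sub>n\<close>, a regularized Gauss series whose first and third parameters grow together
  with \<open>n\<close> is of polynomial size in \<open>n\<close>, uniformly on smaller discs.  Hence the sum converges locally uniformly as soon as the coefficients
  \<open>p\<close> define a power series on the unit disc.
\<close>

lemma shifted_sum_holomorphic:
  fixes p :: "nat \<Rightarrow> complex" and a b c d :: complex
  assumes p: "\<And>z. norm z < 1 \<Longrightarrow> summable (\<lambda>n. p n * z ^ n)"
  defines "T \<equiv> \<lambda>n z. pochhammer b n * p n * z ^ n * hypergeo_reg_series (a + of_nat n) d (c + of_nat n) z"
  shows "\<And>z. norm z < 1 \<Longrightarrow> summable (\<lambda>n. T n z)"
    and "(\<lambda>z. \<Sum>n. T n z) holomorphic_on ball 0 1"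
proof -
  obtain C K where C: "C > 0" and CK: "\<And>n k. norm (pochhammer b n * pochhammer (a + of_nat n) k * rGamma (c + of_nat n + of_nat k))
      \<le> C * (real (n + 1) powr K * real (k + 1) powr K)"
    using shifted_weight_growth by blast
  define h where "h k = pochhammer d k / fact k" for k
  have h_summable: "summable (\<lambda>n. h n * z ^ n)" if "norm z < 1" for z
    using binomial_series[OF that] by (auto simp: sums_iff h_def)
  define L where "L r = (\<Sum>k. norm (h k) * real (k + 1) powr K * r ^ k)" for r
  define M where "M r n = C * L r * (norm (p n) * real (n + 1) powr K * r ^ n)" for r n
  have M_summable: "summable (M r)" if "0 \<le> r" "r < 1" for r
    unfolding M_def using that by (intro summable_mult weighted_summable p) auto
  have bound: "norm (T n z) \<le> M r n" if z: "norm z \<le> r" and r: "r < 1" for n z r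
  proof -
    have r0: "0 \<le> r" using z norm_ge_zero order_trans by blast
    have z1: "norm z < 1" using z r by simp
    have Lsum: "summable (\<lambda>k. norm (h k) * real (k + 1) powr K * r ^ k)"
      using r0 r by (intro weighted_summable h_summable) auto
    have s1: "summable (\<lambda>k. norm (pochhammer b n * (hyp_coeff (a + of_nat n) d (c + of_nat n) k * z ^ k)))"
      unfolding norm_mult[of "pochhammer b n"] using hyp_coeff_summable[OF z1] by (intro summable_mult)
    have "pochhammer b n * hypergeo_reg_series (a + of_nat n) d (c + of_nat n) z
        = (\<Sum>k. pochhammer b n * (hyp_coeff (a + of_nat n) d (c + of_nat n) k * z ^ k))"
      using sums_mult[OF hypergeo_reg_series_sums[OF z1]] by (simp add: sums_iff)
    also have "norm \<dots> \<le> (\<Sum>k. norm (pochhammer b n * (hyp_coeff (a + of_nat n) d (c + of_nat n) k * z ^ k)))"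
      by (rule summable_norm[OF s1])
    also have "\<dots> \<le> (\<Sum>k. C * real (n + 1) powr K * (norm (h k) * real (k + 1) powr K * r ^ k))"
    proof (rule suminf_le[OF _ s1 summable_mult[OF Lsum]])
      fix k
      have "norm (pochhammer b n * (hyp_coeff (a + of_nat n) d (c + of_nat n) k * z ^ k))
          = norm (pochhammer b n * pochhammer (a + of_nat n) k * rGamma (c + of_nat n + of_nat k)) * norm (h k) * norm z ^ k"
        by (simp add: hyp_coeff_def h_def norm_mult norm_divide norm_power)
      also have "\<dots> \<le> (C * (real (n + 1) powr K * real (k + 1) powr K)) * norm (h k) * r ^ k"
        using C z by (intro mult_mono CK power_mono) auto
      finally show "norm (pochhammer b n * (hyp_coeff (a + of_nat n) d (c + of_nat n) k * z ^ k))
          \<le> C * real (n + 1) powr K * (norm (h k) * real (k + 1) powr K * r ^ k)"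
        by (simp add: mult_ac)
    qed
    also have "\<dots> = C * real (n + 1) powr K * L r"
      unfolding L_def by (rule suminf_mult[OF Lsum])
    finally have *: "norm (pochhammer b n * hypergeo_reg_series (a + of_nat n) d (c + of_nat n) z) \<le> C * real (n + 1) powr K * L r" .
    have "norm (T n z) = norm (p n) * norm z ^ n * norm (pochhammer b n * hypergeo_reg_series (a + of_nat n) d (c + of_nat n) z)"
      by (simp add: T_def norm_mult norm_power)
    also have "\<dots> \<le> norm (p n) * r ^ n * (C * real (n + 1) powr K * L r)"
      using z r0 by (intro mult_mono * power_mono) auto
    finally show ?thesis by (simp add: M_def mult_ac)
  qed
  show "summable (\<lambda>n. T n z)" if "norm z < 1" for z
    by (rule summable_comparison_test'[OF M_summable[of "norm z"], of 0]) (use bound that in auto)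
  have T_hol: "T n holomorphic_on ball 0 1" for n
    unfolding T_def by (intro holomorphic_intros hypergeo_reg_series_holomorphic)
  show "(\<lambda>z. \<Sum>n. T n z) holomorphic_on ball 0 1"
  proof (rule holomorphic_uniform_sequence[of _ "\<lambda>n z. \<Sum>i<n. T i z"])
    show "(\<lambda>z. \<Sum>i<n. T i z) holomorphic_on ball 0 1" for n
      by (intro holomorphic_intros T_hol)
    fix x :: complex assume x: "x \<in> ball 0 1"
    define r where "r = (1 + norm x) / 2"
    have r: "norm x < r" "r < 1" "0 \<le> r" using x by (auto simp: r_def intro: add_nonneg_nonneg)
    have sub: "norm z \<le> r" if "z \<in> cball x (r - norm x)" for z
      using that norm_triangle_ineq2[of z x] by (auto simp: dist_norm norm_minus_commute)
    have "uniform_limit (cball x (r - norm x)) (\<lambda>n z. \<Sum>i<n. T i z) (\<lambda>z. \<Sum>n. T n z) sequentially"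
      by (rule Weierstrass_m_test[OF bound M_summable]) (use sub r in auto)
    moreover have "cball x (r - norm x) \<subseteq> ball 0 1" using sub r by force
    ultimately show "\<exists>d>0. cball x d \<subseteq> ball 0 1 \<and> uniform_limit (cball x d) (\<lambda>n z. \<Sum>i<n. T i z) (\<lambda>z. \<Sum>n. T n z) sequentially"
      using r by (intro exI[of _ "r - norm x"]) auto
  qed auto
qed

text \<open>
  The quadratic transformation exhibits the terms of the expansion as \<open>p z\<^sup>n\<close> times a factor of
  polynomial growth in \<open>n\<close>.  In this form convergence for \<open>\<bar>z\<bar> < 1\<close> is visible.
\<close>

lemma gen_p_term:
  assumes z: "norm z < 1"
  defines "u \<equiv> quad_root z"
  shows "pochhammer (\<mu> - \<nu>) n * p * (4 * u) ^ n *
       hypergeo_reg_series (2 * \<mu> - \<nu> + of_nat (2 * n)) (\<mu> - \<nu> + of_nat n) (1 + \<mu> + of_nat n) (- u)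
    = (1 + u) powr (\<nu> - 2 * \<mu>) * (pochhammer (\<mu> - \<nu>) n * p * z ^ n *
       hypergeo_reg_series (\<mu> - \<nu> / 2 + of_nat n) ((1 + \<nu>) / 2) (1 + \<mu> + of_nat n) z)"
proof -
  define a where "a = 2 * \<mu> - \<nu> + of_nat (2 * n)"
  define b where "b = \<mu> - \<nu> + of_nat n"
  have u1: "1 + u \<noteq> 0" unfolding u_def using one_plus_quad_root_nonzero[OF z] .
  have eqs: "a - b + 1 = 1 + \<mu> + of_nat n" "a / 2 = \<mu> - \<nu> / 2 + of_nat n" "(a + 1) / 2 - b = (1 + \<nu>) / 2"
    by (simp_all add: a_def b_def field_simps)
  have "(1 + u) powr (- a) = (1 + u) powr (\<nu> - 2 * \<mu>) * (1 + u) powr (- of_nat (2 * n))"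
    by (simp add: a_def flip: powr_add)
  also have "(1 + u) powr (- of_nat (2 * n)) = 1 / ((1 + u)\<^sup>2) ^ n"
    using u1 by (simp add: powr_minus powr_nat' power_mult divide_simps del: of_nat_mult)
  finally have pw: "(1 + u) powr (- a) = (1 + u) powr (\<nu> - 2 * \<mu>) * (1 / ((1 + u)\<^sup>2) ^ n)" .
  have "z ^ n = (4 * u / (1 + u)\<^sup>2) ^ n" using quad_root_eq[OF z] by (simp add: u_def)
  also have "\<dots> = (4 * u) ^ n * (1 / ((1 + u)\<^sup>2) ^ n)" by (simp add: power_divide)
  finally have zn: "z ^ n = (4 * u) ^ n * (1 / ((1 + u)\<^sup>2) ^ n)" .
  have "hypergeo_reg_series a b (1 + \<mu> + of_nat n) (- u) =
     (1 + u) powr (\<nu> - 2 * \<mu>) * (1 / ((1 + u)\<^sup>2) ^ n) * hypergeo_reg_series (\<mu> - \<nu> / 2 + of_nat n) ((1 + \<nu>) / 2) (1 + \<mu> + of_nat n) z"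
    using hypergeo_reg_series_quadratic[OF z, of a b] unfolding eqs u_def[symmetric] pw .
  then show ?thesis unfolding zn a_def b_def by (simp only: mult_ac)
qed

text \<open>
  Both sides are holomorphic functions of \<open>z\<close> on the unit disc and agree near \<open>0\<close>.
\<close>

lemma gen_p_expansion:
  assumes z: "norm z < 1"
  defines "u \<equiv> quad_root z"
  shows "(\<lambda>n. pochhammer (\<mu> - \<nu>) n * gen_p n (- \<nu> / 2) (2 * \<mu>) 1 * (4 * u) ^ n *
       hypergeo_reg_series (2 * \<mu> - \<nu> + of_nat (2 * n)) (\<mu> - \<nu> + of_nat n) (1 + \<mu> + of_nat n) (- u))
     sums hypergeo_reg_series (- \<nu>) (\<mu> - \<nu>) (1 + \<mu>) u"
proof -
  define p where "p n = gen_p n (- \<nu> / 2) (2 * \<mu>) 1" for n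
  define T where "T n z = pochhammer (\<mu> - \<nu>) n * p n * z ^ n *
       hypergeo_reg_series (\<mu> - \<nu> / 2 + of_nat n) ((1 + \<nu>) / 2) (1 + \<mu> + of_nat n) z" for n z
  have p: "summable (\<lambda>n. p n * z ^ n)" if "norm z < 1" for z
    using gen_p_summable[OF that] by (simp add: p_def)
  have T_summable: "summable (\<lambda>n. T n z)" if "norm z < 1" for z
    unfolding T_def by (rule shifted_sum_holomorphic(1)[OF p that])
  have T_hol: "(\<lambda>z. \<Sum>n. T n z) holomorphic_on ball 0 1"
    unfolding T_def by (rule shifted_sum_holomorphic(2)[OF p])
  define G where "G z = (1 + quad_root z) powr (\<nu> - 2 * \<mu>) * (\<Sum>n. T n z)" for z
  define R where "R z = hypergeo_reg_series (- \<nu>) (\<mu> - \<nu>) (1 + \<mu>) (quad_root z)" for z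
  have "\<forall>\<^sub>F z in nhds 0. G z = R z"
    using eventually_quad_root(1)[OF gen_p_expansion_near_0[of "\<mu> - \<nu>" \<nu> \<mu> "1 + \<mu>"]]
      eventually_norm_less[OF zero_less_one]
  proof eventually_elim
    case (elim z)
    have "(\<lambda>n. (1 + quad_root z) powr (\<nu> - 2 * \<mu>) * T n z) sums R z"
      using elim(1) unfolding gen_p_term[OF elim(2)] unfolding T_def p_def R_def .
    moreover have "(\<lambda>n. (1 + quad_root z) powr (\<nu> - 2 * \<mu>) * T n z) sums G z"
      unfolding G_def by (intro sums_mult summable_sums T_summable elim(2))
    ultimately show ?case by (simp add: sums_iff)
  qed
  then have "G z = R z"
  proof (rule continuation_unique[of "ball 0 1" z G "ball 0 1" R R, rotated 10])
    show "G holomorphic_on ball 0 1"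
      unfolding G_def using norm_quad_root one_minus_not_nonpos
      by (intro holomorphic_intros quad_root_holomorphic T_hol) auto
    have "(hypergeo_reg_series (- \<nu>) (\<mu> - \<nu>) (1 + \<mu>) \<circ> quad_root) holomorphic_on ball 0 1"
      by (rule holomorphic_on_compose_gen[OF quad_root_holomorphic hypergeo_reg_series_holomorphic])
         (use norm_quad_root in auto)
    then show "R holomorphic_on ball 0 1" by (simp add: R_def[abs_def] o_def)
  qed (use z in auto)
  moreover have "(\<lambda>n. (1 + u) powr (\<nu> - 2 * \<mu>) * T n z) sums G z"
    unfolding G_def u_def by (intro sums_mult summable_sums T_summable z)
  ultimately show ?thesis
    unfolding u_def gen_p_term[OF z] by (simp add: T_def p_def R_def)
qed

section \<open>The boundary point\<close>

lemma power_series_product: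
  fixes a b c :: "nat \<Rightarrow> complex"
  assumes "\<forall>\<^sub>F z in nhds 0. (\<lambda>n. a n * z ^ n) sums f z"
    and "\<forall>\<^sub>F z in nhds 0. (\<lambda>n. b n * z ^ n) sums g z"
    and "\<forall>\<^sub>F z in nhds 0. (\<lambda>n. c n * z ^ n) sums (f z * g z)"
  shows "c n = (\<Sum>i\<le>n. a i * b (n - i))"
proof -
  have "f has_fps_expansion Abs_fps a" "g has_fps_expansion Abs_fps b"
    "(\<lambda>z. f z * g z) has_fps_expansion Abs_fps c"
    using assms by (auto intro!: has_fps_expansionI)
  then have "Abs_fps c = Abs_fps a * Abs_fps b"
    using fps_expansion_unique_complex has_fps_expansion_mult by blast
  then have "fps_nth (Abs_fps c) n = fps_nth (Abs_fps a * Abs_fps b) n" by simp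
  then show ?thesis by (simp add: fps_mult_nth atLeast0AtMost)
qed

lemma summable_powr_Suc: "s < -1 \<Longrightarrow> summable (\<lambda>n. real (n + 1) powr s)"
  using summable_real_powr_iff[of s] by (subst (asm) summable_Suc_iff[symmetric]) (simp add: add_ac)

lemma summable_norm_Cauchy_product:
  fixes a b :: "nat \<Rightarrow> complex"
  assumes "summable (\<lambda>n. norm (a n))" "summable (\<lambda>n. norm (b n))"
  shows "summable (\<lambda>n. norm (\<Sum>i\<le>n. a i * b (n - i)))"
proof (rule summable_comparison_test')
  show "summable (\<lambda>n. \<Sum>i\<le>n. norm (a i) * norm (b (n - i)))"
    using assms by (intro summable_Cauchy_product) auto
  show "norm (norm (\<Sum>i\<le>n. a i * b (n - i))) \<le> (\<Sum>i\<le>n. norm (a i) * norm (b (n - i)))" for n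
    using norm_sum[of "\<lambda>i. a i * b (n - i)" "{..n}"] by (simp add: norm_mult)
qed

lemma one_plus_quad_root_powr:
  assumes "norm z < 1"
  shows "(1 + quad_root z) powr a = 2 powr a * (1 + csqrt (1 - z)) powr (- a)"
proof -
  define t where "t = 1 + csqrt (1 - z)"
  have t: "Re t > 0" using csqrt_one_minus_pos[OF assms] by (simp only: t_def plus_complex.sel one_complex.sel)
  then have "t \<noteq> 0" "t \<notin> \<real>\<^sub>\<le>\<^sub>0" by (auto simp: complex_nonpos_Reals_iff)
  then have "Ln (of_real 2 * inverse t) = Ln 2 - Ln t"
    using Ln_times_of_real[of 2 "inverse t"] Ln_inverse[of t] by simp
  then have L: "Ln (2 / t) = Ln 2 - Ln t" by (simp add: divide_inverse)
  have "(2 / t) powr a = exp (a * Ln 2 + (- a) * Ln t)"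
    unfolding powr_def L using \<open>t \<noteq> 0\<close> by (simp add: algebra_simps)
  also have "\<dots> = 2 powr a * t powr (- a)"
    unfolding powr_def exp_add using \<open>t \<noteq> 0\<close> by simp
  finally show ?thesis by (simp add: one_plus_quad_root[OF assms] t_def)
qed

lemma gen_p_zero_sums:
  assumes "norm z < 1"
  shows "(\<lambda>k. gen_p k 0 \<tau> 1 * z ^ k) sums (2 powr \<tau> * (1 + csqrt (1 - z)) powr (- \<tau>))"
proof -
  have "1 - z \<noteq> 0" using assms by auto
  then show ?thesis using gen_p_sums[OF assms, of 0 \<tau>] by simp
qed

lemma eventually_norm_lessI:
  assumes "\<And>z::complex. norm z < 1 \<Longrightarrow> P z"
  shows "\<forall>\<^sub>F z in nhds 0. P z"
  using eventually_norm_less[OF zero_less_one] by (rule eventually_mono) (rule assms)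

text \<open>
  The quadratic transformation with \<open>b = 0\<close> has a constant left-hand side and thereby evaluates the
  coefficients for \<open>\<rho> = 0\<close> in closed form; they are of order \<open>n\<^bsup>-3/2\<^esup>\<close>.  The closed form carries
  the factor \<open>1 / \<Gamma>(\<tau> + 1)\<close>, which must not vanish.
\<close>

lemma gen_p_zero_abs_summable_pos:
  assumes "Re \<tau> > 0"
  shows "summable (\<lambda>n. norm (gen_p n 0 \<tau> 1))"
proof -
  define h where "h n = hyp_coeff (\<tau> / 2) ((\<tau> + 1) / 2) (\<tau> + 1) n" for n
  define r where "r = rGamma (\<tau> + 1)"
  have "\<tau> + 1 \<notin> \<int>\<^sub>\<le>\<^sub>0"
    using assms by (auto elim!: nonpos_Ints_cases simp: complex_eq_iff)
  then have r: "r \<noteq> 0" by (simp add: r_def rGamma_eq_zero_iff)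
  have const: "hypergeo_reg_series \<tau> 0 (\<tau> + 1) w = r" for w
  proof -
    have "(\<lambda>n. hyp_coeff \<tau> 0 (\<tau> + 1) n * w ^ n) sums (\<Sum>n\<in>{0}. hyp_coeff \<tau> 0 (\<tau> + 1) n * w ^ n)"
      by (rule sums_finite) (auto simp: hyp_coeff_def pochhammer_0_left)
    then show ?thesis by (simp add: hypergeo_reg_series_altdef sums_iff hyp_coeff_def r_def)
  qed
  have h: "(\<lambda>n. h n * z ^ n) sums (r * (2 powr \<tau> * (1 + csqrt (1 - z)) powr (- \<tau>)))" if z: "norm z < 1" for z
  proof -
    have "r = (1 + quad_root z) powr (- \<tau>) * hypergeo_reg_series (\<tau> / 2) ((\<tau> + 1) / 2) (\<tau> + 1) z"
      using hypergeo_reg_series_quadratic[OF z, of \<tau> 0] by (simp add: const)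
    then have "hypergeo_reg_series (\<tau> / 2) ((\<tau> + 1) / 2) (\<tau> + 1) z = r * (1 + quad_root z) powr \<tau>"
      using one_plus_quad_root_nonzero[OF z] by (simp add: powr_minus field_simps)
    then show ?thesis
      using hypergeo_reg_series_sums[OF z] unfolding h_def one_plus_quad_root_powr[OF z] by metis
  qed
  have g: "(\<lambda>n. r * gen_p n 0 \<tau> 1 * z ^ n) sums (r * (2 powr \<tau> * (1 + csqrt (1 - z)) powr (- \<tau>)))" if "norm z < 1" for z
    using sums_mult[OF gen_p_zero_sums[OF that], of r] by (simp add: mult.assoc)
  have "h = (\<lambda>n. r * gen_p n 0 \<tau> 1)"
    by (rule power_series_unique; rule eventually_norm_lessI) (use h g in auto)
  then have eq: "norm (gen_p n 0 \<tau> 1) = norm (h n) / norm r" for n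
    using r by (simp add: norm_mult)
  obtain C where C: "\<And>n. norm (h n) \<le> C * real (n + 1) powr (Re (\<tau> / 2) + Re ((\<tau> + 1) / 2) - Re (\<tau> + 1) - 1)"
    using hyp_coeff_growth unfolding h_def by blast
  have "Re (\<tau> / 2) + Re ((\<tau> + 1) / 2) - Re (\<tau> + 1) - 1 = - 3 / 2" by (simp add: field_simps)
  with C have "norm (h n) \<le> C * real (n + 1) powr (- 3 / 2)" for n by metis
  then have "summable (\<lambda>n. norm (h n))"
    by (intro summable_comparison_test'[OF summable_mult[OF summable_powr_Suc[of "-3/2"], of C], of 0]) auto
  then show ?thesis unfolding eq by (rule summable_divide)
qed

lemma binomial_coeff_summable:
  fixes a :: complex
  assumes "Re a + s < -1"
  shows "summable (\<lambda>n. norm (pochhammer a n / fact n) * real (n + 1) powr (s + 1))"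
proof -
  obtain C where C: "C > 0" "\<And>n. norm (pochhammer a n) \<le> C * fact n * real (n + 1) powr (Re a - 1)"
    using pochhammer_growth[of a] by blast
  show ?thesis
  proof (rule summable_comparison_test')
    show "summable (\<lambda>n. C * real (n + 1) powr (Re a + s))"
      using assms by (intro summable_mult summable_powr_Suc) auto
    fix n :: nat
    have "norm (norm (pochhammer a n / fact n) * real (n + 1) powr (s + 1)) =
       norm (pochhammer a n) / fact n * real (n + 1) powr (s + 1)" by (simp add: norm_divide)
    also have "\<dots> \<le> C * fact n * real (n + 1) powr (Re a - 1) / fact n * real (n + 1) powr (s + 1)"
      by (intro mult_right_mono divide_right_mono C) auto
    also have "\<dots> = C * (real (n + 1) powr (Re a - 1) * real (n + 1) powr (s + 1))" by simp
    also have "\<dots> = C * real (n + 1) powr (Re a + s)" by (subst powr_add[symmetric]) simp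
    finally show "norm (norm (pochhammer a n / fact n) * real (n + 1) powr (s + 1)) \<le> C * real (n + 1) powr (Re a + s)" .
  qed
qed

lemma gen_p_minus_one_abs_summable: "summable (\<lambda>n. norm (gen_p n 0 (-1) 1))"
proof -
  define h where "h n = (if n = 0 then 1 else 0) + pochhammer (- (1 / 2) :: complex) n / fact n" for n :: nat
  have h: "(\<lambda>n. 1 / 2 * h n * z ^ n) sums (2 powr (-1) * (1 + csqrt (1 - z)) powr (- (-1)))" if z: "norm z < 1" for z :: complex
  proof -
    have "(\<lambda>n. (if n = 0 then 1 else 0) * z ^ n) sums (\<Sum>n\<in>{0::nat}. (if n = 0 then 1 else 0) * z ^ n)"
      by (rule sums_finite) auto
    then have "(\<lambda>n. (if n = 0 then 1 else 0) * z ^ n + pochhammer (- (1 / 2)) n / fact n * z ^ n)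
        sums (1 + (1 - z) powr (- (- (1 / 2))))"
      by (intro sums_add binomial_series z) simp
    then have "(\<lambda>n. 1 / 2 * (h n * z ^ n)) sums (1 / 2 * (1 + csqrt (1 - z)))"
      unfolding csqrt_conv_powr by (intro sums_mult) (simp add: h_def distrib_right)
    moreover have "(2::complex) powr (-1) = 1 / 2" by (simp add: powr_minus)
    moreover have "(1 + csqrt (1 - z)) powr (- (-1)) = 1 + csqrt (1 - z)"
      using one_plus_csqrt_nonzero[OF z] by simp
    ultimately show ?thesis by (simp only: mult.assoc)
  qed
  have "(\<lambda>n. gen_p n 0 (-1) 1) = (\<lambda>n. 1 / 2 * h n)"
    by (rule power_series_unique; rule eventually_norm_lessI) (use h gen_p_zero_sums in auto)
  then have eq: "gen_p n 0 (-1) 1 = 1 / 2 * h n" for n by meson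
  have "summable (\<lambda>n. norm (pochhammer (- (1 / 2) :: complex) n / fact n) * real (n + 1) powr (- 1 + 1))"
    by (rule binomial_coeff_summable) simp
  then have b: "summable (\<lambda>n. norm (pochhammer (- (1 / 2) :: complex) n / fact n))" by simp
  have "summable (\<lambda>n. norm (h n))"
  proof (rule summable_comparison_test')
    show "summable (\<lambda>n. (if n = 0 then 1 else 0) + norm (pochhammer (- (1 / 2) :: complex) n / fact n))"
      by (intro summable_add b) simp
    show "norm (norm (h n)) \<le> (if n = 0 then 1 else 0) + norm (pochhammer (- (1 / 2) :: complex) n / fact n)" for n
      unfolding h_def by (auto intro: order_trans[OF norm_triangle_ineq])
  qed
  then show ?thesis unfolding eq norm_mult by (intro summable_mult)
qed

text \<open>
  The generating function for \<open>\<tau>\<close> is the one for \<open>\<tau> + 1\<close> times the one for \<open>-1\<close>, and absolutely summable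
  sequences are closed under convolution; so the claim descends from the right half-plane.
\<close>

lemma gen_p_zero_abs_summable: "summable (\<lambda>n. norm (gen_p n 0 \<tau> 1))"
proof -
  have "summable (\<lambda>n. norm (gen_p n 0 \<tau> 1))" if "Re \<tau> + real m > 0" for m \<tau>
    using that
  proof (induction m arbitrary: \<tau>)
    case 0
    then show ?case by (simp add: gen_p_zero_abs_summable_pos)
  next
    case (Suc m)
    have "Re (\<tau> + 1) + real m > 0" using Suc.prems by simp
    note IH = Suc.IH[OF this]
    have "gen_p n 0 \<tau> 1 = (\<Sum>i\<le>n. gen_p i 0 (\<tau> + 1) 1 * gen_p (n - i) 0 (-1) 1)" for n
    proof (rule power_series_product; rule eventually_norm_lessI)
      fix z :: complex assume z: "norm z < 1"
      show "(\<lambda>n. gen_p n 0 (\<tau> + 1) 1 * z ^ n) sums (2 powr (\<tau> + 1) * (1 + csqrt (1 - z)) powr (- (\<tau> + 1)))"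
        and "(\<lambda>n. gen_p n 0 (-1) 1 * z ^ n) sums (2 powr (-1) * (1 + csqrt (1 - z)) powr (- (-1)))"
        by (intro gen_p_zero_sums z)+
      have "2 powr \<tau> * (1 + csqrt (1 - z)) powr (- \<tau>) = (2 powr (\<tau> + 1) * (1 + csqrt (1 - z)) powr (- (\<tau> + 1))) *
         (2 powr (-1) * (1 + csqrt (1 - z)) powr (- (-1)))"
      proof -
        have "2 powr \<tau> = (2 powr (\<tau> + 1) * 2 powr (-1) :: complex)" by (simp flip: powr_add)
        moreover have "(1 + csqrt (1 - z)) powr (- \<tau>) = (1 + csqrt (1 - z)) powr (- (\<tau> + 1)) * (1 + csqrt (1 - z)) powr (- (-1))"
          by (subst powr_add[symmetric]) simp
        ultimately show ?thesis by (simp only: mult_ac)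
      qed
      with gen_p_zero_sums[OF z, of \<tau>]
      show "(\<lambda>n. gen_p n 0 \<tau> 1 * z ^ n) sums ((2 powr (\<tau> + 1) * (1 + csqrt (1 - z)) powr (- (\<tau> + 1))) *
         (2 powr (-1) * (1 + csqrt (1 - z)) powr (- (-1))))" by simp
    qed
    then show ?case
      using summable_norm_Cauchy_product[OF IH gen_p_minus_one_abs_summable] by simp
  qed
  moreover obtain m :: nat where "- Re \<tau> < real m" using reals_Archimedean2 by blast
  then have "Re \<tau> + real m > 0" by simp
  ultimately show ?thesis by blast
qed

lemma gen_p_convolution:
  "gen_p n \<rho> \<tau> 1 = (\<Sum>i\<le>n. pochhammer \<rho> i / fact i * gen_p (n - i) 0 \<tau> 1)"
proof (rule power_series_product; rule eventually_norm_lessI)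
  fix z :: complex assume z: "norm z < 1"
  show "(\<lambda>n. pochhammer \<rho> n / fact n * z ^ n) sums ((1 - z) powr (- \<rho>))"
    by (rule binomial_series[OF z])
  show "(\<lambda>n. gen_p n 0 \<tau> 1 * z ^ n) sums (2 powr \<tau> * (1 + csqrt (1 - z)) powr (- \<tau>))"
    by (rule gen_p_zero_sums[OF z])
  show "(\<lambda>n. gen_p n \<rho> \<tau> 1 * z ^ n) sums ((1 - z) powr (- \<rho>) * (2 powr \<tau> * (1 + csqrt (1 - z)) powr (- \<tau>)))"
    using gen_p_sums[OF z, of \<rho> \<tau>] by (simp only: mult_ac)
qed

text \<open>
  The polynomials are the convolution of the coefficients of \<open>(1 - z)\<^bsup>\<nu>/2\<^esup>\<close>, of order
  \<open>n\<^bsup>-Re \<nu>/2 - 1\<^esup>\<close>, with an absolutely summable sequence.  The weight decreases and may be moved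
  into the first factor, which then has order \<open>n\<^bsup>-(3/2) Re \<nu> - 2\<^esup>\<close>.  The exponent is less than \<open>-1\<close> precisely if
  \<open>Re \<nu> > -2/3\<close>.
\<close>

lemma gen_p_weighted_summable:
  assumes "Re \<nu> > - 2 / 3"
  shows "summable (\<lambda>n. norm (gen_p n (- \<nu> / 2) \<tau> 1) * real (n + 1) powr (- Re \<nu> - 1))"
proof (rule summable_comparison_test')
  define b where "b n = norm (pochhammer (- \<nu> / 2) n / fact n)" for n
  define q where "q n = norm (gen_p n 0 \<tau> 1)" for n
  define s where "s = - Re \<nu> - 1"
  have "summable (\<lambda>n. b n * real (n + 1) powr (s - 1 + 1))"
    unfolding b_def by (rule binomial_coeff_summable) (use assms in \<open>simp add: s_def\<close>)
  then have "summable (\<lambda>n. \<Sum>i\<le>n. (b i * real (i + 1) powr s) * q (n - i))"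
    using gen_p_zero_abs_summable[of \<tau>] by (intro summable_Cauchy_product) (auto simp: b_def q_def)
  then show "summable (\<lambda>n. \<Sum>i\<le>n. (b i * real (i + 1) powr s) * q (n - i))" .
  fix n :: nat
  have "norm (norm (gen_p n (- \<nu> / 2) \<tau> 1) * real (n + 1) powr (- Re \<nu> - 1)) = norm (gen_p n (- \<nu> / 2) \<tau> 1) * real (n + 1) powr s"
    by (simp add: s_def)
  also have "\<dots> \<le> (\<Sum>i\<le>n. b i * q (n - i)) * real (n + 1) powr s"
    unfolding gen_p_convolution[of n] b_def q_def norm_mult[symmetric]
    by (intro mult_right_mono norm_sum) auto
  also have "\<dots> = (\<Sum>i\<le>n. b i * q (n - i) * real (n + 1) powr s)"
    by (rule sum_distrib_right)
  also have "\<dots> \<le> (\<Sum>i\<le>n. b i * q (n - i) * real (i + 1) powr s)"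
    by (intro sum_mono mult_left_mono powr_mono2') (use assms in \<open>auto simp: s_def b_def q_def\<close>)
  finally show "norm (norm (gen_p n (- \<nu> / 2) \<tau> 1) * real (n + 1) powr (- Re \<nu> - 1)) \<le> (\<Sum>i\<le>n. (b i * real (i + 1) powr s) * q (n - i))"
    by (simp add: mult_ac)
qed

text \<open>
  If only the third parameter grows with \<open>n\<close>, the Gauss series behaves like its leading coefficient:
  in the bound for the \<open>k\<close>-th term, \<open>n! k! / (n + k)! \<le> 1\<close> absorbs the factorials.
\<close>

lemma hypergeo_reg_series_decay:
  fixes a b c d :: complex
  shows "\<exists>C>0. \<forall>n s. norm s \<le> 1 / 2 \<longrightarrow>
    norm (pochhammer b n * hypergeo_reg_series a d (c + of_nat n) s) \<le> C * real (n + 1) powr (Re b - Re c)"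
proof -
  obtain B where B: "B > 0" "\<And>n. norm (pochhammer b n) \<le> B * fact n * real (n + 1) powr (Re b - 1)"
    using pochhammer_growth by blast
  obtain A where A: "A > 0" "\<And>n. norm (pochhammer a n) \<le> A * fact n * real (n + 1) powr (Re a - 1)"
    using pochhammer_growth by blast
  obtain D where D: "D > 0" "\<And>n. norm (pochhammer d n) \<le> D * fact n * real (n + 1) powr (Re d - 1)"
    using pochhammer_growth by blast
  obtain G where G: "G > 0" "\<And>n. norm (rGamma (c + of_nat n)) \<le> G * real (n + 1) powr (1 - Re c) / fact n"
    using rGamma_growth by blast
  define K where "K = (Re a - 1) + (Re d - 1) + \<bar>1 - Re c\<bar>"
  define X where "X = B * A * D * G"
  have X: "X > 0" using A B D G by (simp add: X_def)
  define L where "L = (\<Sum>k. real (k + 1) powr K * (1 / 2) ^ k)"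
  have Lsum: "summable (\<lambda>k. real (k + 1) powr K * (1 / 2) ^ k)"
    by (rule summable_powr_geometric) auto
  have L: "L \<ge> 0" unfolding L_def by (intro suminf_nonneg Lsum) auto
  have "norm (pochhammer b n * hypergeo_reg_series a d (c + of_nat n) s) \<le> (X * L + 1) * real (n + 1) powr (Re b - Re c)"
    if s: "norm s \<le> 1 / 2" for n s
  proof -
    have s1: "norm s < 1" using s by simp
    define t where "t k = pochhammer b n * (hyp_coeff a d (c + of_nat n) k * s ^ k)" for k
    have t_le: "norm (t k) \<le> X * real (n + 1) powr (Re b - Re c) * (real (k + 1) powr K * (1 / 2) ^ k)" for k
    proof -
      have g: "norm (rGamma (c + of_nat n + of_nat k)) \<le> G * (real (n + 1) powr (1 - Re c) * real (k + 1) powr \<bar>1 - Re c\<bar>) / fact (n + k)"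
      proof -
        have "norm (rGamma (c + of_nat n + of_nat k)) \<le> G * real (n + k + 1) powr (1 - Re c) / fact (n + k)"
          using G(2)[of "n + k"] by (simp add: add.assoc)
        also have "\<dots> \<le> G * (real (n + 1) powr (1 - Re c) * real (k + 1) powr \<bar>1 - Re c\<bar>) / fact (n + k)"
          using G(1) by (intro divide_right_mono mult_left_mono powr_sum_le) auto
        finally show ?thesis .
      qed
      have "fact n * fact k dvd (fact (n + k) :: nat)" by (rule fact_fact_dvd_fact)
      then have "fact n * fact k \<le> (fact (n + k) :: nat)" by (rule dvd_imp_le) simp
      then have "real (fact n * fact k) \<le> real (fact (n + k))" by (rule of_nat_mono)
      then have "fact n * fact k \<le> (fact (n + k) :: real)" by simp
      then have f: "fact n * fact k / fact (n + k) \<le> (1 :: real)" by simp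
      have "norm (t k) = norm (pochhammer b n) * (norm (pochhammer a k) * norm (pochhammer d k) * norm (rGamma (c + of_nat n + of_nat k)) / fact k * norm s ^ k)"
        by (simp add: t_def hyp_coeff_def norm_mult norm_divide norm_power)
      also have "\<dots> \<le> (B * fact n * real (n + 1) powr (Re b - 1)) *
         ((A * fact k * real (k + 1) powr (Re a - 1)) * (D * fact k * real (k + 1) powr (Re d - 1)) *
          (G * (real (n + 1) powr (1 - Re c) * real (k + 1) powr \<bar>1 - Re c\<bar>) / fact (n + k)) / fact k * (1 / 2) ^ k)"
        using A(1) B(1) D(1) G(1) s
        by (intro mult_mono A B D g divide_right_mono power_mono) auto
      also have "\<dots> = (fact n * fact k / fact (n + k)) * (X * (real (n + 1) powr (Re b - 1) * real (n + 1) powr (1 - Re c)) *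
          ((real (k + 1) powr (Re a - 1) * real (k + 1) powr (Re d - 1) * real (k + 1) powr \<bar>1 - Re c\<bar>) * (1 / 2) ^ k))"
        by (simp only: X_def times_divide_eq_right times_divide_eq_left) (simp add: divide_simps)
      also have "\<dots> = (fact n * fact k / fact (n + k)) * (X * real (n + 1) powr (Re b - Re c) * (real (k + 1) powr K * (1 / 2) ^ k))"
        by (simp add: K_def flip: powr_add)
      also have "\<dots> \<le> 1 * (X * real (n + 1) powr (Re b - Re c) * (real (k + 1) powr K * (1 / 2) ^ k))"
        using X by (intro mult_right_mono f) auto
      finally show ?thesis by simp
    qed
    have maj: "summable (\<lambda>k. X * real (n + 1) powr (Re b - Re c) * (real (k + 1) powr K * (1 / 2) ^ k))"
      by (intro summable_mult Lsum)
    have t_sum: "summable (\<lambda>k. norm (t k))"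
      by (rule summable_comparison_test'[OF maj, of 0]) (use t_le in auto)
    have "pochhammer b n * hypergeo_reg_series a d (c + of_nat n) s = (\<Sum>k. t k)"
      unfolding t_def using sums_mult[OF hypergeo_reg_series_sums[OF s1]] by (simp add: sums_iff)
    also have "norm \<dots> \<le> (\<Sum>k. norm (t k))" by (rule summable_norm[OF t_sum])
    also have "\<dots> \<le> (\<Sum>k. X * real (n + 1) powr (Re b - Re c) * (real (k + 1) powr K * (1 / 2) ^ k))"
      by (intro suminf_le t_le t_sum maj)
    also have "\<dots> = X * real (n + 1) powr (Re b - Re c) * L"
      unfolding L_def by (rule suminf_mult[OF Lsum])
    also have "\<dots> \<le> (X * L + 1) * real (n + 1) powr (Re b - Re c)" by (simp add: algebra_simps)
    finally show ?thesis .
  qed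
  moreover have "X * L + 1 > 0" using X L by (simp add: add_nonneg_pos)
  ultimately show ?thesis by blast
qed

lemma powr_le_two_powr:
  fixes y t :: real
  assumes "1 / 2 \<le> y" "y \<le> 2"
  shows "y powr t \<le> 2 powr \<bar>t\<bar>"
proof (cases "t \<ge> 0")
  case True
  then show ?thesis using assms by (simp add: powr_mono2)
next
  case False
  then have "y powr t \<le> (1 / 2) powr t" using assms by (intro powr_mono2') auto
  also have "\<dots> = 2 powr (- t)" by (subst powr_divide) (simp_all add: powr_minus_divide)
  finally show ?thesis using False by simp
qed

text \<open>
  The point \<open>u = 2 \<surd>2 - 3\<close> corresponds to \<open>z = -1\<close>.  The expansion is known for \<open>z\<close> slightly above \<open>-1\<close>, and
  Tannery's theorem carries it to the limit.  For the majorant, Pfaff's transformation moves \<open>z\<close> from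
  \<open>(-1, 0)\<close> to \<open>z / (z - 1)\<close> in \<open>(0, 1/2)\<close> and leaves a Gauss series in which only the third parameter
  depends on \<open>n\<close>.
\<close>

lemma gen_p_expansion_boundary:
  assumes \<nu>: "Re \<nu> > - 2 / 3"
  defines "u0 \<equiv> of_real (2 * sqrt 2 - 3) :: complex"
  shows "(\<lambda>n. pochhammer (\<mu> - \<nu>) n * gen_p n (- \<nu> / 2) (2 * \<mu>) 1 * (4 * u0) ^ n *
       hypergeo_reg_series (2 * \<mu> - \<nu> + of_nat (2 * n)) (\<mu> - \<nu> + of_nat n) (1 + \<mu> + of_nat n) (- u0))
     sums hypergeo_reg_series (- \<nu>) (\<mu> - \<nu>) (1 + \<mu>) u0"
proof -
  define p where "p n = gen_p n (- \<nu> / 2) (2 * \<mu>) 1" for n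
  define T where "T n u = pochhammer (\<mu> - \<nu>) n * p n * (4 * of_real u) ^ n *
       hypergeo_reg_series (2 * \<mu> - \<nu> + of_nat (2 * n)) (\<mu> - \<nu> + of_nat n) (1 + \<mu> + of_nat n) (- of_real u)" for n and u :: real
  define R where "R u = hypergeo_reg_series (- \<nu>) (\<mu> - \<nu>) (1 + \<mu>) (of_real u)" for u :: real
  define v where "v = 2 * sqrt 2 - 3"
  have sqrt2: "1.41 < sqrt 2" "sqrt 2 < 1.42"
    by (rule real_less_rsqrt, simp add: power2_eq_square) (rule real_less_lsqrt, simp_all add: power2_eq_square)
  then have v: "-0.2 < v" "v < -0.1" by (simp_all add: v_def)
  define \<alpha> where "\<alpha> = (1 + \<nu>) / 2"
  obtain C where C: "C > 0" "\<And>n s. norm s \<le> 1 / 2 \<Longrightarrow>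
     norm (pochhammer (\<mu> - \<nu>) n * hypergeo_reg_series (1 + \<nu> / 2) \<alpha> (1 + \<mu> + of_nat n) s) \<le> C * real (n + 1) powr (Re (\<mu> - \<nu>) - Re (1 + \<mu>))"
    using hypergeo_reg_series_decay[of "\<mu> - \<nu>" "1 + \<nu> / 2" \<alpha> "1 + \<mu>"] by metis
  define Q where "Q = 2 powr \<bar>Re (\<nu> - 2 * \<mu>)\<bar> * 2 powr \<bar>Re (- \<alpha>)\<bar> * C"
  define M where "M n = Q * (norm (p n) * real (n + 1) powr (- Re \<nu> - 1))" for n
  have M: "summable M"
    unfolding M_def p_def by (intro summable_mult gen_p_weighted_summable \<nu>)
  have z: "norm (4 * of_real u / (1 + of_real u)\<^sup>2 :: complex) < 1 \<and> 4 * u / (1 + u)\<^sup>2 < 0 \<and> -1 < 4 * u / (1 + u)\<^sup>2"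
    if u: "v < u" "u < 0" for u
  proof -
    have "sqrt 8 = 2 * sqrt 2"
      using real_sqrt_mult[of 4 2] by simp
    then have "sqrt 8 < u + 3" using u by (simp add: v_def)
    then have "(sqrt 8)\<^sup>2 < (u + 3)\<^sup>2" by (intro power_strict_mono) auto
    then have "8 < (u + 3)\<^sup>2" by simp
    then have pos: "- (4 * u) < (1 + u)\<^sup>2" by (simp add: power2_eq_square algebra_simps)
    have "1 + u > 0" using u v by simp
    then have sq: "(1 + u)\<^sup>2 > 0" by simp
    have 1: "-1 < 4 * u / (1 + u)\<^sup>2" using pos sq by (simp add: field_simps)
    have 2: "4 * u / (1 + u)\<^sup>2 < 0" using u sq by (simp add: divide_neg_pos)
    have "(4 * of_real u / (1 + of_real u)\<^sup>2 :: complex) = of_real (4 * u / (1 + u)\<^sup>2)" by simp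
    then have "norm (4 * of_real u / (1 + of_real u)\<^sup>2 :: complex) = \<bar>4 * u / (1 + u)\<^sup>2\<bar>"
      by (metis norm_of_real)
    with 1 2 show ?thesis by linarith
  qed
  have sums: "(\<lambda>n. T n u) sums R u" if u: "v < u" "u < 0" for u
  proof -
    have "norm (of_real u :: complex) < 1" using u v by simp
    then have "quad_root (4 * of_real u / (1 + of_real u)\<^sup>2) = of_real u" by (rule quad_root_inverse)
    with gen_p_expansion[of "4 * of_real u / (1 + of_real u)\<^sup>2" \<mu> \<nu>] z[OF u]
    show ?thesis by (simp add: T_def R_def p_def)
  qed
  have bound: "norm (T n u) \<le> M n" if u: "v < u" "u < 0" for n u
  proof -
    define y where "y = 4 * u / (1 + u)\<^sup>2"
    have y: "-1 < y" "y < 0" using z[OF u] by (auto simp: y_def)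
    have yz: "norm (of_real y :: complex) < 1" using y by simp
    have "norm (of_real u :: complex) < 1" using u v by simp
    then have qr: "quad_root (of_real y) = of_real u"
      using quad_root_inverse[of "of_real u"] by (simp add: y_def)
    have arg: "norm (of_real y / (of_real y - 1) :: complex) \<le> 1 / 2"
    proof -
      have "of_real y / (of_real y - 1) = (of_real (y / (y - 1)) :: complex)" by simp
      then have "norm (of_real y / (of_real y - 1) :: complex) = \<bar>y / (y - 1)\<bar>" by (metis norm_of_real)
      also have "\<dots> \<le> 1 / 2" using y by (simp add: abs_if divide_simps)
      finally show ?thesis .
    qed
    have pf: "hypergeo_reg_series (\<mu> - \<nu> / 2 + of_nat n) \<alpha> (1 + \<mu> + of_nat n) (of_real y) =
       (1 - of_real y) powr (- \<alpha>) * hypergeo_reg_series (1 + \<nu> / 2) \<alpha> (1 + \<mu> + of_nat n) (of_real y / (of_real y - 1))"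
      using hypergeo_reg_series_pfaff[OF yz, of "\<mu> - \<nu> / 2 + of_nat n" \<alpha> "1 + \<mu> + of_nat n"] y by (simp add: algebra_simps)
    have "T n u = (1 + of_real u) powr (\<nu> - 2 * \<mu>) * (pochhammer (\<mu> - \<nu>) n * p n * (of_real y) ^ n *
       hypergeo_reg_series (\<mu> - \<nu> / 2 + of_nat n) \<alpha> (1 + \<mu> + of_nat n) (of_real y))"
      using gen_p_term[OF yz, of \<mu> \<nu> n "p n"] unfolding qr T_def \<alpha>_def .
    also have "norm \<dots> = norm ((1 + of_real u) powr (\<nu> - 2 * \<mu>) :: complex) * norm ((1 - of_real y) powr (- \<alpha>) :: complex) * (norm (p n) * \<bar>y\<bar> ^ n *
         norm (pochhammer (\<mu> - \<nu>) n * hypergeo_reg_series (1 + \<nu> / 2) \<alpha> (1 + \<mu> + of_nat n) (of_real y / (of_real y - 1))))"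
      unfolding pf norm_mult norm_power norm_of_real by (simp only: mult_ac)
    also have "\<dots> \<le> (2 powr \<bar>Re (\<nu> - 2 * \<mu>)\<bar> * 2 powr \<bar>Re (- \<alpha>)\<bar>) * (norm (p n) * 1 * (C * real (n + 1) powr (Re (\<mu> - \<nu>) - Re (1 + \<mu>))))"
    proof (intro mult_mono C arg)
      have "norm (of_real (1 + u) powr (\<nu> - 2 * \<mu>) :: complex) = (1 + u) powr Re (\<nu> - 2 * \<mu>)"
        using u v by (subst norm_powr_real_powr) auto
      also have "\<dots> \<le> 2 powr \<bar>Re (\<nu> - 2 * \<mu>)\<bar>" using u v by (intro powr_le_two_powr) auto
      finally show "norm ((1 + of_real u) powr (\<nu> - 2 * \<mu>) :: complex) \<le> 2 powr \<bar>Re (\<nu> - 2 * \<mu>)\<bar>" by simp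
      have "norm (of_real (1 - y) powr (- \<alpha>) :: complex) = (1 - y) powr Re (- \<alpha>)"
        using y by (subst norm_powr_real_powr) auto
      also have "\<dots> \<le> 2 powr \<bar>Re (- \<alpha>)\<bar>" using y by (intro powr_le_two_powr) auto
      finally show "norm ((1 - of_real y) powr (- \<alpha>) :: complex) \<le> 2 powr \<bar>Re (- \<alpha>)\<bar>" by simp
      show "\<bar>y\<bar> ^ n \<le> 1" using y by (intro power_le_one) auto
    qed (use C(1) in auto)
    also have "\<dots> = M n" by (simp add: M_def Q_def mult_ac)
    finally show ?thesis .
  qed
  have ev: "\<forall>\<^sub>F u in at_right v. v < u \<and> u < 0"
    using v eventually_at_right_field[of "\<lambda>u. v < u \<and> u < 0" v] by (auto intro!: exI[of _ 0])
  have cont: "((\<lambda>u. hypergeo_reg_series a b c (of_real (f u))) \<longlongrightarrow> hypergeo_reg_series a b c (of_real w)) F"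
    if "\<bar>w\<bar> < 1" "(f \<longlongrightarrow> w) F" for a b c w and f :: "real \<Rightarrow> real" and F
  proof -
    have "continuous_on (ball 0 1) (hypergeo_reg_series a b c)"
      by (rule holomorphic_on_imp_continuous_on[OF hypergeo_reg_series_holomorphic])
    then have "isCont (hypergeo_reg_series a b c) (of_real w)"
      by (rule continuous_on_interior) (use that in auto)
    then show ?thesis by (rule isCont_tendsto_compose) (intro tendsto_intros that)
  qed
  have T_lim: "((\<lambda>u. T n u) \<longlongrightarrow> T n v) (at_right v)" for n
  proof -
    have "((\<lambda>u. hypergeo_reg_series (2 * \<mu> - \<nu> + of_nat (2 * n)) (\<mu> - \<nu> + of_nat n) (1 + \<mu> + of_nat n) (of_real (- u)))
       \<longlongrightarrow> hypergeo_reg_series (2 * \<mu> - \<nu> + of_nat (2 * n)) (\<mu> - \<nu> + of_nat n) (1 + \<mu> + of_nat n) (of_real (- v))) (at_right v)"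
      using v by (intro cont tendsto_intros) auto
    then show ?thesis unfolding T_def of_real_minus by (intro tendsto_intros)
  qed
  have "\<forall>\<^sub>F u in at_right v. \<forall>n. norm (T n u) \<le> M n"
    using ev by eventually_elim (use bound in auto)
  then have "\<forall>\<^sub>F (n, u) in at_top \<times>\<^sub>F at_right v. norm (T n u) \<le> M n"
    using eventually_prodI[of "\<lambda>_. True" at_top "\<lambda>u. \<forall>n. norm (T n u) \<le> M n" "at_right v"]
    by (auto elim!: eventually_mono)
  from tannerys_theorem[OF T_lim this M]
  have summ: "summable (\<lambda>n. norm (T n v))" and lim: "((\<lambda>u. \<Sum>n. T n u) \<longlongrightarrow> (\<Sum>n. T n v)) (at_right v)"
    by auto
  have "((\<lambda>u. R u) \<longlongrightarrow> (\<Sum>n. T n v)) (at_right v)"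
    by (rule Lim_transform_eventually[OF lim]) (use ev in eventually_elim, use sums in \<open>auto simp: sums_iff\<close>)
  moreover have "((\<lambda>u. R u) \<longlongrightarrow> R v) (at_right v)"
    unfolding R_def using v by (intro cont tendsto_intros) auto
  ultimately have "(\<Sum>n. T n v) = R v"
    by (intro tendsto_unique[OF trivial_limit_at_right_real])
  then have "(\<lambda>n. T n v) sums R v"
    using summable_sums[OF summable_norm_cancel[OF summ]] by simp
  then show ?thesis by (simp add: T_def R_def p_def u0_def v_def)
qed

section \<open>Legendre functions on the unit interval\<close>

lemma of_real_powr_exp:
  fixes y :: real and s :: complex
  shows "y > 0 \<Longrightarrow> of_real y powr s = exp (s * of_real (ln y))"
  by (simp add: powr_def Ln_of_real)

lemma hypergeo_reg_commute: "hypergeo_reg a b c z = hypergeo_reg b a c z"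
  unfolding hypergeo_reg_def hypergeo_reg_series_commute[of a b] ..

lemma hypergeo_reg_real:
  fixes y :: real
  assumes "y < 1 / 2"
  shows "hypergeo_reg (- \<nu>) (\<nu> + 1) (1 + m) (of_real y) =
     exp (\<nu> * of_real (ln (1 - y))) * hypergeo_reg_series (- \<nu>) (m - \<nu>) (1 + m) (of_real (y / (y - 1)))"
proof -
  have "hypergeo_reg (- \<nu>) (\<nu> + 1) (1 + m) (of_real y) =
     (1 - of_real y) powr (- (- \<nu>)) * hypergeo_reg_series (1 + m - (\<nu> + 1)) (- \<nu>) (1 + m) (of_real y / (of_real y - 1))"
    using assms by (subst hypergeo_reg_commute) (intro hypergeo_reg_pfaff, simp)
  also have "(1 - of_real y) powr (- (- \<nu>)) = exp (\<nu> * of_real (ln (1 - y)))"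
    using of_real_powr_exp[of "1 - y" \<nu>] assms by simp
  also have "hypergeo_reg_series (1 + m - (\<nu> + 1)) (- \<nu>) (1 + m) (of_real y / (of_real y - 1)) =
      hypergeo_reg_series (- \<nu>) (m - \<nu>) (1 + m) (of_real (y / (y - 1)))"
    by (subst hypergeo_reg_series_commute) (simp add: algebra_simps)
  finally show ?thesis .
qed

text \<open>
  Pfaff's transformation with \<open>z = (1 - x) / 2\<close>.  All powers are written as exponentials of logarithms of
  positive numbers, so that later they can be collected by linear arithmetic in the exponents.
\<close>

lemma legendre_P_less_1:
  fixes x :: real
  assumes x: "0 < x" "x < 1"
  shows "legendre_P \<nu> (- m) x =
     exp (m / 2 * (of_real (ln (1 - x)) - of_real (ln (1 + x))) + \<nu> * (of_real (ln (1 + x)) - of_real (ln 2))) *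
     hypergeo_reg_series (- \<nu>) (m - \<nu>) (1 + m) (- of_real ((1 - x) / (1 + x)))"
proof -
  have "\<bar>(1 - x) / (1 + x)\<bar> = (1 - x) / (1 + x)" using x by simp
  moreover have "of_real ((1 - x) / (1 + x)) powr (m / 2) = exp (m / 2 * (of_real (ln (1 - x)) - of_real (ln (1 + x))))"
    using x by (subst of_real_powr_exp) (simp_all add: ln_div)
  moreover have "ln (1 - (1 - x) / 2) = ln (1 + x) - ln 2"
  proof -
    have "1 - (1 - x) / 2 = (1 + x) / 2" by (simp add: field_simps)
    moreover have "ln ((1 + x) / 2) = ln (1 + x) - ln 2" using x by (simp add: ln_div)
    ultimately show ?thesis by (simp only:)
  qed
  moreover have "(1 - x) / 2 / ((1 - x) / 2 - 1) = - ((1 - x) / (1 + x))"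
    using x by (simp add: field_simps)
  ultimately show ?thesis
    using hypergeo_reg_real[of "(1 - x) / 2" \<nu> m] x unfolding legendre_P_def
    by (simp only: minus_minus diff_minus_eq_add of_real_diff of_real_minus exp_add mult.assoc) simp
qed

text \<open>
  The same at \<open>1/x\<close>, where \<open>z\<close> is negative; apart from a power of \<open>x\<close>, only the sign of
  the final argument changes, which is why
  both pairs of expansions have the same shape.
\<close>

lemma legendre_P_greater_1:
  fixes x :: real
  assumes x: "0 < x" "x < 1"
  shows "legendre_P \<nu> (- m) (1 / x) =
     exp (m / 2 * (of_real (ln (1 - x)) - of_real (ln (1 + x))) + \<nu> * (of_real (ln (1 + x)) - of_real (ln 2) - of_real (ln x))) *
     hypergeo_reg_series (- \<nu>) (m - \<nu>) (1 + m) (of_real ((1 - x) / (1 + x)))"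
proof -
  have "1 - 1 / x = (x - 1) / x" "1 + 1 / x = (1 + x) / x"
    using x by (simp_all add: diff_divide_distrib add_divide_distrib)
  then have "(1 - 1 / x) / (1 + 1 / x) = (x - 1) / (1 + x)" using x by simp
  also have "\<dots> = - ((1 - x) / (1 + x))" by (simp only: minus_divide_left minus_diff_eq)
  finally have "(1 - 1 / x) / (1 + 1 / x) = - ((1 - x) / (1 + x))" .
  then have "\<bar>(1 - 1 / x) / (1 + 1 / x)\<bar> = (1 - x) / (1 + x)" using x by simp
  moreover have "of_real ((1 - x) / (1 + x)) powr (m / 2) = exp (m / 2 * (of_real (ln (1 - x)) - of_real (ln (1 + x))))"
    using x by (subst of_real_powr_exp) (simp_all add: ln_div)
  moreover have "ln (1 - (1 - 1 / x) / 2) = ln (1 + x) - ln 2 - ln x"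
  proof -
    have "1 - (1 - 1 / x) / 2 = (1 + x) / 2 / x" using x by (simp add: field_simps)
    moreover have "ln ((1 + x) / 2 / x) = ln (1 + x) - ln 2 - ln x" using x by (simp add: ln_div ln_mult)
    ultimately show ?thesis by (simp only:)
  qed
  moreover have "(1 - 1 / x) / 2 / ((1 - 1 / x) / 2 - 1) = (1 - x) / (1 + x)"
  proof -
    have "(1 - 1 / x) / 2 - 1 = - ((1 + x) / (2 * x))" and "(1 - 1 / x) / 2 = - ((1 - x) / (2 * x))"
      using x by (simp_all add: field_simps)
    then show ?thesis using x by (simp only: minus_divide_divide) simp
  qed
  moreover have "(1 - 1 / x) / 2 < 1 / 2" using x by simp
  ultimately show ?thesis
    using hypergeo_reg_real[of "(1 - 1 / x) / 2" \<nu> m] x unfolding legendre_P_def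
    by (simp only: minus_minus diff_minus_eq_add of_real_diff of_real_minus exp_add mult.assoc)
qed

lemma four_times_power_exp:
  fixes x :: real
  assumes x: "0 < x" "x < 1"
  shows "(4 * of_real ((1 - x) / (1 + x))) ^ n =
     exp (of_nat n * (2 * of_real (ln 2) + of_real (ln (1 - x)) - of_real (ln (1 + x))) :: complex)"
proof -
  have "exp (2 * ln 2 + ln (1 - x) - ln (1 + x)) = 4 * ((1 - x) / (1 + x))"
  proof -
    have "exp (2 * ln 2) = (4 :: real)" by (simp add: exp_double)
    moreover have "exp (ln (1 - x)) = 1 - x" "exp (ln (1 + x)) = 1 + x" using x by simp_all
    ultimately show ?thesis by (simp only: exp_add exp_diff times_divide_eq_right)
  qed
  then have "4 * of_real ((1 - x) / (1 + x)) = (of_real (exp (2 * ln 2 + ln (1 - x) - ln (1 + x))) :: complex)"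
    by simp
  then show ?thesis by (simp only: exp_of_nat_mult exp_of_real[symmetric] of_real_add of_real_diff of_real_mult of_real_numeral)
qed

lemma power_ratio_exp:
  fixes x :: real
  assumes x: "0 < x" "x < 1"
  shows "of_real ((1 - x) / (1 + x)) ^ n = exp (of_nat n * (of_real (ln (1 - x)) - of_real (ln (1 + x))) :: complex)"
proof -
  have "exp (ln (1 - x) - ln (1 + x)) = (1 - x) / (1 + x)"
    using x by (simp add: exp_diff)
  then have "of_real ((1 - x) / (1 + x)) = (of_real (exp (ln (1 - x) - ln (1 + x))) :: complex)"
    by simp
  then show ?thesis by (simp only: exp_of_nat_mult exp_of_real[symmetric] of_real_diff)
qed

lemma powr_exps:
  fixes x :: real and s :: complex
  assumes x: "0 < x" "x < 1"
  shows "of_real x powr s = exp (s * of_real (ln x))"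
    "of_real (1 + x) powr s = exp (s * of_real (ln (1 + x)))"
    "of_real (1 - x) powr s = exp (s * of_real (ln (1 - x)))"
    "of_real (1 - x\<^sup>2) powr s = exp (s * (of_real (ln (1 - x)) + of_real (ln (1 + x))))"
    "2 powr s = exp (s * of_real (ln 2))"
proof -
  show "of_real x powr s = exp (s * of_real (ln x))"
    "of_real (1 + x) powr s = exp (s * of_real (ln (1 + x)))"
    "of_real (1 - x) powr s = exp (s * of_real (ln (1 - x)))"
    using x by (intro of_real_powr_exp; simp)+
  have "1 - x\<^sup>2 = (1 - x) * (1 + x)" by (simp add: power2_eq_square algebra_simps)
  moreover have "ln ((1 - x) * (1 + x)) = ln (1 - x) + ln (1 + x)" using x by (simp add: ln_mult)
  moreover have "(1 - x) * (1 + x) > 0" using x by simp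
  ultimately show "of_real (1 - x\<^sup>2) powr s = exp (s * (of_real (ln (1 - x)) + of_real (ln (1 + x))))"
    using of_real_powr_exp[of "(1 - x) * (1 + x)" s] by simp
  show "2 powr s = exp (s * of_real (ln 2))"
    using of_real_powr_exp[of 2 s] by simp
qed

text \<open>
  The two values of \<open>z\<close> at which the expansion is used.  The second one exceeds \<open>-1\<close> if and only if
  \<open>x\<^sup>2 > 1/2\<close>.
\<close>

lemma quad_arg:
  fixes x :: real
  assumes x: "0 < x" "x < 1"
  defines "w \<equiv> (1 - x) / (1 + x)"
  shows "4 * w / (1 + w)\<^sup>2 = 1 - x\<^sup>2" "4 * (- w) / (1 + (- w))\<^sup>2 = - (1 - x\<^sup>2) / x\<^sup>2"
proof -
  have "1 + w = 2 / (1 + x)" "1 + (- w) = 2 * x / (1 + x)"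
    using x by (simp_all add: w_def field_simps)
  then show "4 * w / (1 + w)\<^sup>2 = 1 - x\<^sup>2" "4 * (- w) / (1 + (- w))\<^sup>2 = - (1 - x\<^sup>2) / x\<^sup>2"
    using x by (simp_all only:) (simp_all add: w_def divide_simps power2_eq_square, simp_all add: algebra_simps)
qed

section \<open>The series expansions of Legendre functions\<close>

theorem theorem10:
  fixes \<mu> \<nu> :: complex
  shows "(\<forall>x::real.
            (1 / sqrt 2 < x \<and> x < 1) \<or>
            (x = 1 / sqrt 2 \<and> Re \<nu> > - 2 / 3) \<or>
            (0 < x \<and> x < 1 \<and> \<nu> - \<mu> \<in> \<nat>) \<longrightarrow>
            (\<lambda>n. (-1) ^ n * pochhammer (\<mu> - \<nu>) n * gen_p n (- \<nu> / 2) (2 * \<mu>) 1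
                   / (2 powr (\<mu> - of_nat n) * of_real x powr (of_nat n + \<mu> - \<nu>)
                        * of_real (1 - x\<^sup>2) powr (- of_nat n / 2))
                   * legendre_P (\<nu> - \<mu> - of_nat n) (- \<mu> - of_nat n) (1 / x))
              sums (legendre_P \<nu> (- \<mu>) x / of_real (1 + x) powr \<mu>))
       \<and> (\<forall>x::real. 0 < x \<and> x < 1 \<longrightarrow>
            (\<lambda>n. (-1) ^ n * pochhammer (\<mu> - \<nu>) n * gen_g n \<nu> (- 2 * \<mu>)
                   * (of_real (1 - x) powr (of_nat n / 2) * legendre_P \<nu> (- \<mu> - of_nat n) x
                        / of_real (1 + x) powr (of_nat n / 2 + \<mu>)))
              sums (legendre_P (\<nu> - \<mu>) (- \<mu>) (1 / x)
                      / (2 powr \<mu> * of_real x powr (\<mu> - \<nu>))))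
       \<and> (\<forall>x::real. 0 < x \<and> x < 1 \<longrightarrow>
            (\<lambda>n. pochhammer (\<mu> - \<nu>) n * gen_p n (- \<nu> / 2) (2 * \<mu>) 1
                   / (2 powr (\<mu> - of_nat n) * of_real (1 - x\<^sup>2) powr (- of_nat n / 2))
                   * legendre_P (\<nu> - \<mu> - of_nat n) (- of_nat n - \<mu>) x)
              sums (of_real x powr \<nu> * legendre_P \<nu> (- \<mu>) (1 / x)
                      / of_real (1 + x) powr \<mu>))
       \<and> (\<forall>x::real. 0 < x \<and> x < 1 \<longrightarrow>
            (\<lambda>n. pochhammer (\<mu> - \<nu>) n * gen_g n \<nu> (- 2 * \<mu>)
                   * (of_real (1 - x) powr (of_nat n / 2)
                        * legendre_P \<nu> (- of_nat n - \<mu>) (1 / x)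
                        / of_real (1 + x) powr (of_nat n / 2 + \<mu>)))
              sums (legendre_P (\<nu> - \<mu>) (- \<mu>) x / (2 powr \<mu> * of_real x powr \<nu>)))"
proof -
  \<comment> \<open>\<open>F\<close> and \<open>R\<close> are the terms and the sum of the expansion in \<open>\<pp>\<^sub>n\<close>, \<open>H\<close> and \<open>S\<close> those of the one in \<open>g\<^sub>n\<close>.\<close>
  define F where "F n v = hypergeo_reg_series (2 * \<mu> - \<nu> + of_nat (2 * n)) (\<mu> - \<nu> + of_nat n) (1 + \<mu> + of_nat n) (of_real v)" for n and v :: real
  define H where "H n v = hypergeo_reg_series (- \<nu>) (\<mu> - \<nu> + of_nat n) (1 + \<mu> + of_nat n) (of_real v)" for n and v :: real
  define R where "R v = hypergeo_reg_series (- \<nu>) (\<mu> - \<nu>) (1 + \<mu>) (of_real v)" for v :: real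
  define S where "S v = hypergeo_reg_series (\<mu> - \<nu>) (2 * \<mu> - \<nu>) (1 + \<mu>) (of_real v)" for v :: real
  define p where "p n = gen_p n (- \<nu> / 2) (2 * \<mu>) 1" for n
  define g where "g n = gen_g n \<nu> (- 2 * \<mu>)" for n
  define b where "b n = pochhammer (\<mu> - \<nu>) n" for n
  define w where "w x = (1 - x) / (1 + x)" for x :: real
  define LM LP LX where "LM x = complex_of_real (ln (1 - x))" and "LP x = complex_of_real (ln (1 + x))"
    and "LX x = complex_of_real (ln x)" for x
  define L2 where "L2 = complex_of_real (ln 2)"
  \<comment> \<open>\<open>K\<close> is the constant by which both sides of the reduced expansions get multiplied; in the last
    expansion of the theorem it is accompanied by \<open>x\<close> to the power \<open>-\<nu>\<close>.\<close>
  define K where "K x = exp (\<mu> / 2 * (LM x - LP x) + \<nu> * (LP x - L2) - \<mu> * LP x)" for x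

  have w: "0 < w x" "w x < 1" if "0 < x" "x < 1" for x
    using that by (auto simp: w_def field_simps)
  have wn: "norm (of_real (w x) :: complex) < 1" "norm (- of_real (w x) :: complex) < 1" if "0 < x" "x < 1" for x
    using w[OF that] by auto

  have P_lt: "legendre_P \<nu>' (- m) x = exp (m / 2 * (LM x - LP x) + \<nu>' * (LP x - L2)) *
       hypergeo_reg_series (- \<nu>') (m - \<nu>') (1 + m) (of_real (- w x))" if "0 < x" "x < 1" for \<nu>' m x
    using legendre_P_less_1[OF that] by (simp add: LM_def LP_def L2_def w_def)
  have P_gt: "legendre_P \<nu>' (- m) (1 / x) = exp (m / 2 * (LM x - LP x) + \<nu>' * (LP x - L2 - LX x)) *
       hypergeo_reg_series (- \<nu>') (m - \<nu>') (1 + m) (of_real (w x))" if "0 < x" "x < 1" for \<nu>' m x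
    using legendre_P_greater_1[OF that] by (simp add: LM_def LP_def L2_def LX_def w_def)

  have F_eq: "hypergeo_reg_series (- (\<nu> - \<mu> - of_nat n)) (\<mu> + of_nat n - (\<nu> - \<mu> - of_nat n)) (1 + (\<mu> + of_nat n)) (of_real v) = F n v" for n v
    unfolding F_def by (subst hypergeo_reg_series_commute) (simp add: algebra_simps)
  have H_eq: "hypergeo_reg_series (- \<nu>) (\<mu> + of_nat n - \<nu>) (1 + (\<mu> + of_nat n)) (of_real v) = H n v" for n v
    unfolding H_def by (simp add: algebra_simps)
  have S_eq: "hypergeo_reg_series (- (\<nu> - \<mu>)) (\<mu> - (\<nu> - \<mu>)) (1 + \<mu>) (of_real v) = S v" for v
    unfolding S_def by (simp add: algebra_simps)
  have m1: "- \<mu> - of_nat n = - (\<mu> + of_nat n)" "- of_nat n - \<mu> = - (\<mu> + of_nat n)" for n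
    by simp_all

  have p_sums: "(\<lambda>n. b n * p n * (4 * of_real u) ^ n * F n (- u)) sums R u"
    if "norm (4 * of_real u / (1 + of_real u)\<^sup>2 :: complex) < 1" "\<bar>u\<bar> < 1" for u
  proof -
    have "quad_root (4 * of_real u / (1 + of_real u)\<^sup>2) = of_real u"
      using that(2) by (intro quad_root_inverse) simp
    then show ?thesis
      using gen_p_expansion[OF that(1), of \<mu> \<nu>] by (simp only: F_def R_def p_def b_def of_real_minus)
  qed
  have norm_quad: "norm (4 * of_real u / (1 + of_real u)\<^sup>2 :: complex) = \<bar>4 * u / (1 + u)\<^sup>2\<bar>" for u
  proof -
    have "(4 * of_real u / (1 + of_real u)\<^sup>2 :: complex) = of_real (4 * u / (1 + u)\<^sup>2)" by simp
    then show ?thesis by (metis norm_of_real)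
  qed
  have g_sums: "(\<lambda>n. b n * g n * of_real v ^ n * H n v) sums S (- v)" if "\<bar>v\<bar> < 1" for v
    using gen_g_expansion[of "of_real v" "\<mu> - \<nu>" \<nu> \<mu> "1 + \<mu>"] that
    by (simp add: b_def g_def H_def S_def)

  have part_1a: "(\<lambda>n. (-1) ^ n * b n * p n / (2 powr (\<mu> - of_nat n) * of_real x powr (of_nat n + \<mu> - \<nu>)
                        * of_real (1 - x\<^sup>2) powr (- of_nat n / 2))
                   * legendre_P (\<nu> - \<mu> - of_nat n) (- \<mu> - of_nat n) (1 / x))
              sums (legendre_P \<nu> (- \<mu>) x / of_real (1 + x) powr \<mu>)"
    if x: "0 < x" "x < 1" and s: "(\<lambda>n. b n * p n * (4 * of_real (- w x)) ^ n * F n (w x)) sums R (- w x)" for x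
  proof -
    have "(-1) ^ n * b n * p n / (2 powr (\<mu> - of_nat n) * of_real x powr (of_nat n + \<mu> - \<nu>)
                        * of_real (1 - x\<^sup>2) powr (- of_nat n / 2))
                   * legendre_P (\<nu> - \<mu> - of_nat n) (- \<mu> - of_nat n) (1 / x)
        = K x * (b n * p n * (4 * of_real (- w x)) ^ n * F n (w x))" for n
    proof -
      have "(4 * of_real (- w x)) ^ n = ((-1) * (4 * of_real (w x) :: complex)) ^ n" by simp
      also have "\<dots> = (-1) ^ n * (4 * of_real (w x)) ^ n" by (rule power_mult_distrib)
      also have "(4 * of_real (w x)) ^ n = exp (of_nat n * (2 * L2 + LM x - LP x))"
        unfolding w_def LM_def LP_def L2_def by (rule four_times_power_exp[OF x])
      finally have pw: "(4 * of_real (- w x)) ^ n = (-1) ^ n * exp (of_nat n * (2 * L2 + LM x - LP x))" .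
      \<comment> \<open>The powers of \<open>x\<close> cancel; those of \<open>1 - x\<close>, \<open>1 + x\<close> and \<open>2\<close> depend on \<open>n\<close> through \<open>(4w)\<^sup>n\<close> only.\<close>
      have e: "exp ((\<mu> + of_nat n) / 2 * (LM x - LP x) + (\<nu> - \<mu> - of_nat n) * (LP x - L2 - LX x)) =
         K x * exp (of_nat n * (2 * L2 + LM x - LP x)) *
         (exp ((\<mu> - of_nat n) * L2) * exp ((of_nat n + \<mu> - \<nu>) * LX x) * exp (- of_nat n / 2 * (LM x + LP x)))"
        unfolding K_def exp_add[symmetric] by (rule arg_cong[of _ _ exp]) (simp add: field_simps)
      show ?thesis
        unfolding m1 P_gt[OF x] F_eq pw powr_exps[OF x] LM_def[of x, symmetric] LP_def[of x, symmetric] L2_def[symmetric] LX_def[of x, symmetric] e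
        by simp
    qed
    moreover have "legendre_P \<nu> (- \<mu>) x / of_real (1 + x) powr \<mu> = K x * R (- w x)"
      unfolding P_lt[OF x] R_def[symmetric] powr_exps[OF x] LP_def[of x, symmetric] K_def exp_diff by simp
    ultimately show ?thesis using sums_mult[OF s, of "K x"] by simp
  qed

  have part_1b: "(\<lambda>n. (-1) ^ n * b n * g n * (of_real (1 - x) powr (of_nat n / 2) * legendre_P \<nu> (- \<mu> - of_nat n) x
                        / of_real (1 + x) powr (of_nat n / 2 + \<mu>)))
              sums (legendre_P (\<nu> - \<mu>) (- \<mu>) (1 / x) / (2 powr \<mu> * of_real x powr (\<mu> - \<nu>)))"
    if x: "0 < x" "x < 1" for x
  proof -
    have s: "(\<lambda>n. b n * g n * of_real (- w x) ^ n * H n (- w x)) sums S (w x)"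
      using g_sums[of "- w x"] w[OF x] by simp
    have "(-1) ^ n * b n * g n * (of_real (1 - x) powr (of_nat n / 2) * legendre_P \<nu> (- \<mu> - of_nat n) x
                        / of_real (1 + x) powr (of_nat n / 2 + \<mu>))
        = K x * (b n * g n * of_real (- w x) ^ n * H n (- w x))" for n
    proof -
      have "of_real (- w x) ^ n = ((-1) * (of_real (w x) :: complex)) ^ n" by simp
      also have "\<dots> = (-1) ^ n * of_real (w x) ^ n" by (rule power_mult_distrib)
      also have "of_real (w x) ^ n = exp (of_nat n * (LM x - LP x))"
        unfolding w_def LM_def LP_def by (rule power_ratio_exp[OF x])
      finally have pw: "of_real (- w x) ^ n = (-1) ^ n * exp (of_nat n * (LM x - LP x))" .
      have e: "exp (of_nat n / 2 * LM x) * exp ((\<mu> + of_nat n) / 2 * (LM x - LP x) + \<nu> * (LP x - L2)) =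
         K x * exp (of_nat n * (LM x - LP x)) * exp ((of_nat n / 2 + \<mu>) * LP x)"
        unfolding K_def exp_add[symmetric] by (rule arg_cong[of _ _ exp]) (simp add: field_simps)
      show ?thesis
        unfolding m1 P_lt[OF x] H_eq pw powr_exps[OF x] LM_def[of x, symmetric] LP_def[of x, symmetric] mult.assoc[symmetric] e
        by simp
    qed
    moreover have "legendre_P (\<nu> - \<mu>) (- \<mu>) (1 / x) / (2 powr \<mu> * of_real x powr (\<mu> - \<nu>)) = K x * S (w x)"
    proof -
      have e: "exp (\<mu> / 2 * (LM x - LP x) + (\<nu> - \<mu>) * (LP x - L2 - LX x)) = K x * (exp (\<mu> * L2) * exp ((\<mu> - \<nu>) * LX x))"
        unfolding K_def exp_add[symmetric] by (rule arg_cong[of _ _ exp]) (simp add: field_simps)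
      show ?thesis
        unfolding P_gt[OF x] S_eq powr_exps[OF x] LX_def[of x, symmetric] L2_def[symmetric] e by simp
    qed
    ultimately show ?thesis using sums_mult[OF s, of "K x"] by simp
  qed

  have part_2a: "(\<lambda>n. b n * p n / (2 powr (\<mu> - of_nat n) * of_real (1 - x\<^sup>2) powr (- of_nat n / 2))
                   * legendre_P (\<nu> - \<mu> - of_nat n) (- of_nat n - \<mu>) x)
              sums (of_real x powr \<nu> * legendre_P \<nu> (- \<mu>) (1 / x) / of_real (1 + x) powr \<mu>)"
    if x: "0 < x" "x < 1" for x
  proof -
    have q: "4 * w x / (1 + w x)\<^sup>2 = 1 - x\<^sup>2" unfolding w_def by (rule quad_arg(1)[OF x])
    have "0 < x\<^sup>2" "x\<^sup>2 < 1" using x by (simp_all add: power_less_one_iff)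
    then have "norm (4 * of_real (w x) / (1 + of_real (w x))\<^sup>2 :: complex) < 1"
      unfolding norm_quad q by simp
    then have s: "(\<lambda>n. b n * p n * (4 * of_real (w x)) ^ n * F n (- w x)) sums R (w x)"
      using w[OF x] by (intro p_sums) auto
    have "b n * p n / (2 powr (\<mu> - of_nat n) * of_real (1 - x\<^sup>2) powr (- of_nat n / 2))
                   * legendre_P (\<nu> - \<mu> - of_nat n) (- of_nat n - \<mu>) x
        = K x * (b n * p n * (4 * of_real (w x)) ^ n * F n (- w x))" for n
    proof -
      have pw: "(4 * of_real (w x)) ^ n = exp (of_nat n * (2 * L2 + LM x - LP x))"
        unfolding w_def LM_def LP_def L2_def by (rule four_times_power_exp[OF x])
      have e: "exp ((\<mu> + of_nat n) / 2 * (LM x - LP x) + (\<nu> - \<mu> - of_nat n) * (LP x - L2)) =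
         K x * exp (of_nat n * (2 * L2 + LM x - LP x)) *
         (exp ((\<mu> - of_nat n) * L2) * exp (- of_nat n / 2 * (LM x + LP x)))"
        unfolding K_def exp_add[symmetric] by (rule arg_cong[of _ _ exp]) (simp add: field_simps)
      show ?thesis
        unfolding m1 P_lt[OF x] F_eq pw powr_exps[OF x] LM_def[of x, symmetric] LP_def[of x, symmetric] L2_def[symmetric] e
        by simp
    qed
    moreover have "of_real x powr \<nu> * legendre_P \<nu> (- \<mu>) (1 / x) / of_real (1 + x) powr \<mu> = K x * R (w x)"
    proof -
      have e: "exp (\<nu> * LX x) * exp (\<mu> / 2 * (LM x - LP x) + \<nu> * (LP x - L2 - LX x)) = K x * exp (\<mu> * LP x)"
        unfolding K_def exp_add[symmetric] by (rule arg_cong[of _ _ exp]) (simp add: field_simps)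
      show ?thesis
        unfolding P_gt[OF x] R_def[symmetric] powr_exps[OF x] LX_def[of x, symmetric] LP_def[of x, symmetric] mult.assoc[symmetric] e by simp
    qed
    ultimately show ?thesis using sums_mult[OF s, of "K x"] by simp
  qed

  have part_2b: "(\<lambda>n. b n * g n * (of_real (1 - x) powr (of_nat n / 2) * legendre_P \<nu> (- of_nat n - \<mu>) (1 / x)
                        / of_real (1 + x) powr (of_nat n / 2 + \<mu>)))
              sums (legendre_P (\<nu> - \<mu>) (- \<mu>) x / (2 powr \<mu> * of_real x powr \<nu>))"
    if x: "0 < x" "x < 1" for x
  proof -
    have s: "(\<lambda>n. b n * g n * of_real (w x) ^ n * H n (w x)) sums S (- w x)"
      using g_sums[of "w x"] w[OF x] by simp
    have "b n * g n * (of_real (1 - x) powr (of_nat n / 2) * legendre_P \<nu> (- of_nat n - \<mu>) (1 / x)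
                        / of_real (1 + x) powr (of_nat n / 2 + \<mu>))
        = K x * exp (- \<nu> * LX x) * (b n * g n * of_real (w x) ^ n * H n (w x))" for n
    proof -
      have pw: "of_real (w x) ^ n = exp (of_nat n * (LM x - LP x))"
        unfolding w_def LM_def LP_def by (rule power_ratio_exp[OF x])
      have e: "exp (of_nat n / 2 * LM x) * exp ((\<mu> + of_nat n) / 2 * (LM x - LP x) + \<nu> * (LP x - L2 - LX x)) =
         K x * exp (- \<nu> * LX x) * exp (of_nat n * (LM x - LP x)) * exp ((of_nat n / 2 + \<mu>) * LP x)"
        unfolding K_def exp_add[symmetric] by (rule arg_cong[of _ _ exp]) (simp add: field_simps)
      show ?thesis
        unfolding m1 P_gt[OF x] H_eq pw powr_exps[OF x] LM_def[of x, symmetric] LP_def[of x, symmetric] mult.assoc[symmetric] e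
        by simp
    qed
    moreover have "legendre_P (\<nu> - \<mu>) (- \<mu>) x / (2 powr \<mu> * of_real x powr \<nu>) = K x * exp (- \<nu> * LX x) * S (- w x)"
    proof -
      have e: "exp (\<mu> / 2 * (LM x - LP x) + (\<nu> - \<mu>) * (LP x - L2)) = K x * exp (- \<nu> * LX x) * (exp (\<mu> * L2) * exp (\<nu> * LX x))"
        unfolding K_def exp_add[symmetric] by (rule arg_cong[of _ _ exp]) (simp add: field_simps)
      show ?thesis
        unfolding P_lt[OF x] S_eq powr_exps[OF x] LX_def[of x, symmetric] L2_def[symmetric] e by simp
    qed
    ultimately show ?thesis using sums_mult[OF s, of "K x * exp (- \<nu> * LX x)"] by simp
  qed

  have p_sums_interval: "(\<lambda>n. b n * p n * (4 * of_real (- w x)) ^ n * F n (w x)) sums R (- w x)"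
    if x: "1 / sqrt 2 < x" "x < 1" for x
  proof -
    have x0: "0 < x" using x(1) by (rule less_trans[rotated]) simp
    have "(1 / sqrt 2)\<^sup>2 < x\<^sup>2" using x by (intro power_strict_mono) auto
    then have half: "1 / 2 < x\<^sup>2" by (simp add: power_divide)
    have "x\<^sup>2 < 1" using x0 x by (simp add: power_less_one_iff)
    have q: "4 * (- w x) / (1 + (- w x))\<^sup>2 = - (1 - x\<^sup>2) / x\<^sup>2"
      unfolding w_def by (rule quad_arg(2)[OF x0 x(2)])
    have "\<bar>- (1 - x\<^sup>2) / x\<^sup>2\<bar> < 1"
    proof -
      have "0 < x\<^sup>2" using x0 by simp
      then have "0 < (1 - x\<^sup>2) / x\<^sup>2" "(1 - x\<^sup>2) / x\<^sup>2 < 1"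
        using half \<open>x\<^sup>2 < 1\<close> by (simp_all add: pos_divide_less_eq)
      then show ?thesis unfolding minus_divide_left[symmetric] abs_minus_cancel by simp
    qed
    then have "norm (4 * of_real (- w x) / (1 + of_real (- w x))\<^sup>2 :: complex) < 1"
      unfolding norm_quad q .
    then show ?thesis using p_sums[of "- w x"] w[OF x0 x(2)] by simp
  qed
  have p_sums_boundary: "(\<lambda>n. b n * p n * (4 * of_real (- w x)) ^ n * F n (w x)) sums R (- w x)"
    if "x = 1 / sqrt 2" "Re \<nu> > - 2 / 3" for x
  proof -
    have nz: "sqrt 2 + 1 \<noteq> 0" using real_sqrt_ge_zero[of 2] by linarith
    have ratio: "(1 - 1 / s) / (1 + 1 / s) = (s - 1) / (s + 1)" if "s > 0" for s :: real
    proof -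
      have "1 - 1 / s = (s - 1) / s" "1 + 1 / s = (s + 1) / s"
        using that by (simp_all add: diff_divide_distrib add_divide_distrib)
      then show ?thesis using that by simp
    qed
    have "w x = (sqrt 2 - 1) / (sqrt 2 + 1)"
      unfolding w_def that(1) by (rule ratio) simp
    also have "\<dots> = 3 - 2 * sqrt 2"
    proof -
      have "(3 - 2 * sqrt 2) * (sqrt 2 + 1) = sqrt 2 - 1" by (simp add: algebra_simps)
      with nz show ?thesis by (simp add: field_simps)
    qed
    finally have "of_real (- w x) = (of_real (2 * sqrt 2 - 3) :: complex)" by simp
    moreover have "of_real (w x) = - (of_real (- w x) :: complex)" by simp
    ultimately show ?thesis
      using gen_p_expansion_boundary[OF that(2), of \<mu>] unfolding F_def R_def p_def b_def by metis
  qed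
  have p_sums_terminating: "(\<lambda>n. b n * p n * (4 * of_real (- w x)) ^ n * F n (w x)) sums R (- w x)"
    if x: "0 < x" "x < 1" and N: "\<nu> - \<mu> \<in> \<nat>" for x
  proof -
    from N obtain M where "\<nu> - \<mu> = of_nat M" by (auto elim: Nats_cases)
    then have M: "\<mu> - \<nu> = - of_nat M" by (metis minus_diff_eq)
    have "norm (of_real (- w x) :: complex) < 1" using wn(2)[OF x] by simp
    from gen_p_expansion_terminating[OF this, of M \<nu> \<mu> "1 + \<mu>"] show ?thesis
      by (simp add: F_def R_def p_def b_def M)
  qed

  have "0 < 1 / sqrt 2" "1 / sqrt 2 < 1" by simp_all
  then have conj_1a: "(\<lambda>n. (-1) ^ n * b n * p n / (2 powr (\<mu> - of_nat n) * of_real x powr (of_nat n + \<mu> - \<nu>)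
                        * of_real (1 - x\<^sup>2) powr (- of_nat n / 2))
                   * legendre_P (\<nu> - \<mu> - of_nat n) (- \<mu> - of_nat n) (1 / x))
              sums (legendre_P \<nu> (- \<mu>) x / of_real (1 + x) powr \<mu>)"
    if "(1 / sqrt 2 < x \<and> x < 1) \<or> (x = 1 / sqrt 2 \<and> Re \<nu> > - 2 / 3) \<or> (0 < x \<and> x < 1 \<and> \<nu> - \<mu> \<in> \<nat>)" for x
  proof -
    have "0 < x" "x < 1" using that \<open>0 < 1 / sqrt 2\<close> \<open>1 / sqrt 2 < 1\<close> by linarith+
    moreover from that have "(\<lambda>n. b n * p n * (4 * of_real (- w x)) ^ n * F n (w x)) sums R (- w x)"
      using p_sums_interval[of x] p_sums_boundary[of x] p_sums_terminating[of x] by blast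
    ultimately show ?thesis by (rule part_1a)
  qed
  show ?thesis
    using conj_1a part_1b part_2a part_2b unfolding b_def p_def g_def by (intro conjI allI impI) blast+
qed

end
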